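(* Let $a>b>0$ and $\lambda\ne0$. The system of equations of motion of the Kowalevski gyrostat in two constant fields on $P^6$, written in the complex coordinates $w_i,x_j,y_j,z_j$, has the four-dimensional invariant submanifold $\mathfrak O_*$ defined by the equations $U_1=0,\ U_2=0$, where $$U_1=\frac{y_2w_1+x_1w_2+z_1(w_3+\lambda)}{w_1}-\frac{x_2w_1+y_1w_2+z_2(w_3+\lambda)}{w_2},\qquad U_2=w_1w_2\,U_1',$$ the prime denoting the derivative $d/d(it)$ in virtue of the system. The Poisson bracket $\{U_1,U_2\}$ is non-zero almost everywhere on this submanifold.
   Context: Phase space. Fix real $a>b>0$ and $\lambda\ne0$; put $p=\sqrt{a^2+b^2}$, $r=\sqrt{a^2-b^2}$. $P^6=\{(\boldsymbol\omega,\boldsymbol\alpha,\boldsymbol\beta)\in\mathbb R^3\times\mathbb R^3\times\mathbb R^3:\ \boldsymbol\alpha\cdot\boldsymbol\alpha=a^2,\ \boldsymbol\beta\cdot\boldsymbol\beta=b^2,\ \boldsymbol\alpha\cdot\boldsymbol\beta=0\}$. The gyrostat equations are $2\dot\omega_1=\omega_2(\omega_3-\lambda)+\beta_3$, $2\dot\omega_2=-\omega_1(\omega_3-\lambda)-\alpha_3$, $\dot\omega_3=\alpha_2-\beta_1$, $\dot{\boldsymbol\alpha}=\boldsymbol\alpha\times\boldsymbol\omega$, $\dot{\boldsymbol\beta}=\boldsymbol\beta\times\boldsymbol\omega$. Complex coordinates ($i^2=-1$): $x_1=(\alpha_1-\beta_2)+i(\alpha_2+\beta_1)$, $x_2=(\alpha_1-\beta_2)-i(\alpha_2+\beta_1)$,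 $y_1=(\alpha_1+\beta_2)+i(\alpha_2-\beta_1)$, $y_2=(\alpha_1+\beta_2)-i(\alpha_2-\beta_1)$, $z_1=\alpha_3+i\beta_3$, $z_2=\alpha_3-i\beta_3$, $w_1=\omega_1+i\omega_2$, $w_2=\omega_1-i\omega_2$, $w_3=\omega_3$. In these coordinates, with prime denoting $d/d(it)$, the equations of motion are $$2w_1'=-w_1(w_3-\lambda)-z_1,\quad 2w_2'=w_2(w_3-\lambda)+z_2,\quad 2w_3'=y_2-y_1,$$ $$x_1'=-x_1w_3+z_1w_1,\quad x_2'=x_2w_3-z_2w_2,\quad y_1'=-y_1w_3+z_2w_1,\quad y_2'=y_2w_3-z_1w_2,$$ $$2z_1'=x_1w_2-y_2w_1,\quad 2z_2'=-x_2w_1+y_1w_2,$$ and $P^6$ is given by $z_1^2+x_1y_2=r^2$, $z_2^2+x_2y_1=r^2$, $x_1x_2+y_1y_2+2z_1z_2=2p^2$. The functions $U_1,U_2$ are considered where they are defined ($w_1w_2\ne0$). Poisson bracket: with $\mathbf M=(M_1,M_2,M_3)=(2\omega_1,2\omega_2,\omega_3+\lambda)$, it is determined by $\{M_i,M_j\}=\varepsilon_{ijk}M_k$, $\{M_i,\alpha_j\}=\varepsilon_{ijk}\alpha_k$, $\{M_i,\beta_j\}=\varepsilon_{ijk}\beta_k$, $\{\alpha_i,\alpha_j\}=\{\alpha_i,\beta_j\}=\{\beta_i,\beta_j\}=0$ (extended complex-bilinearly). "Almost everywhere on $\mathfrak O_*$" means outside a subset of measure zero in $\mathfrak O_*$.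 *)

theory Defs
  imports "HOL-Analysis.Analysis"
begin

section \<open>Smooth maps, submanifolds and null sets in submanifolds\<close>

text \<open>The following two predicates are meant for open \<open>S\<close>.\<close>

primrec Ck_on :: "nat \<Rightarrow> 'a::euclidean_space set \<Rightarrow> ('a \<Rightarrow> 'b::real_normed_vector) \<Rightarrow> bool" where
  "Ck_on 0 S f \<longleftrightarrow> continuous_on S f"
| "Ck_on (Suc k) S f \<longleftrightarrow>
     (\<forall>x\<in>S. f differentiable at x) \<and> (\<forall>v. Ck_on k S (\<lambda>x. frechet_derivative f (at x) v))"

definition smooth_on :: "'a::euclidean_space set \<Rightarrow> ('a \<Rightarrow> 'b::real_normed_vector) \<Rightarrow> bool" where
  "smooth_on S f \<longleftrightarrow> (\<forall>k. Ck_on k S f)"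

text \<open>Embedded \<open>k\<close>-dimensional submanifolds of Euclidean space: locally the common zero set of
  \<open>DIM('a) - k\<close> smooth real functions whose differentials are linearly independent.\<close>

definition submanifold :: "nat \<Rightarrow> 'a::euclidean_space set \<Rightarrow> bool" where
  "submanifold k S \<longleftrightarrow> k \<le> DIM('a) \<and>
     (\<forall>p\<in>S. \<exists>U (g :: nat \<Rightarrow> 'a \<Rightarrow> real).
        open U \<and> p \<in> U \<and>
        (\<forall>i < DIM('a) - k. smooth_on U (g i)) \<and>
        S \<inter> U = {x \<in> U. \<forall>i < DIM('a) - k. g i x = 0} \<and>
        (\<forall>x \<in> S \<inter> U. \<forall>c :: nat \<Rightarrow> real.
           (\<forall>v. (\<Sum>i < DIM('a) - k. c i * frechet_derivative (g i) (at x) v) = 0) \<longrightarrow>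
           (\<forall>i < DIM('a) - k. c i = 0)))"

text \<open>Smooth local parametrizations (inverses of charts) of a submanifold \<open>S\<close>; the type
  \<open>'b\<close> of the parameter domain carries the dimension of \<open>S\<close>.\<close>

definition local_parametrization ::
  "'a::euclidean_space set \<Rightarrow> 'b::euclidean_space set \<Rightarrow> ('b \<Rightarrow> 'a) \<Rightarrow> bool" where
  "local_parametrization S V \<psi> \<longleftrightarrow>
     open V \<and> smooth_on V \<psi> \<and> (\<forall>v\<in>V. inj (frechet_derivative \<psi> (at v))) \<and>
     openin (top_of_set S) (\<psi> ` V) \<and> (\<exists>\<phi>. homeomorphism V (\<psi> ` V) \<psi> \<phi>)"

text \<open>\<open>N\<close> has measure zero in the four-dimensional submanifold \<open>S\<close>: in every chart
  it corresponds to a Lebesgue null set.\<close>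

definition null_in4 :: "'a::euclidean_space set \<Rightarrow> 'a set \<Rightarrow> bool" where
  "null_in4 S N \<longleftrightarrow> N \<subseteq> S \<and>
     (\<forall>(V :: (real^4) set) \<psi>. local_parametrization S V \<psi> \<longrightarrow> negligible {v \<in> V. \<psi> v \<in> N})"


section \<open>The gyrostat in two constant fields\<close>

text \<open>A state is a triple \<open>(\<omega>, \<alpha>, \<beta>)\<close>.\<close>

type_synonym state = "(real^3) \<times> (real^3) \<times> (real^3)"

definition P6 :: "real \<Rightarrow> real \<Rightarrow> state set" where
  "P6 a b = {(\<omega>, \<alpha>, \<beta>). \<alpha> \<bullet> \<alpha> = a\<^sup>2 \<and> \<beta> \<bullet> \<beta> = b\<^sup>2 \<and> \<alpha> \<bullet> \<beta> = 0}"

definition gyrostat_field :: "real \<Rightarrow> state \<Rightarrow> state" where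
  "gyrostat_field lam = (\<lambda>(\<omega>, \<alpha>, \<beta>).
     (vector [(\<omega>$2 * (\<omega>$3 - lam) + \<beta>$3) / 2,
              (- \<omega>$1 * (\<omega>$3 - lam) - \<alpha>$3) / 2,
              \<alpha>$2 - \<beta>$1],
      cross3 \<alpha> \<omega>,
      cross3 \<beta> \<omega>))"

definition gyrostat_solution :: "real \<Rightarrow> real set \<Rightarrow> (real \<Rightarrow> state) \<Rightarrow> bool" where
  "gyrostat_solution lam I \<gamma> \<longleftrightarrow>
     (\<forall>t\<in>I. (\<gamma> has_vector_derivative gyrostat_field lam (\<gamma> t)) (at t within I))"

definition X1 :: "state \<Rightarrow> complex" where
  "X1 = (\<lambda>(\<omega>, \<alpha>, \<beta>). of_real (\<alpha>$1 - \<beta>$2) + \<i> * of_real (\<alpha>$2 + \<beta>$1))"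
definition X2 :: "state \<Rightarrow> complex" where
  "X2 = (\<lambda>(\<omega>, \<alpha>, \<beta>). of_real (\<alpha>$1 - \<beta>$2) - \<i> * of_real (\<alpha>$2 + \<beta>$1))"
definition Y1 :: "state \<Rightarrow> complex" where
  "Y1 = (\<lambda>(\<omega>, \<alpha>, \<beta>). of_real (\<alpha>$1 + \<beta>$2) + \<i> * of_real (\<alpha>$2 - \<beta>$1))"
definition Y2 :: "state \<Rightarrow> complex" where
  "Y2 = (\<lambda>(\<omega>, \<alpha>, \<beta>). of_real (\<alpha>$1 + \<beta>$2) - \<i> * of_real (\<alpha>$2 - \<beta>$1))"
definition Z1 :: "state \<Rightarrow> complex" where
  "Z1 = (\<lambda>(\<omega>, \<alpha>, \<beta>). of_real (\<alpha>$3) + \<i> * of_real (\<beta>$3))"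
definition Z2 :: "state \<Rightarrow> complex" where
  "Z2 = (\<lambda>(\<omega>, \<alpha>, \<beta>). of_real (\<alpha>$3) - \<i> * of_real (\<beta>$3))"
definition W1 :: "state \<Rightarrow> complex" where
  "W1 = (\<lambda>(\<omega>, \<alpha>, \<beta>). of_real (\<omega>$1) + \<i> * of_real (\<omega>$2))"
definition W2 :: "state \<Rightarrow> complex" where
  "W2 = (\<lambda>(\<omega>, \<alpha>, \<beta>). of_real (\<omega>$1) - \<i> * of_real (\<omega>$2))"
definition W3 :: "state \<Rightarrow> complex" where
  "W3 = (\<lambda>(\<omega>, \<alpha>, \<beta>). of_real (\<omega>$3))"

lemmas complex_coords = X1_def X2_def Y1_def Y2_def Z1_def Z2_def W1_def W2_def W3_def

text \<open>The derivative \<open>d/d(it)\<close> in virtue of the system.\<close>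

definition prime_deriv :: "real \<Rightarrow> (state \<Rightarrow> complex) \<Rightarrow> state \<Rightarrow> complex" where
  "prime_deriv lam f s = frechet_derivative f (at s) (gyrostat_field lam s) / \<i>"

definition U1 :: "real \<Rightarrow> state \<Rightarrow> complex" where
  "U1 lam s =
     (Y2 s * W1 s + X1 s * W2 s + Z1 s * (W3 s + of_real lam)) / W1 s
   - (X2 s * W1 s + Y1 s * W2 s + Z2 s * (W3 s + of_real lam)) / W2 s"

definition U2 :: "real \<Rightarrow> state \<Rightarrow> complex" where
  "U2 lam s = W1 s * W2 s * prime_deriv lam (U1 lam) s"

text \<open>The set where \<open>U1\<close> and \<open>U2\<close> are considered; outside it their values are
  artefacts of \<open>x / 0 = 0\<close>.\<close>

definition U_domain :: "state set" where
  "U_domain = {s. W1 s * W2 s \<noteq> 0}"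

definition O_star :: "real \<Rightarrow> real \<Rightarrow> real \<Rightarrow> state set" where
  "O_star a b lam = {s \<in> P6 a b \<inter> U_domain. U1 lam s = 0 \<and> U2 lam s = 0}"

text \<open>Trajectories may leave or re-enter \<open>U_domain\<close>; invariance of \<open>S\<close> demands that a
  trajectory meeting \<open>S\<close> is in \<open>S\<close> at all times, past and future, at which it is
  in \<open>U_domain\<close>.\<close>

definition gyrostat_invariant :: "real \<Rightarrow> state set \<Rightarrow> bool" where
  "gyrostat_invariant lam S \<longleftrightarrow>
     (\<forall>I \<gamma> t0. is_interval I \<and> gyrostat_solution lam I \<gamma> \<and> t0 \<in> I \<and> \<gamma> t0 \<in> S \<longrightarrow>
        (\<forall>t\<in>I. \<gamma> t \<in> U_domain \<longrightarrow> \<gamma> t \<in> S))"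


section \<open>The Poisson bracket\<close>

definition levi_civita :: "3 \<Rightarrow> 3 \<Rightarrow> 3 \<Rightarrow> real" where
  "levi_civita i j k = cross3 (axis i 1) (axis j 1) $ k"

definition momentum :: "real \<Rightarrow> state \<Rightarrow> real^3" where
  "momentum lam = (\<lambda>(\<omega>, \<alpha>, \<beta>). vector [2 * \<omega>$1, 2 * \<omega>$2, \<omega>$3 + lam])"

text \<open>Partial derivatives with respect to the coordinates \<open>(M, \<alpha>, \<beta>)\<close>; in view of
  \<open>M = (2\<omega>\<^sub>1, 2\<omega>\<^sub>2, \<omega>\<^sub>3 + lam)\<close>, increasing \<open>M\<^sub>1\<close> or \<open>M\<^sub>2\<close> by one increases
  \<open>\<omega>\<^sub>1\<close> or \<open>\<omega>\<^sub>2\<close> by one half.\<close>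

definition dM :: "(state \<Rightarrow> complex) \<Rightarrow> state \<Rightarrow> 3 \<Rightarrow> complex" where
  "dM f s i = frechet_derivative f (at s) (axis i (if i = 3 then 1 else 1/2), 0, 0)"
definition dalpha :: "(state \<Rightarrow> complex) \<Rightarrow> state \<Rightarrow> 3 \<Rightarrow> complex" where
  "dalpha f s i = frechet_derivative f (at s) (0, axis i 1, 0)"
definition dbeta :: "(state \<Rightarrow> complex) \<Rightarrow> state \<Rightarrow> 3 \<Rightarrow> complex" where
  "dbeta f s i = frechet_derivative f (at s) (0, 0, axis i 1)"

text \<open>The (complex-bilinear) biderivation with the structure functions recorded in the lemmas
  \<open>poisson_M_M\<close> to \<open>poisson_beta_beta\<close> below.\<close>

definition poisson :: "real \<Rightarrow> (state \<Rightarrow> complex) \<Rightarrow> (state \<Rightarrow> complex) \<Rightarrow> state \<Rightarrow> complex" where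
  "poisson lam f g s =
     (\<Sum>i\<in>UNIV. \<Sum>j\<in>UNIV. \<Sum>k\<in>UNIV. of_real (levi_civita i j k) *
        (dM f s i * dM g s j * of_real (momentum lam s $ k)
         + (dM f s i * dalpha g s j + dalpha f s i * dM g s j) * of_real (fst (snd s) $ k)
         + (dM f s i * dbeta g s j + dbeta f s i * dM g s j) * of_real (snd (snd s) $ k)))"


section \<open>Consistency with the structure functions and the complex form of the system\<close>

lemma frechet_linear:
  fixes f :: "state \<Rightarrow> complex"
  assumes "linear f"
  shows "frechet_derivative (\<lambda>s. f s + c) (at x) = f"
  by (rule frechet_derivative_at[symmetric])
     (auto intro!: derivative_eq_intros linear_imp_has_derivative assms)

abbreviation fM :: "real \<Rightarrow> 3 \<Rightarrow> state \<Rightarrow> complex" where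
  "fM lam i \<equiv> (\<lambda>s. of_real (momentum lam s $ i))"
abbreviation falpha :: "3 \<Rightarrow> state \<Rightarrow> complex" where
  "falpha i \<equiv> (\<lambda>s. of_real (fst (snd s) $ i))"
abbreviation fbeta :: "3 \<Rightarrow> state \<Rightarrow> complex" where
  "fbeta i \<equiv> (\<lambda>s. of_real (snd (snd s) $ i))"

lemma linear_coords:
  "linear (\<lambda>s::state. complex_of_real (c * fst s $ i))"
  "linear (falpha i)" "linear (fbeta i)"
  by (rule linearI; simp add: complex_eq_iff algebra_simps)+

lemma frechet_fM:
  "frechet_derivative (fM lam i) (at s) =
     (\<lambda>s. complex_of_real ((if i = 3 then 1 else 2) * fst s $ i))"
proof -
  have "fM lam i = (\<lambda>s. complex_of_real ((if i = 3 then 1 else 2) * fst s $ i)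
                        + of_real (if i = 3 then lam else 0))"
    using exhaust_3[of i] by (auto simp: momentum_def fun_eq_iff)
  then show ?thesis
    by (simp only: frechet_linear[OF linear_coords(1)])
qed

lemma frechet_falpha: "frechet_derivative (falpha i) (at s) = falpha i"
  using frechet_linear[OF linear_coords(2), of i 0] by simp

lemma frechet_fbeta: "frechet_derivative (fbeta i) (at s) = fbeta i"
  using frechet_linear[OF linear_coords(3), of i 0] by simp

lemma partials:
  "dM (fM lam i) s j = (if j = i then 1 else 0)" "dM (falpha i) s j = 0" "dM (fbeta i) s j = 0"
  "dalpha (fM lam i) s j = 0" "dalpha (falpha i) s j = (if j = i then 1 else 0)"
  "dalpha (fbeta i) s j = 0"
  "dbeta (fM lam i) s j = 0" "dbeta (falpha i) s j = 0"
  "dbeta (fbeta i) s j = (if j = i then 1 else 0)"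
  by (auto simp: dM_def dalpha_def dbeta_def frechet_fM frechet_falpha frechet_fbeta axis_def)

lemma poisson_M_M:
  "poisson lam (fM lam i) (fM lam j) s = (\<Sum>k\<in>UNIV. of_real (levi_civita i j k) * fM lam k s)"
  using exhaust_3[of i] exhaust_3[of j] by (auto simp: poisson_def partials sum_3)

lemma poisson_M_alpha:
  "poisson lam (fM lam i) (falpha j) s = (\<Sum>k\<in>UNIV. of_real (levi_civita i j k) * falpha k s)"
  using exhaust_3[of i] exhaust_3[of j] by (auto simp: poisson_def partials sum_3)

lemma poisson_M_beta:
  "poisson lam (fM lam i) (fbeta j) s = (\<Sum>k\<in>UNIV. of_real (levi_civita i j k) * fbeta k s)"
  using exhaust_3[of i] exhaust_3[of j] by (auto simp: poisson_def partials sum_3)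

lemma poisson_alpha_alpha: "poisson lam (falpha i) (falpha j) s = 0"
  by (simp add: poisson_def partials)

lemma poisson_alpha_beta: "poisson lam (falpha i) (fbeta j) s = 0"
  by (simp add: poisson_def partials)

lemma poisson_beta_beta: "poisson lam (fbeta i) (fbeta j) s = 0"
  by (simp add: poisson_def partials)

lemma linear_complex_coords:
  "linear X1" "linear X2" "linear Y1" "linear Y2" "linear Z1" "linear Z2"
  "linear W1" "linear W2" "linear W3"
  by (rule linearI; auto simp: complex_coords complex_eq_iff algebra_simps)+

lemma prime_deriv_linear:
  "linear f \<Longrightarrow> prime_deriv lam f s = f (gyrostat_field lam s) / \<i>"
  using frechet_linear[of f 0 s] by (simp add: prime_deriv_def)

lemma gyrostat_complex_form:
  "2 * prime_deriv lam W1 s = - W1 s * (W3 s - of_real lam) - Z1 s"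
  "2 * prime_deriv lam W2 s = W2 s * (W3 s - of_real lam) + Z2 s"
  "2 * prime_deriv lam W3 s = Y2 s - Y1 s"
  "prime_deriv lam X1 s = - X1 s * W3 s + Z1 s * W1 s"
  "prime_deriv lam X2 s = X2 s * W3 s - Z2 s * W2 s"
  "prime_deriv lam Y1 s = - Y1 s * W3 s + Z2 s * W1 s"
  "prime_deriv lam Y2 s = Y2 s * W3 s - Z1 s * W2 s"
  "2 * prime_deriv lam Z1 s = X1 s * W2 s - Y2 s * W1 s"
  "2 * prime_deriv lam Z2 s = - X2 s * W1 s + Y1 s * W2 s"
proof -
  obtain \<omega> \<alpha> \<beta> where s: "s = (\<omega>, \<alpha>, \<beta>)" by (cases s)
  note lin = linear_complex_coords[THEN prime_deriv_linear]
  note eqs = s complex_coords gyrostat_field_def cross3_def case_prod_conv vector_3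
  show "2 * prime_deriv lam W1 s = - W1 s * (W3 s - of_real lam) - Z1 s"
    unfolding lin unfolding eqs complex_eq_iff by (simp add: field_simps)
  show "2 * prime_deriv lam W2 s = W2 s * (W3 s - of_real lam) + Z2 s"
    unfolding lin unfolding eqs complex_eq_iff by (simp add: field_simps)
  show "2 * prime_deriv lam W3 s = Y2 s - Y1 s"
    unfolding lin unfolding eqs complex_eq_iff by (simp add: field_simps)
  show "prime_deriv lam X1 s = - X1 s * W3 s + Z1 s * W1 s"
    unfolding lin unfolding eqs complex_eq_iff by (simp add: field_simps)
  show "prime_deriv lam X2 s = X2 s * W3 s - Z2 s * W2 s"
    unfolding lin unfolding eqs complex_eq_iff by (simp add: field_simps)
  show "prime_deriv lam Y1 s = - Y1 s * W3 s + Z2 s * W1 s"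
    unfolding lin unfolding eqs complex_eq_iff by (simp add: field_simps)
  show "prime_deriv lam Y2 s = Y2 s * W3 s - Z1 s * W2 s"
    unfolding lin unfolding eqs complex_eq_iff by (simp add: field_simps)
  show "2 * prime_deriv lam Z1 s = X1 s * W2 s - Y2 s * W1 s"
    unfolding lin unfolding eqs complex_eq_iff by (simp add: field_simps)
  show "2 * prime_deriv lam Z2 s = - X2 s * W1 s + Y1 s * W2 s"
    unfolding lin unfolding eqs complex_eq_iff by (simp add: field_simps)
qed

lemma P6_complex_form:
  assumes "s \<in> P6 a b"
  shows "(Z1 s)\<^sup>2 + X1 s * Y2 s = of_real (a\<^sup>2 - b\<^sup>2)"
    and "(Z2 s)\<^sup>2 + X2 s * Y1 s = of_real (a\<^sup>2 - b\<^sup>2)"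
    and "X1 s * X2 s + Y1 s * Y2 s + 2 * Z1 s * Z2 s = of_real (2 * (a\<^sup>2 + b\<^sup>2))"
proof -
  obtain \<omega> \<alpha> \<beta> where s: "s = (\<omega>, \<alpha>, \<beta>)" by (cases s)
  have a: "a\<^sup>2 = \<alpha>$1 * \<alpha>$1 + \<alpha>$2 * \<alpha>$2 + \<alpha>$3 * \<alpha>$3"
    and b: "b\<^sup>2 = \<beta>$1 * \<beta>$1 + \<beta>$2 * \<beta>$2 + \<beta>$3 * \<beta>$3"
    and ab: "\<alpha>$1 * \<beta>$1 + \<alpha>$2 * \<beta>$2 + \<alpha>$3 * \<beta>$3 = 0"
    using assms by (simp_all add: s P6_def inner_vec_def sum_3)
  note eqs = s complex_coords case_prod_conv complex_eq_iff power2_eq_square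
  show "(Z1 s)\<^sup>2 + X1 s * Y2 s = of_real (a\<^sup>2 - b\<^sup>2)"
    unfolding a b unfolding eqs using ab by (simp, simp add: algebra_simps)
  show "(Z2 s)\<^sup>2 + X2 s * Y1 s = of_real (a\<^sup>2 - b\<^sup>2)"
    unfolding a b unfolding eqs using ab by (simp, simp add: algebra_simps)
  show "X1 s * X2 s + Y1 s * Y2 s + 2 * Z1 s * Z2 s = of_real (2 * (a\<^sup>2 + b\<^sup>2))"
    unfolding a b unfolding eqs by (simp add: algebra_simps)
qed

end

theory Submission
  imports Defs
begin

text \<open>
  Let \<open>C\<close> be the quotient of \<open>M \<bullet> (\<alpha> + \<i> \<beta>)\<close> by \<open>w\<^sub>1\<close>, where \<open>M\<close> is the momentum. Then
  \<open>U1 = C - cnj C\<close>, so \<open>U1 = 0\<close> says that \<open>C\<close> is real. The derivative of \<open>C\<close> in virtue of the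
  system is \<open>T/2\<close> for an explicit function \<open>T\<close> (\<open>areas_speed\<close>), which turns out to be real
  wherever \<open>C\<close> is real; as \<open>U2 = w\<^sub>1 w\<^sub>2 Re T\<close>, the set \<open>O_star\<close> consists of the points of \<open>P6\<close> at
  which \<open>w\<^sub>1\<close> does not vanish, \<open>C\<close> is real and \<open>T = 0\<close>.

  Invariance. On \<open>O_star\<close> the value \<open>c\<close> of \<open>C\<close> is a constant of motion. For fixed real \<open>c\<close> the
  equations \<open>C = c\<close> and \<open>T = 0\<close>, cleared of denominators, and one consequence of them form three
  polynomial residuals whose derivatives are linear combinations of the residuals and their
  conjugates (\<open>residual_derivatives\<close>). Uniqueness for linear differential equations keeps them
  zero, also across times at which \<open>w\<^sub>1 = 0\<close>.

  Smoothness. The manifold is cut out by five functions: three Casimir functions, \<open>Im C\<close> and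
  \<open>Re T\<close>. In coordinates adapted to the rotational symmetry of the equations, a linear relation
  between their differentials becomes a small system of polynomial equations for the multipliers
  (\<open>functional_reduced\<close>), and eliminating shows that it has only the trivial solution
  (\<open>lagrange_multipliers\<close>). The elimination needs \<open>c \<noteq> 0\<close>, which follows from the identity
  \<open>O_star_identity\<close>; its right-hand side is \<open>4 a\<^sup>2 b\<^sup>2\<close>.

  The bracket. The Hamiltonian field of \<open>U1\<close> is computed on the manifold in adapted coordinates
  (\<open>ham_direction_U1\<close>), and \<open>{U1, U2}\<close> is the derivative of \<open>U2\<close> along it. The result is
  \<open>- 2 \<i> c f\<close>, where \<open>c\<^sup>2 f = c\<^sup>3 k - c\<^sup>4/4 + 4 a\<^sup>2 b\<^sup>2\<close> and \<open>k\<close> is the energy plus \<open>c\<close> minus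
  \<open>\<lambda>\<^sup>2/2\<close> (\<open>poisson_U1_U2\<close>, \<open>degeneracy_identity\<close>). So the zero set of the bracket is \<open>f = 0\<close>. There
  the Hamiltonian field of \<open>U1\<close> is tangent to the manifold, and differentiating repeatedly along
  it, and along one further tangent vector supplied by the multiplier analysis, exhausts the zero
  set by five pieces on each of which some function vanishes with nonzero tangential derivative.
  Such pieces are null in every chart (\<open>negligible_in_chart\<close>).
\<close>

section \<open>Calculus of smooth maps\<close>

lemma Ck_on_Suc_imp: "Ck_on (Suc k) S f \<Longrightarrow> Ck_on k S f"
proof (induction k arbitrary: f)
  case 0
  then show ?case
    by (auto simp: differentiable_imp_continuous_within continuous_at_imp_continuous_on)
next
  case (Suc k)
  then show ?case by auto
qed

lemma Ck_on_cong:
  assumes "open S" "\<And>x. x \<in> S \<Longrightarrow> f x = g x" "Ck_on k S f"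
  shows "Ck_on k S g"
  using assms(2,3)
proof (induction k arbitrary: f g)
  case 0
  then show ?case by (simp cong: continuous_on_cong)
next
  case (Suc k)
  have der: "(g has_derivative frechet_derivative f (at x)) (at x)" if "x \<in> S" for x
    using Suc.prems that \<open>open S\<close>
    by (intro has_derivative_transform_within_open[of f _ x UNIV S g])
       (auto simp: frechet_derivative_works)
  then have eq: "frechet_derivative f (at x) = frechet_derivative g (at x)" if "x \<in> S" for x
    using frechet_derivative_at[OF der[OF that]] by simp
  have "Ck_on k S (\<lambda>x. frechet_derivative g (at x) v)" for v
  proof (rule Suc.IH)
    show "Ck_on k S (\<lambda>x. frechet_derivative f (at x) v)" using Suc.prems(2) by simp
  qed (simp add: eq)
  with der show ?case by (auto simp: differentiable_def)
qed

text \<open>The recursive clause for \<open>Ck_on\<close> speaks of the Frechet derivative; in practice an explicit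
  derivative is known on an open set, and this lemma lets it take the place of the
  Frechet derivative.\<close>

lemma Ck_on_SucI:
  assumes "open S" and "\<And>x. x \<in> S \<Longrightarrow> (f has_derivative f' x) (at x)"
    and "\<And>v. Ck_on k S (\<lambda>x. f' x v)"
  shows "Ck_on (Suc k) S f"
proof -
  have "frechet_derivative f (at x) = f' x" if "x \<in> S" for x
    using frechet_derivative_at[OF assms(2)[OF that]] by simp
  then have "Ck_on k S (\<lambda>x. frechet_derivative f (at x) v)" for v
    by (intro Ck_on_cong[OF assms(1) _ assms(3)[of v]]) simp
  with assms(2) show ?thesis by (auto simp: differentiable_def)
qed

lemma Ck_on_SucD:
  assumes "Ck_on (Suc k) S f"
  shows "\<And>x. x \<in> S \<Longrightarrow> (f has_derivative frechet_derivative f (at x)) (at x)"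
    and "\<And>v. Ck_on k S (\<lambda>x. frechet_derivative f (at x) v)"
  using assms by (auto simp: frechet_derivative_works)

lemma Ck_on_const: "Ck_on k S (\<lambda>x. c)"
  by (induction k arbitrary: c) simp_all

lemma Ck_on_bounded_linear:
  assumes "bounded_linear h" "open S" "Ck_on k S f"
  shows "Ck_on k S (\<lambda>x. h (f x))"
  using assms(3)
proof (induction k arbitrary: f)
  case 0
  then show ?case by (simp add: bounded_linear.continuous_on[OF assms(1)])
next
  case (Suc k)
  note f = Ck_on_SucD[OF Suc.prems]
  show ?case
    by (rule Ck_on_SucI[OF assms(2)])
       (auto intro!: bounded_linear.has_derivative[OF assms(1)] f(1) Suc.IH f(2))
qed

lemma Ck_on_add:
  assumes "open S" "Ck_on k S f" "Ck_on k S g"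
  shows "Ck_on k S (\<lambda>x. f x + g x)"
  using assms(2,3)
proof (induction k arbitrary: f g)
  case 0
  then show ?case by (simp add: continuous_on_add)
next
  case (Suc k)
  note f = Ck_on_SucD[OF Suc.prems(1)] and g = Ck_on_SucD[OF Suc.prems(2)]
  show ?case
    by (rule Ck_on_SucI[OF assms(1)]) (auto intro!: has_derivative_add f(1) g(1) Suc.IH f(2) g(2))
qed

lemma Ck_on_mult:
  fixes f g :: "'a::euclidean_space \<Rightarrow> 'b::real_normed_algebra"
  assumes "open S" "Ck_on k S f" "Ck_on k S g"
  shows "Ck_on k S (\<lambda>x. f x * g x)"
  using assms(2,3)
proof (induction k arbitrary: f g)
  case 0
  then show ?case by (simp add: continuous_on_mult)
next
  case (Suc k)
  note f = Ck_on_SucD[OF Suc.prems(1)] and g = Ck_on_SucD[OF Suc.prems(2)]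
  show ?case
    by (rule Ck_on_SucI[OF assms(1)])
       (auto intro!: has_derivative_mult f(1) g(1) Ck_on_add[OF assms(1)] Suc.IH f(2) g(2)
          Ck_on_Suc_imp[OF Suc.prems(1)] Ck_on_Suc_imp[OF Suc.prems(2)])
qed

lemma Ck_on_inverse:
  fixes f :: "'a::euclidean_space \<Rightarrow> 'b::real_normed_div_algebra"
  assumes "open S" "\<And>x. x \<in> S \<Longrightarrow> f x \<noteq> 0" "Ck_on k S f"
  shows "Ck_on k S (\<lambda>x. inverse (f x))"
  using assms(3)
proof (induction k)
  case 0
  then show ?case using assms(2) by (simp add: continuous_on_inverse)
next
  case (Suc k)
  note f = Ck_on_SucD[OF Suc.prems]
  have inv: "Ck_on k S (\<lambda>x. inverse (f x))"
    by (rule Suc.IH[OF Ck_on_Suc_imp[OF Suc.prems]])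
  show ?case
  proof (rule Ck_on_SucI[OF assms(1)])
    show "((\<lambda>x. inverse (f x)) has_derivative
        (\<lambda>v. - (inverse (f x) * frechet_derivative f (at x) v * inverse (f x)))) (at x)"
      if "x \<in> S" for x
      by (rule Deriv.has_derivative_inverse[OF assms(2)[OF that] f(1)[OF that]])
    show "Ck_on k S (\<lambda>x. - (inverse (f x) * frechet_derivative f (at x) v * inverse (f x)))" for v
      by (rule Ck_on_bounded_linear[OF bounded_linear_minus[OF bounded_linear_ident] assms(1)])
         (intro Ck_on_mult assms(1) inv f(2))
  qed
qed

named_theorems smooth_intros

lemma smooth_on_const [smooth_intros]: "smooth_on S (\<lambda>x. c)"
  by (simp add: smooth_on_def Ck_on_const)

lemma smooth_on_linear:
  assumes "linear f" shows "smooth_on S f"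
proof -
  have "frechet_derivative f (at x) = f" for x
    using linear_imp_has_derivative[OF assms] frechet_derivative_at by metis
  then have "Ck_on k S f" for k
    using linear_imp_differentiable[OF assms] linear_continuous_on[of f S] assms
    by (cases k) (auto simp: linear_conv_bounded_linear Ck_on_const)
  then show ?thesis by (simp add: smooth_on_def)
qed

lemma smooth_on_bounded_linear:
  "bounded_linear h \<Longrightarrow> open S \<Longrightarrow> smooth_on S f \<Longrightarrow> smooth_on S (\<lambda>x. h (f x))"
  by (simp add: smooth_on_def Ck_on_bounded_linear)

lemmas smooth_on_cnj [smooth_intros] = smooth_on_bounded_linear[OF bounded_linear_cnj]
lemmas smooth_on_Re [smooth_intros] = smooth_on_bounded_linear[OF bounded_linear_Re]
lemmas smooth_on_Im [smooth_intros] = smooth_on_bounded_linear[OF bounded_linear_Im]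

lemma smooth_on_add [smooth_intros]:
  "open S \<Longrightarrow> smooth_on S f \<Longrightarrow> smooth_on S g \<Longrightarrow> smooth_on S (\<lambda>x. f x + g x)"
  by (simp add: smooth_on_def Ck_on_add)

lemma smooth_on_diff [smooth_intros]:
  "open S \<Longrightarrow> smooth_on S f \<Longrightarrow> smooth_on S g \<Longrightarrow> smooth_on S (\<lambda>x. f x - g x)"
  using smooth_on_add[of S f "\<lambda>x. - g x"]
    smooth_on_bounded_linear[OF bounded_linear_minus[OF bounded_linear_ident], of S g] by simp

lemma smooth_on_mult [smooth_intros]:
  fixes f g :: "'a::euclidean_space \<Rightarrow> 'b::real_normed_algebra"
  shows "open S \<Longrightarrow> smooth_on S f \<Longrightarrow> smooth_on S g \<Longrightarrow> smooth_on S (\<lambda>x. f x * g x)"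
  by (simp add: smooth_on_def Ck_on_mult)

lemma smooth_on_divide [smooth_intros]:
  fixes f g :: "'a::euclidean_space \<Rightarrow> 'b::real_normed_field"
  shows "open S \<Longrightarrow> (\<And>x. x \<in> S \<Longrightarrow> g x \<noteq> 0) \<Longrightarrow> smooth_on S f \<Longrightarrow> smooth_on S g \<Longrightarrow>
    smooth_on S (\<lambda>x. f x / g x)"
  by (simp add: smooth_on_def Ck_on_mult Ck_on_inverse divide_inverse)

lemma smooth_on_has_derivative:
  "smooth_on S f \<Longrightarrow> x \<in> S \<Longrightarrow> (f has_derivative frechet_derivative f (at x)) (at x)"
  unfolding smooth_on_def by (metis Ck_on_SucD(1))

section \<open>Null sets and tangent spaces of submanifolds\<close>

text \<open>If the partial derivative of \<open>h\<close> in the direction \<open>i\<close> does not vanish, replacing the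
  coordinate \<open>i\<close> by the value of \<open>h\<close> is a map with injective derivative that sends the zero set
  of \<open>h\<close> into a coordinate hyperplane. Preimages of null sets under such maps are null,
  and finitely many directions \<open>i\<close> suffice.\<close>

lemma negligible_level_set:
  fixes h :: "'a::euclidean_space \<Rightarrow> real"
  assumes "\<And>x. x \<in> A \<Longrightarrow> h x = 0"
    and "\<And>x. x \<in> A \<Longrightarrow> (h has_derivative h' x) (at x)"
    and "\<And>x. x \<in> A \<Longrightarrow> \<exists>v. h' x v \<noteq> 0"
  shows "negligible A"
proof -
  define B where "B i = {x \<in> A. h' x i \<noteq> 0}" for i
  have "negligible (B i)" if i: "i \<in> Basis" for i
  proof -
    let ?f = "\<lambda>x. x + (h x - x \<bullet> i) *\<^sub>R i"
    have lin: "linear (h' x)" if "x \<in> B i" for x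
      using assms(2) that has_derivative_linear unfolding B_def by blast
    have "negligible {x \<in> B i. ?f x \<in> {x. x \<bullet> i = 0}}"
    proof (rule negligible_differentiable_vimage)
      show "negligible {x::'a. x \<bullet> i = 0}"
        using i by (rule negligible_standard_hyperplane)
      fix x assume x: "x \<in> B i"
      then have "(h has_derivative h' x) (at x within B i)"
        by (simp add: B_def has_derivative_at_withinI[OF assms(2)])
      then show "(?f has_derivative (\<lambda>v. v + (h' x v - v \<bullet> i) *\<^sub>R i)) (at x within B i)"
        by (intro has_derivative_add has_derivative_ident has_derivative_scaleR_left
            has_derivative_diff has_derivative_inner_left)
      show "inj (\<lambda>v. v + (h' x v - v \<bullet> i) *\<^sub>R i)"
      proof (subst linear_injective_0)
        show "linear (\<lambda>v. v + (h' x v - v \<bullet> i) *\<^sub>R i)"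
          using lin[OF x]
          by (intro linearI) (simp_all add: linear_add linear_scale algebra_simps)
        show "\<forall>v. v + (h' x v - v \<bullet> i) *\<^sub>R i = 0 \<longrightarrow> v = 0"
        proof (intro allI impI)
          fix v assume v: "v + (h' x v - v \<bullet> i) *\<^sub>R i = 0"
          then have "(v + (h' x v - v \<bullet> i) *\<^sub>R i) \<bullet> i = 0" by simp
          then have "h' x v = 0" using i by (simp add: inner_left_distrib)
          with v have "v = (v \<bullet> i) *\<^sub>R i" by simp
          then have "h' x v = (v \<bullet> i) * h' x i"
            using linear_scale[OF lin[OF x], of "v \<bullet> i" i] by simp
          with \<open>h' x v = 0\<close> x \<open>v = (v \<bullet> i) *\<^sub>R i\<close> show "v = 0" by (auto simp: B_def)
        qed
      qed
    qed
    moreover have "{x \<in> B i. ?f x \<in> {x. x \<bullet> i = 0}} = B i"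
      using i assms(1) by (auto simp: B_def inner_left_distrib)
    ultimately show ?thesis by simp
  qed
  moreover have "A \<subseteq> (\<Union>i\<in>Basis. B i)"
  proof
    fix x assume x: "x \<in> A"
    show "x \<in> (\<Union>i\<in>Basis. B i)"
    proof (rule ccontr)
      assume "x \<notin> (\<Union>i\<in>Basis. B i)"
      with x have "\<forall>i\<in>Basis. h' x i = 0" by (auto simp: B_def)
      then have "h' x v = 0" for v
        using linear_eq_0_on_span[of "h' x" Basis] has_derivative_linear[OF assms(2)[OF x]]
        by (metis iso_tuple_UNIV_I span_Basis)
      with assms(3)[OF x] show False by auto
    qed
  qed
  moreover have "negligible (\<Union>i\<in>Basis. B i)"
    using calculation(1) by (intro negligible_Union) auto
  ultimately show ?thesis
    using negligible_subset by blast
qed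

text \<open>The duality behind Lagrange multipliers: in terms of gradients, \<open>M\<close> is orthogonal to the
  orthogonal complement of a span, hence lies in the span.\<close>

lemma common_kernel_spans:
  fixes L :: "nat \<Rightarrow> 'a::euclidean_space \<Rightarrow> real"
  assumes "\<And>i. i < N \<Longrightarrow> linear (L i)" "linear M"
    and "\<And>v. (\<forall>i<N. L i v = 0) \<Longrightarrow> M v = 0"
  shows "\<exists>c. \<forall>v. M v = (\<Sum>i<N. c i * L i v)"
proof -
  define g where "g i = adjoint (L i) 1" for i
  define G where "G = span (g ` {..<N})"
  have L: "L i v = g i \<bullet> v" if "i < N" for i v
    using adjoint_works[OF assms(1)[OF that], of v 1] by (simp add: g_def inner_commute)
  have M: "M v = adjoint M 1 \<bullet> v" for v
    using adjoint_works[OF assms(2), of v 1] by (simp add: inner_commute)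
  have "adjoint M 1 \<in> G\<^sup>\<bottom>\<^sup>\<bottom>"
    using assms(3) span_base[of _ "g ` {..<N}"]
    by (auto simp: orthogonal_comp_def orthogonal_def L M G_def inner_commute)
  then have "adjoint M 1 \<in> G"
    using orthogonal_comp_self[of G] by (simp add: G_def)
  moreover have "G \<subseteq> range (\<lambda>c. \<Sum>i<N. c i *\<^sub>R g i)"
    unfolding G_def
  proof (rule span_minimal)
    show "g ` {..<N} \<subseteq> range (\<lambda>c. \<Sum>i<N. c i *\<^sub>R g i)"
    proof clarify
      fix i assume "i < N"
      then have "g i = (\<Sum>j<N. (if j = i then 1 else 0) *\<^sub>R g j)"
        by (simp add: if_distrib[of "\<lambda>r. r *\<^sub>R _"] cong: if_cong)
      then show "g i \<in> range (\<lambda>c. \<Sum>i<N. c i *\<^sub>R g i)"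
        by (intro range_eqI[of _ _ "\<lambda>j. if j = i then 1 else 0"])
    qed
    show "subspace (range (\<lambda>c. \<Sum>i<N. c i *\<^sub>R g i))"
      unfolding subspace_def
    proof (intro conjI ballI allI; clarify?)
      show "0 \<in> range (\<lambda>c. \<Sum>i<N. c i *\<^sub>R g i)"
        by (rule range_eqI[of _ _ "\<lambda>i. 0"]) simp
      show "(\<Sum>i<N. c i *\<^sub>R g i) + (\<Sum>i<N. d i *\<^sub>R g i) \<in> range (\<lambda>c. \<Sum>i<N. c i *\<^sub>R g i)" for c d
        by (rule range_eqI[of _ _ "\<lambda>i. c i + d i"]) (simp add: scaleR_add_left sum.distrib)
      show "r *\<^sub>R (\<Sum>i<N. c i *\<^sub>R g i) \<in> range (\<lambda>c. \<Sum>i<N. c i *\<^sub>R g i)" for r c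
        by (rule range_eqI[of _ _ "\<lambda>i. r * c i"]) (simp add: scaleR_sum_right)
    qed
  qed
  ultimately obtain c where c: "adjoint M 1 = (\<Sum>i<N. c i *\<^sub>R g i)"
    by blast
  show ?thesis
    by (rule exI[of _ c]) (simp add: M c inner_sum_left L)
qed

text \<open>The derivative \<open>D\<close> of a parametrization has its range inside the common kernel of the
  differentials of the defining functions; both have the same dimension, so every common zero
  of the differentials is the velocity of a curve in the chart.\<close>

lemma tangent_vectors_in_range:
  fixes L :: "nat \<Rightarrow> 'a::euclidean_space \<Rightarrow> real" and D :: "'b::euclidean_space \<Rightarrow> 'a"
  assumes "\<And>i. i < N \<Longrightarrow> linear (L i)" "linear D" "inj D" "DIM('b) + N = DIM('a)"
    and indep: "\<And>c. (\<And>v. (\<Sum>i<N. c i * L i v) = 0) \<Longrightarrow> (\<forall>i<N. c i = 0)"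
    and zero: "\<And>i x. i < N \<Longrightarrow> L i (D x) = 0"
    and w: "\<And>i. i < N \<Longrightarrow> L i w = 0"
  shows "w \<in> range D"
proof -
  define g where "g i = adjoint (L i) 1" for i
  define T where "T = {y \<in> (UNIV::'a set). \<forall>x \<in> span (g ` {..<N}). orthogonal x y}"
  have L: "L i v = g i \<bullet> v" if "i < N" for i v
    using adjoint_works[OF assms(1)[OF that], of v 1] by (simp add: g_def inner_commute)
  have zero_comb: "\<forall>i<N. c i = 0" if "(\<Sum>i<N. c i *\<^sub>R g i) = 0" for c
  proof (rule indep)
    fix v
    have "(\<Sum>i<N. c i * L i v) = (\<Sum>i<N. c i *\<^sub>R g i) \<bullet> v"
      by (simp add: inner_sum_left L)
    then show "(\<Sum>i<N. c i * L i v) = 0" by (simp add: that)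
  qed
  have inj: "inj_on g {..<N}"
  proof (rule inj_onI, rule ccontr)
    fix i j assume ij: "i \<in> {..<N}" "j \<in> {..<N}" "g i = g j" "i \<noteq> j"
    define c :: "nat \<Rightarrow> real" where "c k = (if k = i then 1 else 0) - (if k = j then 1 else 0)" for k
    have "(\<Sum>k<N. c k *\<^sub>R g k) = g i - g j"
      using ij by (simp add: c_def scaleR_diff_left sum_subtractf if_distrib[of "\<lambda>r. r *\<^sub>R _"] cong: if_cong)
    then have "c i = 0" using zero_comb[of c] ij by simp
    then show False using ij(4) by (simp add: c_def)
  qed
  have "independent (g ` {..<N})"
  proof
    assume "dependent (g ` {..<N})"
    then obtain u i where u: "i < N" "u (g i) \<noteq> 0" "(\<Sum>v\<in>g ` {..<N}. u v *\<^sub>R v) = 0"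
      by (subst (asm) dependent_finite) auto
    then have "(\<Sum>i<N. u (g i) *\<^sub>R g i) = 0"
      by (simp add: sum.reindex[OF inj])
    then show False using zero_comb[of "\<lambda>i. u (g i)"] u by simp
  qed
  then have "dim (span (g ` {..<N})) = N"
    by (simp add: dim_eq_card_independent card_image[OF inj])
  moreover have "dim T + dim (span (g ` {..<N})) = dim (UNIV::'a set)"
    unfolding T_def by (rule dim_subspace_orthogonal_to_vectors) auto
  ultimately have dimT: "dim T = DIM('b)" using assms(4) by simp
  have T: "y \<in> T" if "\<And>i. i < N \<Longrightarrow> L i y = 0" for y
  proof -
    have "orthogonal y x" if "x \<in> span (g ` {..<N})" for x
      using that by (rule orthogonal_to_span) (use \<open>\<And>i. i < N \<Longrightarrow> L i y = 0\<close> L in \<open>auto simp: orthogonal_def inner_commute\<close>)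
    then show ?thesis by (auto simp: T_def orthogonal_commute)
  qed
  have "range D = T"
  proof (rule subspace_dim_equal)
    show "subspace (range D)" using assms(2) by (simp add: linear_subspace_image)
    show "subspace T"
      using subspace_orthogonal_to_vectors[of "span (g ` {..<N})"] by (simp add: T_def)
    show "range D \<subseteq> T" using T zero by auto
    show "dim T \<le> dim (range D)"
      using dim_image_eq[OF assms(2), of UNIV] assms(3) dimT by simp
  qed
  with T w show ?thesis by simp
qed

section \<open>Coordinates adapted to the rotational symmetry\<close>

text \<open>The equations of motion are invariant under multiplying \<open>w\<^sub>1, z\<^sub>1\<close> by a phase and \<open>x\<^sub>1\<close> by its
  square. The quantities \<open>\<zeta> = z\<^sub>1/w\<^sub>1\<close>, \<open>\<xi> = x\<^sub>1 w\<^sub>2/w\<^sub>1\<close>, \<open>y\<^sub>2\<close>, \<open>\<tau> = w\<^sub>1 w\<^sub>2\<close> and \<open>w\<^sub>3\<close> are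
  invariant under this rotation, and together with the phase of \<open>w\<^sub>1\<close> they are coordinates where
  \<open>w\<^sub>1\<close> does not vanish.\<close>

definition zeta :: "state \<Rightarrow> complex" where "zeta s = Z1 s / W1 s"
definition xi :: "state \<Rightarrow> complex" where "xi s = X1 s * W2 s / W1 s"
definition tau :: "state \<Rightarrow> real" where "tau s = (cmod (W1 s))\<^sup>2"
definition w3_plus :: "real \<Rightarrow> state \<Rightarrow> real" where "w3_plus lam s = Re (W3 s) + lam"
definition w3_minus :: "real \<Rightarrow> state \<Rightarrow> real" where "w3_minus lam s = Re (W3 s) - lam"
text \<open>With \<open>M\<close> the kinetic momentum, \<open>M \<bullet> (\<alpha> + \<i> \<beta>) = y\<^sub>2 w\<^sub>1 + x\<^sub>1 w\<^sub>2 + z\<^sub>1 (w\<^sub>3 + \<lambda>)\<close> joins the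
  projections of the momentum to \<open>\<alpha>\<close> and \<open>\<beta>\<close> (the areas constants of a single field), and
  \<open>areas_ratio\<close> is its quotient by \<open>w\<^sub>1\<close>. Its derivative in virtue of the
  system is half of \<open>areas_speed\<close> (lemma \<open>areas_ratio_along_field\<close>).\<close>

definition areas_ratio :: "real \<Rightarrow> state \<Rightarrow> complex" where
  "areas_ratio lam s = xi s + Y2 s + zeta s * of_real (w3_plus lam s)"
definition areas_speed :: "real \<Rightarrow> state \<Rightarrow> complex" where
  "areas_speed lam s = xi s * cnj (zeta s) - cnj (Y2 s) * zeta s + areas_ratio lam s * (zeta s + of_real (w3_minus lam s))"

text \<open>The real and imaginary part of \<open>casimir1\<close> are \<open>\<alpha> \<bullet> \<alpha> - \<beta> \<bullet> \<beta>\<close> and \<open>2 \<alpha> \<bullet> \<beta>\<close>; \<open>casimir2\<close> is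
  \<open>2 (\<alpha> \<bullet> \<alpha> + \<beta> \<bullet> \<beta>)\<close>.\<close>

definition casimir1 :: "state \<Rightarrow> complex" where "casimir1 s = (Z1 s)\<^sup>2 + X1 s * Y2 s"
definition casimir2 :: "state \<Rightarrow> real" where
  "casimir2 s = (cmod (X1 s))\<^sup>2 + (cmod (Y2 s))\<^sup>2 + 2 * (cmod (Z1 s))\<^sup>2"

lemma cnj_coords: "X2 s = cnj (X1 s)" "Y1 s = cnj (Y2 s)" "Z2 s = cnj (Z1 s)" "W2 s = cnj (W1 s)"
  "W3 s = of_real (Re (W3 s))"
  by (auto simp: complex_coords complex_eq_iff split: prod.split)

lemma U_domain_iff: "s \<in> U_domain \<longleftrightarrow> W1 s \<noteq> 0"
  by (simp add: U_domain_def cnj_coords)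

lemma open_U_domain: "open U_domain"
proof -
  have "continuous_on UNIV W1"
    by (intro linear_continuous_on linear_conv_bounded_linear[THEN iffD1] linear_complex_coords)
  then have "open (W1 -` (- {0}))" by (intro open_vimage) auto
  also have "W1 -` (- {0}) = U_domain" by (auto simp: U_domain_iff)
  finally show ?thesis .
qed

lemma tau_eq: "of_real (tau s) = W1 s * cnj (W1 s)"
  by (simp add: tau_def flip: complex_norm_square)

lemma tau_pos: "s \<in> U_domain \<Longrightarrow> tau s > 0"
  by (simp add: tau_def U_domain_iff)

lemma original_coords:
  assumes "s \<in> U_domain"
  shows "Z1 s = zeta s * W1 s" "X1 s * cnj (W1 s) = xi s * W1 s"
  using assms by (simp_all add: zeta_def xi_def cnj_coords U_domain_iff)

lemma P6_iff: "s \<in> P6 a b \<longleftrightarrow> casimir1 s = of_real (a\<^sup>2 - b\<^sup>2) \<and> casimir2 s = 2 * (a\<^sup>2 + b\<^sup>2)"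
proof -
  obtain \<omega> \<alpha> \<beta> where s: "s = (\<omega>, \<alpha>, \<beta>)" by (cases s)
  have casimir1: "casimir1 s = Complex (\<alpha> \<bullet> \<alpha> - \<beta> \<bullet> \<beta>) (2 * (\<alpha> \<bullet> \<beta>))"
    by (simp add: casimir1_def s complex_coords complex_eq_iff inner_vec_def sum_3 power2_eq_square algebra_simps)
  have casimir2: "casimir2 s = 2 * (\<alpha> \<bullet> \<alpha> + \<beta> \<bullet> \<beta>)"
    unfolding casimir2_def cmod_power2
    by (simp add: s complex_coords inner_vec_def sum_3 power2_eq_square algebra_simps)
  show ?thesis
    unfolding casimir1 casimir2 by (auto simp: s P6_def complex_eq_iff)
qed

lemma casimir1_reduced:
  assumes "s \<in> U_domain"
  shows "casimir1 s = W1 s / cnj (W1 s) * (of_real (tau s) * (zeta s)\<^sup>2 + xi s * Y2 s)"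
  using assms by (simp add: casimir1_def tau_eq zeta_def xi_def cnj_coords U_domain_iff field_simps power2_eq_square)

lemma casimir2_reduced:
  assumes "s \<in> U_domain"
  shows "casimir2 s = (cmod (xi s))\<^sup>2 + (cmod (Y2 s))\<^sup>2 + 2 * tau s * (cmod (zeta s))\<^sup>2"
  using assms by (simp add: casimir2_def tau_def zeta_def xi_def cnj_coords U_domain_iff norm_mult norm_divide field_simps)

lemma U1_reduced:
  assumes "s \<in> U_domain"
  shows "U1 lam s = areas_ratio lam s - cnj (areas_ratio lam s)"
proof -
  have w: "W1 s \<noteq> 0" using assms by (simp add: U_domain_iff)
  have m: "W3 s + of_real lam = of_real (w3_plus lam s)"
    using cnj_coords(5)[of s] by (simp add: w3_plus_def)
  have "(Y2 s * W1 s + X1 s * W2 s + Z1 s * (W3 s + of_real lam)) / W1 s = areas_ratio lam s"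
    using w by (simp add: m areas_ratio_def zeta_def xi_def add_divide_distrib)
  moreover have "(X2 s * W1 s + Y1 s * W2 s + Z2 s * (W3 s + of_real lam)) / W2 s
      = cnj ((Y2 s * W1 s + X1 s * W2 s + Z1 s * (W3 s + of_real lam)) / W1 s)"
    by (simp add: m cnj_coords(1-4) add.commute)
  ultimately show ?thesis by (simp add: U1_def)
qed

section \<open>Derivatives in the adapted coordinates\<close>

text \<open>A tangent vector \<open>v\<close> at \<open>s\<close> is described by the logarithmic derivative of \<open>w\<^sub>1\<close> and by the
  derivatives of \<open>\<zeta>\<close>, \<open>\<xi>\<close>, \<open>y\<^sub>2\<close> and \<open>w\<^sub>3\<close>. The coordinate \<open>Y2\<close> is linear, so \<open>Y2 v\<close> is its own
  derivative.\<close>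

definition dlog_w1 :: "state \<Rightarrow> state \<Rightarrow> complex" where "dlog_w1 s v = W1 v / W1 s"
definition d_zeta :: "state \<Rightarrow> state \<Rightarrow> complex" where "d_zeta s v = Z1 v / W1 s - zeta s * dlog_w1 s v"
definition d_xi :: "state \<Rightarrow> state \<Rightarrow> complex" where
  "d_xi s v = X1 v * W2 s / W1 s + xi s * (cnj (dlog_w1 s v) - dlog_w1 s v)"
definition d_w3 :: "state \<Rightarrow> real" where "d_w3 v = Re (W3 v)"

lemma coord_has_derivative:
  "(X1 has_derivative X1) F" "(Y2 has_derivative Y2) F" "(Z1 has_derivative Z1) F"
  "(W1 has_derivative W1) F" "(W2 has_derivative W2) F" "(W3 has_derivative W3) F"
  by (intro linear_imp_has_derivative linear_complex_coords)+

lemma zeta_has_derivative: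
  assumes "s \<in> U_domain" shows "(zeta has_derivative d_zeta s) (at s)"
proof -
  have "((\<lambda>s. Z1 s / W1 s) has_derivative d_zeta s) (at s)"
    using assms
    by (auto intro!: has_derivative_eq_rhs[OF has_derivative_divide'] coord_has_derivative
        simp: U_domain_iff d_zeta_def dlog_w1_def zeta_def fun_eq_iff field_simps)
  then show ?thesis by (simp add: zeta_def[abs_def])
qed

lemma xi_has_derivative:
  assumes "s \<in> U_domain" shows "(xi has_derivative d_xi s) (at s)"
proof -
  have w: "W1 s \<noteq> 0" using assms by (simp add: U_domain_iff)
  have "((\<lambda>s. X1 s * W2 s / W1 s) has_derivative d_xi s) (at s)"
    by (rule has_derivative_eq_rhs, (rule has_derivative_divide' has_derivative_mult coord_has_derivative w)+)
       (use w in \<open>simp add: d_xi_def dlog_w1_def xi_def fun_eq_iff field_simps cnj_coords\<close>)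
  then show ?thesis by (simp add: xi_def[abs_def])
qed

lemma tau_has_derivative:
  assumes "s \<in> U_domain" shows "(tau has_derivative (\<lambda>v. 2 * tau s * Re (dlog_w1 s v))) (at s)"
proof -
  have tau: "Re (W1 s * cnj (W1 s)) = tau s" for s
    using tau_eq[of s] by (metis Re_complex_of_real)
  have der: "Re (W1 s * cnj (W1 v) + W1 v * cnj (W1 s)) = 2 * tau s * Re (dlog_w1 s v)" for v
  proof -
    have "W1 v = W1 s * dlog_w1 s v" using assms by (simp add: dlog_w1_def U_domain_iff)
    then show ?thesis unfolding tau[symmetric] by (simp add: algebra_simps)
  qed
  have "((\<lambda>s. Re (W1 s * cnj (W1 s))) has_derivative (\<lambda>v. Re (W1 s * cnj (W1 v) + W1 v * cnj (W1 s)))) (at s)"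
    by (intro has_derivative_Re has_derivative_mult has_derivative_cnj coord_has_derivative)
  then show ?thesis unfolding der tau .
qed

lemma w3_plus_has_derivative: "(w3_plus lam has_derivative d_w3) (at s)" "(w3_minus lam has_derivative d_w3) (at s)"
  unfolding w3_plus_def[abs_def] w3_minus_def[abs_def] d_w3_def[abs_def]
  by (rule has_derivative_eq_rhs, (rule has_derivative_add has_derivative_diff has_derivative_Re
      has_derivative_const coord_has_derivative)+, simp)+

definition d_areas_ratio :: "real \<Rightarrow> state \<Rightarrow> state \<Rightarrow> complex" where
  "d_areas_ratio lam s v = d_xi s v + Y2 v + (d_zeta s v * of_real (w3_plus lam s) + zeta s * of_real (d_w3 v))"
definition d_areas_speed :: "real \<Rightarrow> state \<Rightarrow> state \<Rightarrow> complex" where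
  "d_areas_speed lam s v = d_xi s v * cnj (zeta s) + xi s * cnj (d_zeta s v) - (cnj (Y2 v) * zeta s + cnj (Y2 s) * d_zeta s v)
     + (d_areas_ratio lam s v * (zeta s + of_real (w3_minus lam s)) + areas_ratio lam s * (d_zeta s v + of_real (d_w3 v)))"

lemma areas_ratio_has_derivative:
  assumes "s \<in> U_domain" shows "(areas_ratio lam has_derivative d_areas_ratio lam s) (at s)"
  unfolding areas_ratio_def[abs_def]
  by (rule has_derivative_eq_rhs, (rule has_derivative_add has_derivative_mult has_derivative_of_real
      zeta_has_derivative xi_has_derivative w3_plus_has_derivative coord_has_derivative assms)+)
     (simp add: fun_eq_iff d_areas_ratio_def)

lemma areas_speed_has_derivative:
  assumes "s \<in> U_domain" shows "(areas_speed lam has_derivative d_areas_speed lam s) (at s)"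
  unfolding areas_speed_def[abs_def]
  by (rule has_derivative_eq_rhs, (rule has_derivative_add has_derivative_diff has_derivative_mult has_derivative_of_real has_derivative_cnj
      zeta_has_derivative xi_has_derivative w3_plus_has_derivative areas_ratio_has_derivative coord_has_derivative assms)+)
     (simp add: fun_eq_iff d_areas_speed_def)

definition d_casimir1 :: "state \<Rightarrow> state \<Rightarrow> complex" where
  "d_casimir1 s v = W1 s / cnj (W1 s) *
     (of_real (2 * tau s * Re (dlog_w1 s v)) * (zeta s)\<^sup>2 + of_real (2 * tau s) * zeta s * d_zeta s v
      + d_xi s v * Y2 s + xi s * Y2 v
      + (dlog_w1 s v - cnj (dlog_w1 s v)) * (of_real (tau s) * (zeta s)\<^sup>2 + xi s * Y2 s))"
definition d_casimir2 :: "state \<Rightarrow> state \<Rightarrow> real" where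
  "d_casimir2 s v = 2 * Re (cnj (xi s) * d_xi s v + cnj (Y2 s) * Y2 v
     + 2 * tau s * cnj (zeta s) * d_zeta s v) + 4 * tau s * Re (dlog_w1 s v) * (cmod (zeta s))\<^sup>2"

lemma casimir1_has_derivative:
  assumes "s \<in> U_domain"
  shows "(casimir1 has_derivative d_casimir1 s) (at s)"
proof -
  have "(casimir1 has_derivative (\<lambda>v. 2 * Z1 s * Z1 v + (X1 s * Y2 v + X1 v * Y2 s))) (at s)"
    unfolding casimir1_def[abs_def] power2_eq_square
    by (rule has_derivative_eq_rhs, (rule has_derivative_add has_derivative_mult coord_has_derivative)+)
       (simp add: fun_eq_iff)
  moreover have "2 * Z1 s * Z1 v + (X1 s * Y2 v + X1 v * Y2 s) = W1 s / cnj (W1 s) *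
     (of_real (2 * tau s * Re (dlog_w1 s v)) * (zeta s)\<^sup>2 + of_real (2 * tau s) * zeta s * d_zeta s v
      + d_xi s v * Y2 s + xi s * Y2 v
      + (dlog_w1 s v - cnj (dlog_w1 s v)) * (of_real (tau s) * (zeta s)\<^sup>2 + xi s * Y2 s))" for v
  proof -
    have w: "W1 s \<noteq> 0" using assms by (simp add: U_domain_iff)
    have dlog_w1: "2 * complex_of_real (Re (dlog_w1 s v)) = dlog_w1 s v + cnj (dlog_w1 s v)"
      by (simp add: complex_eq_iff)
    have z: "Z1 v = W1 s * (d_zeta s v + zeta s * dlog_w1 s v)" "Z1 s = W1 s * zeta s"
      and x: "X1 v = W1 s / cnj (W1 s) * (d_xi s v - xi s * (cnj (dlog_w1 s v) - dlog_w1 s v))"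
        "X1 s = W1 s / cnj (W1 s) * xi s"
      using w by (simp_all add: d_zeta_def zeta_def xi_def d_xi_def cnj_coords field_simps)
    have "of_real (2 * tau s * Re (dlog_w1 s v)) = W1 s * cnj (W1 s) * (dlog_w1 s v + cnj (dlog_w1 s v))"
      unfolding dlog_w1[symmetric] tau_eq[symmetric] by simp
    then show ?thesis
      unfolding of_real_mult tau_eq z x using w by (simp add: field_simps power2_eq_square)
  qed
  ultimately show ?thesis by (simp only: d_casimir1_def[abs_def])
qed

lemma casimir2_has_derivative:
  assumes "s \<in> U_domain"
  shows "(casimir2 has_derivative d_casimir2 s) (at s)"
proof -
  have casimir2: "casimir2 s = Re (X1 s * cnj (X1 s) + Y2 s * cnj (Y2 s) + 2 * (Z1 s * cnj (Z1 s)))" for s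
    unfolding casimir2_def by (simp add: complex_mult_cnj cmod_power2)
  have "(casimir2 has_derivative (\<lambda>v. 2 * Re (cnj (X1 s) * X1 v + cnj (Y2 s) * Y2 v + 2 * cnj (Z1 s) * Z1 v))) (at s)"
    unfolding casimir2[abs_def]
    by (rule has_derivative_eq_rhs, (rule has_derivative_add has_derivative_mult has_derivative_cnj has_derivative_Re
       has_derivative_const coord_has_derivative)+)
       (simp add: fun_eq_iff algebra_simps)
  moreover have "2 * Re (cnj (X1 s) * X1 v + cnj (Y2 s) * Y2 v + 2 * cnj (Z1 s) * Z1 v)
    = 2 * Re (cnj (xi s) * d_xi s v + cnj (Y2 s) * Y2 v
     + 2 * tau s * cnj (zeta s) * d_zeta s v) + 4 * tau s * Re (dlog_w1 s v) * (cmod (zeta s))\<^sup>2" for v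
  proof -
    have w: "W1 s \<noteq> 0" using assms by (simp add: U_domain_iff)
    have x: "cnj (X1 s) * X1 v = cnj (xi s) * (d_xi s v - xi s * (cnj (dlog_w1 s v) - dlog_w1 s v))"
      and z: "cnj (Z1 s) * Z1 v = of_real (tau s) * cnj (zeta s) * (d_zeta s v + zeta s * dlog_w1 s v)"
      using w by (simp_all add: d_zeta_def zeta_def xi_def d_xi_def tau_eq cnj_coords field_simps)
    show ?thesis
      unfolding x mult.assoc[of 2 "cnj (Z1 s)"] z cmod_power2
      by (simp add: algebra_simps power2_eq_square)
  qed
  ultimately show ?thesis by (simp only: d_casimir2_def[abs_def])
qed

section \<open>The equations of motion\<close>

lemma U1_has_derivative:
  assumes "s \<in> U_domain"
  shows "(U1 lam has_derivative (\<lambda>v. d_areas_ratio lam s v - cnj (d_areas_ratio lam s v))) (at s)"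
proof (rule has_derivative_transform_within_open[of "\<lambda>s. areas_ratio lam s - cnj (areas_ratio lam s)" _ s UNIV U_domain])
  show "((\<lambda>s. areas_ratio lam s - cnj (areas_ratio lam s)) has_derivative (\<lambda>v. d_areas_ratio lam s v - cnj (d_areas_ratio lam s v))) (at s)"
    by (intro has_derivative_diff has_derivative_cnj areas_ratio_has_derivative assms)
qed (auto simp: assms open_U_domain U1_reduced)

lemma linear_along_field:
  assumes "linear f" shows "f (gyrostat_field lam s) = \<i> * prime_deriv lam f s"
  by (simp add: prime_deriv_linear[OF assms])

lemma coords_along_field:
  fixes lam :: real
  defines "F \<equiv> gyrostat_field lam"
  shows "2 * W1 (F s) = - \<i> * (W1 s * (W3 s - of_real lam) + Z1 s)"
    "2 * W3 (F s) = \<i> * (Y2 s - cnj (Y2 s))"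
    "X1 (F s) = \<i> * (Z1 s * W1 s - X1 s * W3 s)"
    "Y2 (F s) = \<i> * (Y2 s * W3 s - Z1 s * cnj (W1 s))"
    "2 * Z1 (F s) = \<i> * (X1 s * cnj (W1 s) - Y2 s * W1 s)"
proof -
  have *: "2 * (\<i> * p) = \<i> * q" if "2 * p = q" for p q :: complex
    using that by auto
  show "2 * W1 (F s) = - \<i> * (W1 s * (W3 s - of_real lam) + Z1 s)"
    unfolding F_def linear_along_field[OF linear_complex_coords(7)]
      *[OF gyrostat_complex_form(1)] by (simp add: algebra_simps)
  show "2 * W3 (F s) = \<i> * (Y2 s - cnj (Y2 s))"
    unfolding F_def linear_along_field[OF linear_complex_coords(9)]
      *[OF gyrostat_complex_form(3)] by (simp add: cnj_coords(2))
  show "X1 (F s) = \<i> * (Z1 s * W1 s - X1 s * W3 s)"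
    unfolding F_def linear_along_field[OF linear_complex_coords(1)]
      gyrostat_complex_form by (simp add: algebra_simps)
  show "Y2 (F s) = \<i> * (Y2 s * W3 s - Z1 s * cnj (W1 s))"
    unfolding F_def linear_along_field[OF linear_complex_coords(4)]
      gyrostat_complex_form by (simp add: cnj_coords(4))
  show "2 * Z1 (F s) = \<i> * (X1 s * cnj (W1 s) - Y2 s * W1 s)"
    unfolding F_def linear_along_field[OF linear_complex_coords(5)]
      *[OF gyrostat_complex_form(8)] by (simp add: cnj_coords(4))
qed

text \<open>The derivative of \<open>M \<bullet> (\<alpha> + \<i> \<beta>)\<close> along the flow is just \<open>(x\<^sub>1 z\<^sub>2 - y\<^sub>1 z\<^sub>1)/2\<close>; the rest comes from
  the denominator \<open>w\<^sub>1\<close>. The factor \<open>\<i>\<close> converts the derivative with respect to \<open>\<i> t\<close> into the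
  derivative with respect to \<open>t\<close>.\<close>

lemma areas_ratio_along_field:
  assumes "s \<in> U_domain"
  shows "2 * d_areas_ratio lam s (gyrostat_field lam s) = \<i> * areas_speed lam s"
proof -
  let ?F = "gyrostat_field lam s"
  define w u x e m n where defs: "w = W1 s" "u = zeta s" "x = xi s" "e = Y2 s"
    "m = complex_of_real (w3_plus lam s)" "n = complex_of_real (w3_minus lam s)"
  have w: "w \<noteq> 0" using assms by (simp add: defs U_domain_iff)
  have orig: "Z1 s = u * w" "X1 s * cnj w = x * w" and W3: "W3 s - of_real lam = n" "2 * W3 s = m + n"
    using original_coords[OF assms] cnj_coords(5)[of s] by (simp_all add: defs w3_minus_def w3_plus_def)
  have dlog_w1: "dlog_w1 s ?F = - (\<i> / 2) * (n + u)"
  proof -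
    have "2 * (w * dlog_w1 s ?F) = - \<i> * (w * n + u * w)"
      using coords_along_field(1)[of lam s] w by (simp add: dlog_w1_def orig W3 flip: defs)
    then have "w * (2 * dlog_w1 s ?F) = w * (- \<i> * (n + u))" by (simp add: algebra_simps)
    then have "2 * dlog_w1 s ?F = - \<i> * (n + u)" using mult_left_cancel[OF w] by blast
    then show ?thesis by (simp add: field_simps)
  qed
  have d_w3: "2 * complex_of_real (d_w3 ?F) = \<i> * (e - cnj e)"
    using coords_along_field(2)[of lam s] cnj_coords(5)[of ?F] by (simp add: d_w3_def defs)
  have d_zeta: "2 * d_zeta s ?F = \<i> * (x - e + u * n + u\<^sup>2)"
  proof -
    have "2 * (w * d_zeta s ?F) = 2 * Z1 ?F - 2 * u * w * dlog_w1 s ?F"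
      using w by (simp add: d_zeta_def field_simps defs)
    also have "\<dots> = w * (\<i> * (x - e + u * n + u\<^sup>2))"
      unfolding coords_along_field dlog_w1 by (simp add: orig flip: defs) (simp add: algebra_simps power2_eq_square)
    finally show ?thesis using w by simp
  qed
  have cnj_n: "cnj n = n" by (simp add: defs)
  have d_xi: "2 * d_xi s ?F = \<i> * (2 * u * w * cnj w - x * (m + n) + x * (2 * n + u + cnj u))"
  proof -
    have "2 * w * d_xi s ?F = 2 * X1 ?F * cnj w + w * x * (2 * (cnj (dlog_w1 s ?F) - dlog_w1 s ?F))"
      using w by (simp add: d_xi_def field_simps defs cnj_coords)
    also have "2 * (cnj (dlog_w1 s ?F) - dlog_w1 s ?F) = \<i> * (2 * n + u + cnj u)"
      unfolding dlog_w1 by (simp add: cnj_n) (simp add: field_simps)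
    also have "2 * X1 ?F * cnj w = \<i> * (2 * u * w * w * cnj w - x * w * (m + n))"
      unfolding coords_along_field W3(2)[symmetric] orig(1) orig(2)[symmetric]
      by (simp add: defs algebra_simps)
    finally have "w * (2 * d_xi s ?F) = w * (\<i> * (2 * u * w * cnj w - x * (m + n) + x * (2 * n + u + cnj u)))"
      by (simp add: algebra_simps)
    then show ?thesis using mult_left_cancel[OF w] by blast
  qed
  have de: "2 * Y2 ?F = \<i> * (e * (m + n) - 2 * u * w * cnj w)"
    unfolding coords_along_field W3(2)[symmetric] orig(1) by (simp add: defs algebra_simps)
  have "2 * d_areas_ratio lam s ?F = 2 * d_xi s ?F + 2 * Y2 ?F + (2 * d_zeta s ?F) * m + u * (2 * complex_of_real (d_w3 ?F))"
    by (simp add: d_areas_ratio_def defs algebra_simps)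
  also have "\<dots> = \<i> * ((2 * u * w * cnj w - x * (m + n) + x * (2 * n + u + cnj u))
     + (e * (m + n) - 2 * u * w * cnj w) + (x - e + u * n + u\<^sup>2) * m + u * (e - cnj e))"
    unfolding d_xi de d_zeta d_w3 by (simp add: algebra_simps)
  also have "\<dots> = \<i> * areas_speed lam s"
    unfolding areas_speed_def areas_ratio_def defs[symmetric] by (simp add: algebra_simps power2_eq_square)
  finally show ?thesis .
qed

lemma U2_reduced:
  assumes "s \<in> U_domain"
  shows "U2 lam s = of_real (tau s * Re (areas_speed lam s))"
proof -
  let ?d = "d_areas_ratio lam s (gyrostat_field lam s)"
  have "frechet_derivative (U1 lam) (at s) = (\<lambda>v. d_areas_ratio lam s v - cnj (d_areas_ratio lam s v))"
    using frechet_derivative_at[OF U1_has_derivative[OF assms]] by simp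
  then have "prime_deriv lam (U1 lam) s = (?d - cnj ?d) / \<i>"
    by (simp add: prime_deriv_def)
  also have "?d = \<i> * areas_speed lam s / 2" using areas_ratio_along_field[OF assms, of lam] by (simp add: mult.commute)
  finally have "prime_deriv lam (U1 lam) s = of_real (Re (areas_speed lam s))"
    by (simp add: complex_eq_iff)
  then show ?thesis by (simp add: U2_def cnj_coords tau_eq)
qed

lemma U2_has_derivative:
  assumes "s \<in> U_domain"
  shows "(U2 lam has_derivative (\<lambda>v. of_real (tau s * Re (d_areas_speed lam s v)
    + 2 * tau s * Re (dlog_w1 s v) * Re (areas_speed lam s)))) (at s)"
proof (rule has_derivative_transform_within_open[of "\<lambda>s. of_real (tau s * Re (areas_speed lam s))" _ s UNIV U_domain])
  show "((\<lambda>s. complex_of_real (tau s * Re (areas_speed lam s))) has_derivative (\<lambda>v. of_real (tau s * Re (d_areas_speed lam s v)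
    + 2 * tau s * Re (dlog_w1 s v) * Re (areas_speed lam s)))) (at s)"
    by (intro has_derivative_of_real has_derivative_mult has_derivative_Re tau_has_derivative areas_speed_has_derivative assms)
qed (auto simp: assms open_U_domain U2_reduced)

text \<open>This is why two real equations suffice: where the first one holds, the speed of
  \<open>areas_ratio\<close> is real up to the factor \<open>\<i>\<close>, so \<open>U2 = 0\<close>, which only says that the real part of
  \<open>areas_speed\<close> is zero, makes \<open>areas_ratio\<close> stationary.\<close>

lemma Im_areas_speed_eq_0:
  assumes "Im (areas_ratio lam s) = 0" shows "Im (areas_speed lam s) = 0"
proof -
  define u x e m n where defs: "u = zeta s" "x = xi s" "e = Y2 s" "m = w3_plus lam s" "n = w3_minus lam s"
  have "Im (x + e + u * m) = 0" using assms by (simp add: defs areas_ratio_def)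
  then have e: "Im e = - Im x - Im u * m" by simp
  show ?thesis unfolding areas_speed_def areas_ratio_def defs[symmetric] by (simp add: e algebra_simps)
qed

lemma O_star_iff:
  "s \<in> O_star a b lam \<longleftrightarrow> s \<in> U_domain \<and> casimir1 s = of_real (a\<^sup>2 - b\<^sup>2) \<and> casimir2 s = 2 * (a\<^sup>2 + b\<^sup>2)
     \<and> Im (areas_ratio lam s) = 0 \<and> areas_speed lam s = 0"
proof -
  have "areas_ratio lam s - cnj (areas_ratio lam s) = 0 \<longleftrightarrow> Im (areas_ratio lam s) = 0"
    by (simp add: complex_eq_iff)
  moreover have "Im (areas_ratio lam s) = 0 \<Longrightarrow> Re (areas_speed lam s) = 0 \<longleftrightarrow> areas_speed lam s = 0"
    by (simp add: complex_eq_iff Im_areas_speed_eq_0)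
  ultimately show ?thesis
    using tau_pos[of s]
    by (auto simp: O_star_def P6_iff U1_reduced U2_reduced)
qed

section \<open>Invariance\<close>

text \<open>Gronwall's argument: \<open>(y \<bullet> y) exp (- 2 K t)\<close> does not increase.\<close>

lemma linear_ode_zero_forward:
  fixes y :: "real \<Rightarrow> 'a::real_inner"
  assumes "l \<le> r" and y: "\<And>t. t \<in> {l..r} \<Longrightarrow> (y has_vector_derivative y' t) (at t within {l..r})"
    and bound: "\<And>t. t \<in> {l..r} \<Longrightarrow> norm (y' t) \<le> K * norm (y t)" and "y l = 0"
  shows "y r = 0"
proof (cases "l = r")
  case True with assms show ?thesis by simp
next
  case False
  then have "l < r" using assms by simp
  define g where "g t = (y t \<bullet> y t) * exp (- 2 * K * t)" for t
  define g' where "g' t = 2 * (y t \<bullet> y' t - K * (y t \<bullet> y t)) * exp (- 2 * K * t)" for t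
  have g: "(g has_derivative (\<lambda>h. h * g' t)) (at t within {l..r})" if t: "t \<in> {l..r}" for t
  proof -
    have "(y has_derivative (\<lambda>h. h *\<^sub>R y' t)) (at t within {l..r})"
      using y[OF t] by (simp add: has_vector_derivative_def)
    note yy = has_derivative_inner[OF this this]
    have "((\<lambda>t. exp (- 2 * K * t)) has_real_derivative - 2 * K * exp (- 2 * K * t)) (at t within {l..r})"
      by (auto intro!: derivative_eq_intros)
    then have ee: "((\<lambda>t. exp (- 2 * K * t)) has_derivative (\<lambda>h. h * (- 2 * K * exp (- 2 * K * t)))) (at t within {l..r})"
      by (rule has_derivative_eq_rhs[OF _ ext, OF has_field_derivative_imp_has_derivative]) simp
    show ?thesis
      unfolding g_def[abs_def]
      by (rule has_derivative_eq_rhs[OF has_derivative_mult[OF yy ee]])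
         (simp add: fun_eq_iff g'_def inner_commute algebra_simps)
  qed
  obtain x where x: "x \<in> {l<..<r}" "g r - g l = (r - l) * g' x"
    using mvt_simple[OF \<open>l < r\<close>, of g "\<lambda>t h. h * g' t"] g by auto
  have "y x \<bullet> y' x \<le> norm (y x) * norm (y' x)" by (rule norm_cauchy_schwarz)
  also have "\<dots> \<le> norm (y x) * (K * norm (y x))"
    using bound[of x] x(1) by (intro mult_left_mono) auto
  also have "\<dots> = K * (y x \<bullet> y x)" by (simp add: dot_square_norm power2_eq_square)
  finally have "g' x \<le> 0" by (simp add: g'_def mult_nonpos_nonneg)
  then have "g r \<le> g l" using x \<open>l < r\<close> by (smt (verit) mult_nonneg_nonpos)
  also have "g l = 0" by (simp add: g_def \<open>y l = 0\<close>)
  finally have "y r \<bullet> y r \<le> 0" by (simp add: g_def mult_le_0_iff)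
  then show ?thesis using inner_gt_zero_iff[of "y r"] by (meson not_le)
qed

lemma linear_ode_zero:
  fixes y :: "real \<Rightarrow> 'a::real_inner"
  assumes "is_interval I" "t0 \<in> I" "t \<in> I" "y t0 = 0"
    and y: "\<And>t. t \<in> I \<Longrightarrow> (y has_vector_derivative y' t) (at t within I)"
    and bound: "\<And>t. t \<in> I \<Longrightarrow> norm (y' t) \<le> K t * norm (y t)" and K: "continuous_on I K"
  shows "y t = 0"
proof -
  define l r where "l = min t0 t" and "r = max t0 t"
  have sub: "{l..r} \<subseteq> I"
  proof -
    have "l \<in> I" "r \<in> I" using assms(2,3) by (auto simp: l_def r_def min_def max_def)
    then show ?thesis by (intro subsetI) (simp add: mem_is_interval_1_I[OF assms(1), of l r])
  qed
  have "compact (K ` {l..r})"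
    using K sub by (intro compact_continuous_image) (auto intro: continuous_on_subset)
  then obtain B where B: "\<forall>z \<in> K ` {l..r}. \<bar>z\<bar> \<le> B"
    using compact_imp_bounded bounded_real by metis
  have b: "norm (y' x) \<le> B * norm (y x)" if "x \<in> {l..r}" for x
  proof -
    have "K x \<le> B" using B that by force
    then show ?thesis
      using bound[of x] sub that mult_right_mono[of "K x" B "norm (y x)"] by force
  qed
  have der: "(y has_vector_derivative y' x) (at x within {l..r})" if "x \<in> {l..r}" for x
    using y[of x] sub that has_vector_derivative_within_subset by blast
  show ?thesis
  proof (cases "t0 \<le> t")
    case True
    then show ?thesis
      using linear_ode_zero_forward[of l r y y' B] b der assms(4) by (auto simp: l_def r_def)
  next
    case False
    then have lr: "l = t" "r = t0" by (auto simp: l_def r_def)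
    have "y (- (- l)) = 0"
    proof (rule linear_ode_zero_forward[where y = "\<lambda>t. y (- t)" and y' = "\<lambda>t. - y' (- t)"
          and K = B and l = "- r" and r = "- l"])
      show "- r \<le> - l" using False lr by simp
      fix x assume x: "x \<in> {- r..- l}"
      then have mx: "- x \<in> {l..r}" by auto
      have "uminus ` {- r..- l} = {l..r}" by simp
      then have "(y \<circ> uminus has_vector_derivative (- 1) *\<^sub>R y' (- x)) (at x within {- r..- l})"
        by (intro vector_diff_chain_within) (auto intro!: derivative_eq_intros der mx)
      then show "((\<lambda>t. y (- t)) has_vector_derivative - y' (- x)) (at x within {- r..- l})"
        by (simp add: o_def)
      show "norm (- y' (- x)) \<le> B * norm (y (- x))" using b[OF mx] by simp
    qed (simp add: lr assms(4))
    then show ?thesis by (simp add: lr)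
  qed
qed

lemma gyrostat_solution_linear:
  assumes "gyrostat_solution lam I \<gamma>" "t \<in> I" "linear f"
  shows "((\<lambda>t. f (\<gamma> t)) has_vector_derivative f (gyrostat_field lam (\<gamma> t))) (at t within I)"
  using assms bounded_linear.has_vector_derivative[of f \<gamma>]
  by (simp add: gyrostat_solution_def linear_conv_bounded_linear)

text \<open>For a fixed real \<open>c\<close>, the first two residuals are polynomial forms of \<open>areas_ratio = c\<close> and
  \<open>areas_speed = 0\<close>, with the denominators cleared so that they make sense at \<open>w\<^sub>1 = 0\<close> as well.
  The third one is a consequence of the first two where \<open>w\<^sub>1 \<noteq> 0\<close>; it is added because the
  derivatives of the three residuals are linear combinations of the residuals and their
  conjugates with continuous coefficients.\<close>

definition residual1 :: "real \<Rightarrow> complex \<Rightarrow> state \<Rightarrow> complex" where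
  "residual1 lam c s = Y2 s * W1 s + X1 s * cnj (W1 s) + Z1 s * (W3 s + of_real lam) - c * W1 s"
definition residual2 :: "real \<Rightarrow> complex \<Rightarrow> state \<Rightarrow> complex" where
  "residual2 lam c s = X1 s * cnj (Z1 s) - Z1 s * cnj (Y2 s) + c * (W1 s * (W3 s - of_real lam) + Z1 s)"
definition residual3 :: "real \<Rightarrow> complex \<Rightarrow> state \<Rightarrow> complex" where
  "residual3 lam c s = (cnj (Y2 s) - c) * (Y2 s - c) - X1 s * cnj (X1 s) + c * ((W3 s)\<^sup>2 - of_real (lam\<^sup>2))"

lemma residual_derivatives:
  assumes sol: "gyrostat_solution lam I \<gamma>" "t \<in> I" and c: "cnj c = c"
  shows "((\<lambda>t. residual1 lam c (\<gamma> t)) has_vector_derivative \<i> * residual2 lam c (\<gamma> t) / 2) (at t within I)"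
    and "((\<lambda>t. residual2 lam c (\<gamma> t)) has_vector_derivative \<i> * (c * residual1 lam c (\<gamma> t) / 2 - W3 (\<gamma> t) * residual2 lam c (\<gamma> t)
      + W1 (\<gamma> t) * residual3 lam c (\<gamma> t) / 2)) (at t within I)"
    and "((\<lambda>t. residual3 lam c (\<gamma> t)) has_vector_derivative \<i> * (cnj (W1 (\<gamma> t)) * residual2 lam c (\<gamma> t)
      - W1 (\<gamma> t) * cnj (residual2 lam c (\<gamma> t)))) (at t within I)"
    and "((\<lambda>t. casimir1 (\<gamma> t)) has_vector_derivative 0) (at t within I)"
    and "((\<lambda>t. of_real (casimir2 (\<gamma> t)) :: complex) has_vector_derivative 0) (at t within I)"
proof -
  note lin = gyrostat_solution_linear[OF sol, OF linear_complex_coords(1)] gyrostat_solution_linear[OF sol, OF linear_complex_coords(4)]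
    gyrostat_solution_linear[OF sol, OF linear_complex_coords(5)] gyrostat_solution_linear[OF sol, OF linear_complex_coords(7)]
    gyrostat_solution_linear[OF sol, OF linear_complex_coords(9)]
  define w z x y m where s: "w = W1 (\<gamma> t)" "z = Z1 (\<gamma> t)" "x = X1 (\<gamma> t)" "y = Y2 (\<gamma> t)" "m = W3 (\<gamma> t)"
  have m: "cnj m = m" using cnj_coords(5)[of "\<gamma> t"] by (metis s(5) complex_cnj_complex_of_real)
  have F: "W1 (gyrostat_field lam (\<gamma> t)) = - \<i> * (w * (m - of_real lam) + z) / 2"
    "W3 (gyrostat_field lam (\<gamma> t)) = \<i> * (y - cnj y) / 2"
    "X1 (gyrostat_field lam (\<gamma> t)) = \<i> * (z * w - x * m)"
    "Y2 (gyrostat_field lam (\<gamma> t)) = \<i> * (y * m - z * cnj w)"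
    "Z1 (gyrostat_field lam (\<gamma> t)) = \<i> * (x * cnj w - y * w) / 2"
    using coords_along_field[of lam "\<gamma> t"] unfolding s[symmetric] by (simp_all add: field_simps)
  note rules = has_vector_derivative_add has_vector_derivative_diff has_vector_derivative_mult
    bounded_linear.has_vector_derivative[OF bounded_linear_cnj] has_vector_derivative_const lin
  show "((\<lambda>t. residual1 lam c (\<gamma> t)) has_vector_derivative \<i> * residual2 lam c (\<gamma> t) / 2) (at t within I)"
    unfolding residual1_def
    by (rule has_vector_derivative_eq_rhs, (rule rules)+)
       (unfold residual2_def F s[symmetric], simp add: m c, simp add: field_simps)
  show "((\<lambda>t. residual2 lam c (\<gamma> t)) has_vector_derivative \<i> * (c * residual1 lam c (\<gamma> t) / 2 - W3 (\<gamma> t) * residual2 lam c (\<gamma> t)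
      + W1 (\<gamma> t) * residual3 lam c (\<gamma> t) / 2)) (at t within I)"
    unfolding residual2_def
    by (rule has_vector_derivative_eq_rhs, (rule rules)+)
       (unfold residual1_def residual3_def F s[symmetric], simp add: m c, simp add: field_simps power2_eq_square)
  show "((\<lambda>t. residual3 lam c (\<gamma> t)) has_vector_derivative \<i> * (cnj (W1 (\<gamma> t)) * residual2 lam c (\<gamma> t)
      - W1 (\<gamma> t) * cnj (residual2 lam c (\<gamma> t)))) (at t within I)"
    unfolding residual3_def power2_eq_square
    by (rule has_vector_derivative_eq_rhs, (rule rules)+)
       (unfold residual2_def F s[symmetric], simp add: m c, simp add: field_simps)
  show "((\<lambda>t. casimir1 (\<gamma> t)) has_vector_derivative 0) (at t within I)"
    unfolding casimir1_def power2_eq_square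
    by (rule has_vector_derivative_eq_rhs, (rule rules)+)
       (unfold F s[symmetric], simp add: field_simps)
  show "((\<lambda>t. of_real (casimir2 (\<gamma> t)) :: complex) has_vector_derivative 0) (at t within I)"
    unfolding casimir2_def of_real_add of_real_mult complex_norm_square
    by (rule has_vector_derivative_eq_rhs, (rule rules)+)
       (unfold F s[symmetric], simp add: m, simp add: field_simps)
qed

lemma O_star_iff_residuals:
  assumes "s \<in> U_domain" and c: "Im c = 0"
  shows "residual1 lam c s = 0 \<and> residual2 lam c s = 0 \<longleftrightarrow> areas_ratio lam s = c \<and> areas_speed lam s = 0"
proof -
  have w: "W1 s \<noteq> 0" using assms by (simp add: U_domain_iff)
  have m: "W3 s + of_real lam = of_real (w3_plus lam s)" "W3 s - of_real lam = of_real (w3_minus lam s)"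
    using cnj_coords(5)[of s] by (simp_all add: w3_plus_def w3_minus_def)
  note orig = original_coords[OF assms(1)]
  have "residual1 lam c s = W1 s * (areas_ratio lam s - c)"
    by (simp add: residual1_def areas_ratio_def orig m algebra_simps)
  moreover have "W1 s * (X1 s * cnj (Z1 s) - Z1 s * cnj (Y2 s) + areas_ratio lam s * (W1 s * (W3 s - of_real lam) + Z1 s))
      = W1 s * (W1 s * areas_speed lam s)"
  proof -
    have "X1 s * cnj (Z1 s) = W1 s * (xi s * cnj (zeta s))"
      using orig(2) by (simp add: orig(1) algebra_simps)
    then show ?thesis by (simp add: areas_speed_def m orig(1) algebra_simps)
  qed
  ultimately show ?thesis using w by (auto simp: residual2_def)
qed

lemma residual3_eq_0:
  assumes "s \<in> U_domain" and c: "cnj c = c" and "residual1 lam c s = 0" "residual2 lam c s = 0"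
  shows "residual3 lam c s = 0"
proof -
  define w z x y m n where d: "w = W1 s" "z = Z1 s" "x = X1 s" "y = Y2 s"
    "m = W3 s + of_real lam" "n = W3 s - of_real lam"
  have cm: "cnj m = m" using cnj_coords(5)[of s] by (metis d(5) complex_cnj_add complex_cnj_complex_of_real)
  have e1: "y * w + x * cnj w + z * m - c * w = 0"
    using assms(3) by (simp add: residual1_def d)
  have "cnj (y * w + x * cnj w + z * m - c * w) = 0" unfolding e1 by simp
  then have e2: "cnj y * cnj w + cnj x * w + cnj z * m - c * cnj w = 0"
    by (simp add: c cm)
  have e3: "x * cnj z - z * cnj y + c * (w * n + z) = 0"
    using assms(4) by (simp add: residual2_def d)
  have "w * cnj w * ((cnj y - c) * (y - c) - x * cnj x + c * (m * n)) = 0"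
    using e1 e2 e3 by algebra
  moreover have "w \<noteq> 0" using assms(1) by (simp add: d U_domain_iff)
  moreover have "m * n = (W3 s)\<^sup>2 - of_real (lam\<^sup>2)"
    by (simp add: d algebra_simps power2_eq_square)
  ultimately show ?thesis by (simp add: residual3_def d)
qed

text \<open>With \<open>c\<close> the initial value of \<open>areas_ratio\<close>, the residuals solve a linear homogeneous system
  and vanish initially, so they vanish all along the trajectory. Since the system has no
  singularity at \<open>w\<^sub>1 = 0\<close>, this also covers trajectories that leave \<open>U_domain\<close> and come back.\<close>

lemma O_star_invariant: "gyrostat_invariant lam (O_star a b lam)"
  unfolding gyrostat_invariant_def
proof (intro allI impI ballI; elim conjE)
  fix I \<gamma> t0 t
  assume I: "is_interval I" and sol: "gyrostat_solution lam I \<gamma>" and t0: "t0 \<in> I"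
    and start: "\<gamma> t0 \<in> O_star a b lam" and t: "t \<in> I" and dom: "\<gamma> t \<in> U_domain"
  define c where "c = areas_ratio lam (\<gamma> t0)"
  have s0: "\<gamma> t0 \<in> U_domain" "Im c = 0" "areas_speed lam (\<gamma> t0) = 0"
    using start by (auto simp: O_star_iff c_def)
  have cc: "cnj c = c" using s0(2) by (simp add: complex_eq_iff)
  note der = residual_derivatives[OF sol _ cc]
  define y where "y t = (residual1 lam c (\<gamma> t), residual2 lam c (\<gamma> t), residual3 lam c (\<gamma> t))" for t
  define y' where "y' t = (\<i> * residual2 lam c (\<gamma> t) / 2,
    \<i> * (c * residual1 lam c (\<gamma> t) / 2 - W3 (\<gamma> t) * residual2 lam c (\<gamma> t) + W1 (\<gamma> t) * residual3 lam c (\<gamma> t) / 2),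
    \<i> * (cnj (W1 (\<gamma> t)) * residual2 lam c (\<gamma> t) - W1 (\<gamma> t) * cnj (residual2 lam c (\<gamma> t))))" for t
  define K where "K t = 1 + cmod c + cmod (W3 (\<gamma> t)) + 3 * cmod (W1 (\<gamma> t))" for t
  have "y t = 0"
  proof (rule linear_ode_zero[OF I t0 t, where y' = y' and K = K])
    have P12: "residual1 lam c (\<gamma> t0) = 0 \<and> residual2 lam c (\<gamma> t0) = 0"
      using O_star_iff_residuals[OF s0(1,2)] s0(3) c_def by blast
    moreover have "residual3 lam c (\<gamma> t0) = 0"
      using residual3_eq_0[OF s0(1) cc] P12 by blast
    ultimately show "y t0 = 0" by (simp add: y_def zero_prod_def)
  next
    fix t assume "t \<in> I"
    then show "(y has_vector_derivative y' t) (at t within I)"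
      unfolding y_def[abs_def] y'_def by (intro has_vector_derivative_Pair der)
    show "norm (y' t) \<le> K t * norm (y t)"
    proof -
      define p q r w w3 where d: "p = residual1 lam c (\<gamma> t)" "q = residual2 lam c (\<gamma> t)" "r = residual3 lam c (\<gamma> t)"
        "w = W1 (\<gamma> t)" "w3 = W3 (\<gamma> t)"
      define N where "N = norm (p, q, r)"
      have N: "cmod p \<le> N" "cmod q \<le> N" "cmod r \<le> N"
        unfolding N_def by (simp_all add: norm_fst_le norm_snd_le order_trans[OF norm_fst_le norm_snd_le] order_trans[OF norm_snd_le norm_snd_le])
      have "norm (y' t) \<le> cmod (\<i> * q / 2) + (cmod (\<i> * (c * p / 2 - w3 * q + w * r / 2)) + cmod (\<i> * (cnj w * q - w * cnj q)))"
        unfolding y'_def d[symmetric] by (meson add_left_mono norm_Pair_le order_trans)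
      also have "\<dots> \<le> N + ((cmod c * N + cmod w3 * N + cmod w * N) + (cmod w * N + cmod w * N))"
      proof (intro add_mono)
        have "0 \<le> N" by (simp add: N_def)
        then show "cmod (\<i> * q / 2) \<le> N" using N by (simp add: norm_mult norm_divide)
        have "cmod (c * p / 2 - w3 * q + w * r / 2) \<le> cmod (c * p / 2) + cmod (w3 * q) + cmod (w * r / 2)"
          by (meson add_mono norm_triangle_ineq norm_triangle_ineq4 order_refl order_trans)
        also have "\<dots> \<le> cmod c * N + cmod w3 * N + cmod w * N"
        proof (intro add_mono)
          have *: "cmod (v * v' / 2) \<le> cmod v * N" if "cmod v' \<le> N" for v v'
          proof -
            have "cmod (v * v' / 2) \<le> cmod v * cmod v'" by (simp add: norm_mult norm_divide)
            also have "\<dots> \<le> cmod v * N" using that by (intro mult_left_mono) auto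
            finally show ?thesis .
          qed
          show "cmod (c * p / 2) \<le> cmod c * N" "cmod (w * r / 2) \<le> cmod w * N"
            using * N by auto
          show "cmod (w3 * q) \<le> cmod w3 * N" using N by (simp add: norm_mult mult_left_mono)
        qed
        finally show "cmod (\<i> * (c * p / 2 - w3 * q + w * r / 2)) \<le> cmod c * N + cmod w3 * N + cmod w * N"
          by (simp add: norm_mult)
        have "cmod (cnj w * q - w * cnj q) \<le> cmod (cnj w * q) + cmod (w * cnj q)"
          by (rule norm_triangle_ineq4)
        also have "\<dots> \<le> cmod w * N + cmod w * N"
          using N by (intro add_mono) (simp_all add: norm_mult mult_left_mono)
        finally show "cmod (\<i> * (cnj w * q - w * cnj q)) \<le> cmod w * N + cmod w * N"
          by (simp add: norm_mult)
      qed
      also have "\<dots> = K t * norm (y t)"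
        by (simp add: K_def y_def d N_def algebra_simps)
      finally show ?thesis .
    qed
  next
    have "continuous_on I (\<lambda>t. W3 (\<gamma> t))" "continuous_on I (\<lambda>t. W1 (\<gamma> t))"
      using gyrostat_solution_linear[OF sol] linear_complex_coords
      by (auto simp: continuous_on_eq_continuous_within intro!: has_vector_derivative_continuous)
    then show "continuous_on I K"
      unfolding K_def[abs_def] by (intro continuous_intros)
  qed
  then have "residual1 lam c (\<gamma> t) = 0 \<and> residual2 lam c (\<gamma> t) = 0" by (simp add: y_def zero_prod_def)
  then have "areas_ratio lam (\<gamma> t) = c" "areas_speed lam (\<gamma> t) = 0"
    using O_star_iff_residuals[OF dom s0(2)] by blast+
  moreover have "casimir1 (\<gamma> t) = casimir1 (\<gamma> t0)" "casimir2 (\<gamma> t) = casimir2 (\<gamma> t0)"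
    using has_vector_derivative_zero_constant[OF is_interval_convex[OF I] der(4)]
      has_vector_derivative_zero_constant[OF is_interval_convex[OF I] der(5)] t t0
    by (metis of_real_eq_iff)+
  ultimately show "\<gamma> t \<in> O_star a b lam"
    using start dom s0(2) by (simp add: O_star_iff)
qed

section \<open>Non-emptiness\<close>

lemma O_star_nonempty: "O_star a b lam \<noteq> {}"
proof -
  \<comment> \<open>\<open>z\<^sub>1 = 0\<close> and \<open>w\<^sub>3 = \<lambda>\<close> make every term of \<open>areas_speed\<close> vanish, and with \<open>\<alpha>\<close>, \<open>\<beta>\<close> along
    the axes and \<open>w\<^sub>1 = 1\<close> the value of \<open>areas_ratio\<close> is \<open>2 a\<close>\<close>
  let ?s = "(vector [1, 0, lam], vector [a, 0, 0], vector [0, - b, 0]) :: state"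
  have coords: "W1 ?s = 1" "Z1 ?s = 0" "X1 ?s = of_real (a + b)" "Y2 ?s = of_real (a - b)" "W3 ?s = of_real lam" "W2 ?s = 1"
    by (simp_all add: complex_coords complex_eq_iff)
  have "?s \<in> O_star a b lam"
    unfolding O_star_iff U_domain_iff casimir1_def casimir2_def areas_ratio_def areas_speed_def xi_def zeta_def w3_plus_def w3_minus_def coords
    by (simp add: complex_eq_iff norm_of_real power2_eq_square algebra_simps flip: of_real_add of_real_diff)
  then show ?thesis by blast
qed

section \<open>Lagrange multipliers\<close>

text \<open>The next three lemmas analyse the multiplier equations. Each complex number and its conjugate
  are separate variables there, lower case against upper case or unprimed against primed
  (\<open>u, U\<close>; \<open>x, X\<close>; \<open>e, E\<close>; \<open>k, k'\<close>; \<open>M, M'\<close>), so that the claims are statements about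
  polynomial ideals. The variable \<open>e\<close> stands for \<open>y\<^sub>2\<close>, \<open>u\<close> for \<open>\<zeta>\<close>, \<open>m\<close> and \<open>n\<close> for \<open>w\<^sub>3 + \<lambda>\<close> and
  \<open>w\<^sub>3 - \<lambda>\<close>; \<open>A\<close>, \<open>B\<close>, \<open>k\<close>, \<open>M\<close> are the multipliers of \<open>areas_speed\<close>, \<open>casimir2\<close>,
  \<open>casimir1\<close> and \<open>areas_ratio\<close>.

  The first lemma comes from adding \<open>u\<close> times the equation for \<open>\<zeta>\<close> to its conjugate, which
  makes the terms with \<open>B\<close> and \<open>k\<close> cancel.\<close>

lemma lagrange_w3:
  fixes A B M M' k k' t u U x X e E c m n lam :: complex
  assumes "A * (X - E + c) + 4 * t * (B * U + k * u) + 2 * M * m = 0"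
    and "A * (x - e + c) + 4 * t * (B * u + k' * U) + 2 * M' * m = 0"
    and "2 * B * u * U + k * u\<^sup>2 + k' * U\<^sup>2 = 0"
    and "A * c + M * u + M' * U = 0"
    and "x * U - E * u + c * (u + n) = 0" "X * u - e * U + c * (U + n) = 0"
    and "n - m + 2 * lam = 0"
  shows "A * c * (m - lam) = 0"
  using assms by algebra

text \<open>The vector field that generates the rotation does not change \<open>areas_ratio\<close>; contracting the
  multiplier equations with it isolates the imaginary part of \<open>M\<close>.\<close>

lemma lagrange_rotation:
  fixes A B M M' k k' t u U x X e E c m :: complex
  assumes "A * U + 2 * B * X + 2 * k * e + 2 * M = 0" "A * u + 2 * B * x + 2 * k' * E + 2 * M' = 0"
    and "2 * B * E + 2 * k * x + 2 * M - A * U = 0" "2 * B * e + 2 * k' * X + 2 * M' - A * u = 0"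
    and "A * (X - E + c) + 4 * t * (B * U + k * u) + 2 * M * m = 0"
    and "A * (x - e + c) + 4 * t * (B * u + k' * U) + 2 * M' * m = 0"
    and "k * (t * u\<^sup>2 + x * e) - k' * (t * U\<^sup>2 + X * E) = 0"
    and "x + e + u * m - c = 0" "X + E + U * m - c = 0"
  shows "c * (2 * (M - M') + A * (u - U)) = 0"
  using assms by algebra

text \<open>The multiplier of \<open>areas_speed\<close>, normalized to 1, cannot be present. The equations for \<open>\<xi>\<close>,
  \<open>y\<^sub>2\<close> and \<open>\<zeta>\<close> determine everything from \<open>\<zeta>\<close>: with \<open>s = 2 Re \<zeta>\<close> and \<open>d = 2 \<i> Im \<zeta>\<close> they
  force \<open>16 t = (s - 2 \<lambda>)\<^sup>2\<close>, and then \<open>t \<noteq> 0\<close> leaves only \<open>d\<^sup>2 = s (s - 2 \<lambda>)\<close>, which is \<open>c = 0\<close>.\<close>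

lemma lagrange_contradiction:
  fixes B M M' k k' t u U x X e E c lam :: complex
  assumes a: "U + 2 * B * X + 2 * k * e + 2 * M = 0" "u + 2 * B * x + 2 * k' * E + 2 * M' = 0"
    and b: "2 * B * E + 2 * k * x + 2 * M - U = 0" "2 * B * e + 2 * k' * X + 2 * M' - u = 0"
    and cc: "X - E + c + 4 * t * (B * U + k * u) + 2 * M * lam = 0"
      "x - e + c + 4 * t * (B * u + k' * U) + 2 * M' * lam = 0"
    and d: "2 * B * u * U + k * u\<^sup>2 + k' * U\<^sup>2 = 0"
    and e: "c + M * u + M' * U = 0"
    and O: "x + e + u * lam - c = 0" "X + E + U * lam - c = 0"
    and M: "2 * M - (U - lam) = 0" "2 * M' - (u - lam) = 0"
    and "c \<noteq> 0" "t \<noteq> 0"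
    and cnj: "U = cnj u" "cnj B = B" "k' = cnj k"
  shows False
proof -
  define G G' where "G = B * U + k * u" and "G' = B * u + k' * U"
  define h where "h = (G - G') / 2"
  define s d where "s = u + U" and "d = u - U"
  define Q where "Q = x - e + X - E"
  have c: "2 * c - lam * s + 2 * u * U = 0"
    using e M unfolding s_def by algebra
  have sum1: "c * (B + k) - (lam - U + lam * G) = 0"
  proof -
    have "B * (X + E) + k * (x + e) + (U - lam) = 0" using a(1) b(1) M(1) by algebra
    then show ?thesis using O unfolding G_def by algebra
  qed
  have sum2: "c * (B + k') - (lam - u + lam * G') = 0"
  proof -
    have "B * (x + e) + k' * (X + E) + (u - lam) = 0" using a(2) b(2) M(2) by algebra
    then show ?thesis using O unfolding G'_def by algebra
  qed
  have uG: "u * G + U * G' = 0"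
    using d unfolding G_def G'_def by algebra
  have "c * (G + G' - 2) = 0"
  proof -
    have "c * ((B + k) * u + (B + k') * U) - 2 * c = 0"
      using sum1 sum2 uG c unfolding s_def by algebra
    then show ?thesis unfolding G_def G'_def by algebra
  qed
  then have "G + G' = 2" using \<open>c \<noteq> 0\<close> by simp
  then have "G = 1 + h" "G' = 1 - h" by (simp_all add: h_def field_simps)
  then have G1: "G - 1 - h = 0" and G2: "G' - 1 + h = 0" by simp_all
  \<comment> \<open>the real number \<open>\<i> h\<close> measures the phase of \<open>1 + h\<close>, and this relation ties it to that of \<open>u\<close>\<close>
  have s: "s + h * d = 0" using uG G1 G2 unfolding s_def d_def by algebra
  have D1: "U + B * (X - E) - k * (x - e) = 0" using a(1) b(1) by algebra
  have D2: "u + B * (x - e) - k' * (X - E) = 0" using a(2) b(2) by algebra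
  have ku1: "k * u - 1 - h + B * U = 0" using G1 unfolding G_def by algebra
  have "G * (x - e) - G' * (X - E)
      = U * (u + B * (x - e) - k' * (X - E)) - u * (U + B * (X - E) - k * (x - e))"
    unfolding G_def G'_def by (simp add: algebra_simps)
  then have DD: "(1 + h) * (x - e) - (1 - h) * (X - E) = 0"
    unfolding D1 D2 \<open>G = 1 + h\<close> \<open>G' = 1 - h\<close> by simp
  have D'1: "2 * (x - e) - (1 - h) * Q = 0"
    using DD unfolding Q_def by (simp add: algebra_simps)
  have D'2: "2 * (X - E) - (1 + h) * Q = 0"
    using DD unfolding Q_def by (simp add: algebra_simps)
  have "(1 - h\<^sup>2) * (2 * Q + d\<^sup>2) = 0"
  proof -
    have "2 * u * U - (1 - h\<^sup>2) * Q + B * Q * (s + h * d) = 0"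
      using D1 ku1 D'1 D'2 unfolding s_def d_def by algebra
    then show ?thesis using s unfolding s_def d_def by algebra
  qed
  moreover have "1 - h\<^sup>2 \<noteq> 0"
  proof -
    have "G' = cnj G" unfolding G_def G'_def by (simp add: cnj)
    then have "Re h = 0" by (simp add: h_def)
    then have "Re (1 - h\<^sup>2) = 1 + (Im h)\<^sup>2" by (simp add: power2_eq_square)
    also have "\<dots> > 0" by (simp add: add_pos_nonneg)
    finally have "Re (1 - h\<^sup>2) > 0" .
    then show ?thesis by auto
  qed
  ultimately have Q: "2 * Q + d\<^sup>2 = 0" by simp
  have c2: "4 * c - 2 * lam * s + s\<^sup>2 - d\<^sup>2 = 0"
    using c unfolding s_def d_def by algebra
  have "d \<noteq> 0" using s c2 \<open>c \<noteq> 0\<close> by auto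
  have cG1: "(1 + h) * Q + 2 * c + 8 * t * (1 + h) + 2 * (U - lam) * lam = 0"
    using cc(1) D'2 M(1) G1 unfolding G_def by algebra
  have cG2: "(1 - h) * Q + 2 * c + 8 * t * (1 - h) + 2 * (u - lam) * lam = 0"
    using cc(2) D'1 M(2) G2 unfolding G'_def by algebra
  have t: "16 * t - (s - 2 * lam)\<^sup>2 = 0"
    using cG1 cG2 Q c2 unfolding s_def d_def by algebra
  have "d * (h * Q + 8 * t * h - lam * d) = 0"
    using cG1 cG2 unfolding d_def by algebra
  then have "(s - 2 * lam) * (d\<^sup>2 - s * (s - 2 * lam)) = 0"
    using Q t s by algebra
  then have "d\<^sup>2 - s * (s - 2 * lam) = 0" using t \<open>t \<noteq> 0\<close> by auto
  then have "4 * c = 0" using c2 by algebra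
  with \<open>c \<noteq> 0\<close> show False by simp
qed

text \<open>Without the multipliers of the two equations, the differentials of the Casimir functions
  would have to be dependent. That happens only where the inequality between the arithmetic
  and the geometric mean, \<open>|casimir1| \<le> casimir2 / 2\<close>, is an equality.\<close>

lemma lagrange_degenerate:
  fixes be t :: real and ka u x e :: complex
  assumes "of_real be * cnj x + ka * e = 0" "of_real be * cnj e + ka * x = 0"
    and "of_real be * cnj u + ka * u = 0" and "t > 0"
    and strict: "cmod (of_real t * u\<^sup>2 + x * e) < ((cmod x)\<^sup>2 + (cmod e)\<^sup>2) / 2 + t * (cmod u)\<^sup>2"
  shows "be = 0 \<and> ka = 0"
proof -
  have norm_eq: "\<bar>be\<bar> * cmod v = cmod ka * cmod v'" if "of_real be * cnj v + ka * v' = 0" for v v'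
  proof -
    have "cmod (of_real be * cnj v) = cmod (ka * v')"
      using that by (metis add_eq_0_iff norm_minus_cancel)
    then show ?thesis by (simp add: norm_mult)
  qed
  note eqs = norm_eq[OF assms(1)] norm_eq[OF assms(2)] norm_eq[OF assms(3)]
  have "(\<bar>be\<bar> - cmod ka) * (cmod x + cmod e + cmod u) = 0"
    using eqs by (simp add: algebra_simps)
  moreover have "cmod x + cmod e + cmod u \<noteq> 0"
  proof
    assume "cmod x + cmod e + cmod u = 0"
    then have "cmod x = 0 \<and> cmod e = 0 \<and> cmod u = 0"
      using norm_ge_zero[of x] norm_ge_zero[of e] norm_ge_zero[of u] by linarith
    then show False using strict by simp
  qed
  ultimately have be_ka: "\<bar>be\<bar> = cmod ka" by simp
  have "be = 0"
  proof (rule ccontr)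
    assume "be \<noteq> 0"
    then have "cmod x = cmod e" using eqs be_ka by auto
    have "ka * (of_real t * u\<^sup>2 + x * e) = - of_real be * (of_real t * (u * cnj u) + x * cnj x)"
    proof -
      have "ka * u = - of_real be * cnj u" "ka * e = - of_real be * cnj x"
        using assms(1,3) by (simp_all add: add_eq_0_iff)
      then have "ka * u * (of_real t * u) + ka * e * x
          = - of_real be * cnj u * (of_real t * u) + - of_real be * cnj x * x" by simp
      then show ?thesis by (simp add: algebra_simps power2_eq_square)
    qed
    also have "\<dots> = of_real (- be * (t * (cmod u)\<^sup>2 + (cmod x)\<^sup>2))"
      by (simp add: complex_norm_square[symmetric])
    finally have "cmod (ka * (of_real t * u\<^sup>2 + x * e)) = \<bar>be\<bar> * (t * (cmod u)\<^sup>2 + (cmod x)\<^sup>2)"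
      using \<open>t > 0\<close> by (simp only: norm_of_real abs_mult abs_minus_cancel) simp
    then have "cmod (of_real t * u\<^sup>2 + x * e) = t * (cmod u)\<^sup>2 + (cmod x)\<^sup>2"
      using be_ka \<open>be \<noteq> 0\<close> by (auto simp: norm_mult)
    then show False using strict \<open>cmod x = cmod e\<close> by simp
  qed
  with be_ka show ?thesis by simp
qed

text \<open>The adapted derivatives can be prescribed arbitrarily, hence the coefficients of a vanishing
  linear functional can be read off one by one.\<close>

lemma tangent_vector_exists:
  assumes "s \<in> U_domain"
  shows "\<exists>v. dlog_w1 s v = \<nu> \<and> d_zeta s v = p \<and> d_xi s v = q \<and> Y2 v = r \<and> d_w3 v = \<mu>"
proof -
  have w: "W1 s \<noteq> 0" using assms by (simp add: U_domain_iff)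
  have ex: "\<exists>v. W1 v = w \<and> Z1 v = z \<and> X1 v = x \<and> Y2 v = y \<and> Re (W3 v) = m" for w z x y m
    by (rule exI[of _ "(vector [Re w, Im w, m], vector [(Re x + Re y) / 2, (Im x - Im y) / 2, Re z],
       vector [(Im x + Im y) / 2, (Re y - Re x) / 2, Im z])"])
      (simp add: complex_coords complex_eq_iff field_simps)
  obtain v where v: "W1 v = W1 s * \<nu>" "Z1 v = W1 s * (p + zeta s * \<nu>)"
     "X1 v = (q - xi s * (cnj \<nu> - \<nu>)) * W1 s / cnj (W1 s)" "Y2 v = r" "Re (W3 v) = \<mu>"
    using ex[of "W1 s * \<nu>" "W1 s * (p + zeta s * \<nu>)" "(q - xi s * (cnj \<nu> - \<nu>)) * W1 s / cnj (W1 s)" r \<mu>]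
    by (elim exE conjE)
  have dlog_w1: "dlog_w1 s v = \<nu>" using w by (simp add: dlog_w1_def v)
  have "d_zeta s v = p" using w by (simp add: d_zeta_def dlog_w1 v algebra_simps add_divide_distrib)
  moreover have "d_xi s v = q" using w by (simp add: d_xi_def dlog_w1 v cnj_coords)
  moreover have "d_w3 v = \<mu>" by (simp add: d_w3_def v)
  ultimately show ?thesis using dlog_w1 v(4) by blast
qed

text \<open>The value on \<open>v\<close> of a linear combination of the differentials, sorted by the adapted
  derivatives of \<open>v\<close>. The term with \<open>eps\<close> anticipates the second use: \<open>eps = 0\<close> asks whether the
  equations of the manifold are independent, \<open>eps = 1\<close> whether the differential of
  \<open>Re areas_ratio\<close> is a combination of theirs.\<close>

lemma functional_reduced:
  fixes q :: complex and al be c c3 eps lam :: real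
  assumes s: "s \<in> U_domain" and c: "areas_ratio lam s = of_real c"
  defines "u \<equiv> zeta s" and "x \<equiv> xi s" and "e \<equiv> Y2 s" and "t \<equiv> tau s" and "m \<equiv> w3_plus lam s" and "n \<equiv> w3_minus lam s"
  defines "k \<equiv> q * (W1 s / cnj (W1 s)) / 2"
  defines "mu \<equiv> (of_real al * (u + of_real n) - of_real eps - \<i> * of_real c3) / 2"
  shows "Re (q * d_casimir1 s v) + be * d_casimir2 s v + c3 * Im (d_areas_ratio lam s v) + al * Re (d_areas_speed lam s v) - eps * Re (d_areas_ratio lam s v) =
      Re (d_xi s v * (of_real al * cnj u + 2 * of_real be * cnj x + 2 * k * e + 2 * mu))
    + Re (Y2 v * (2 * of_real be * cnj e + 2 * k * x + 2 * mu - of_real al * cnj u))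
    + Re (d_zeta s v * (of_real al * (cnj x - cnj e + of_real c) + 4 * of_real t * (of_real be * cnj u + k * u)
        + 2 * mu * of_real m))
    + d_w3 v * (al * c + 2 * Re (mu * u))
    + Re (dlog_w1 s v) * (4 * t * (be * (cmod u)\<^sup>2 + Re (k * u\<^sup>2)))
    - Im (dlog_w1 s v) * (4 * Im (k * (of_real t * u\<^sup>2 + x * e)))"
proof -
  have casimir1: "q * d_casimir1 s v = 2 * k * (of_real (2 * t * Re (dlog_w1 s v)) * u\<^sup>2 + of_real (2 * t) * u * d_zeta s v
      + d_xi s v * e + x * Y2 v
      + (dlog_w1 s v - cnj (dlog_w1 s v)) * (of_real t * u\<^sup>2 + x * e))"
    by (simp add: d_casimir1_def k_def u_def x_def e_def t_def)
  have mu: "Re mu = (al * (Re u + n) - eps) / 2" "Im mu = (al * Im u - c3) / 2"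
    by (simp_all add: mu_def)
  show ?thesis
    unfolding casimir1 d_casimir2_def d_areas_speed_def d_areas_ratio_def c u_def[symmetric] x_def[symmetric] e_def[symmetric] t_def[symmetric]
      m_def[symmetric] n_def[symmetric] cmod_power2 power2_eq_square
    by (simp add: mu) (simp add: field_simps)
qed

lemma O_star_relations:
  assumes "s \<in> O_star a b lam"
  defines "u \<equiv> zeta s" and "x \<equiv> xi s" and "e \<equiv> Y2 s" and "t \<equiv> tau s" and "m \<equiv> w3_plus lam s" and "n \<equiv> w3_minus lam s"
    and "c \<equiv> Re (areas_ratio lam s)"
  shows "s \<in> U_domain" "t > 0" "areas_ratio lam s = of_real c" "x + e + u * of_real m = of_real c"
    "x * cnj u - cnj e * u + of_real c * (u + of_real n) = 0"
    "cmod (of_real t * u\<^sup>2 + x * e) = \<bar>a\<^sup>2 - b\<^sup>2\<bar>"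
    "((cmod x)\<^sup>2 + (cmod e)\<^sup>2) / 2 + t * (cmod u)\<^sup>2 = a\<^sup>2 + b\<^sup>2"
proof -
  show s: "s \<in> U_domain" using assms(1) by (simp add: O_star_iff)
  then show "t > 0" by (simp add: t_def tau_pos)
  show c: "areas_ratio lam s = of_real c" using assms(1) by (simp add: O_star_iff c_def complex_eq_iff)
  then show "x + e + u * of_real m = of_real c" by (simp add: areas_ratio_def u_def x_def e_def m_def)
  have "areas_speed lam s = 0" using assms(1) by (simp add: O_star_iff)
  then show "x * cnj u - cnj e * u + of_real c * (u + of_real n) = 0"
    by (simp add: areas_speed_def c u_def x_def e_def n_def)
  have "W1 s \<noteq> 0" using s by (simp add: U_domain_iff)
  then have "cmod (casimir1 s) = cmod (of_real t * u\<^sup>2 + x * e)"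
    by (simp add: casimir1_reduced[OF s] norm_mult norm_divide t_def u_def x_def e_def)
  moreover have "casimir1 s = of_real (a\<^sup>2 - b\<^sup>2)" using assms(1) by (simp only: O_star_iff)
  ultimately show "cmod (of_real t * u\<^sup>2 + x * e) = \<bar>a\<^sup>2 - b\<^sup>2\<bar>"
    by (simp only: norm_of_real)
  show "((cmod x)\<^sup>2 + (cmod e)\<^sup>2) / 2 + t * (cmod u)\<^sup>2 = a\<^sup>2 + b\<^sup>2"
    using assms(1) by (simp add: O_star_iff casimir2_reduced[OF s] t_def u_def x_def e_def field_simps)
qed

text \<open>A Lagrange identity; the left-hand side is \<open>4 a\<^sup>2 b\<^sup>2\<close> on \<open>P6\<close>.\<close>

lemma casimir_identity:
  fixes u x e :: complex and t :: real
  shows "(((cmod x)\<^sup>2 + (cmod e)\<^sup>2) / 2 + t * (cmod u)\<^sup>2)\<^sup>2 - (cmod (of_real t * u\<^sup>2 + x * e))\<^sup>2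
    = ((cmod x)\<^sup>2 - (cmod e)\<^sup>2)\<^sup>2 / 4 + t * (cmod (x * cnj u - cnj e * u))\<^sup>2"
  unfolding cmod_power2 by (simp add: power2_eq_square) (simp add: field_simps)

text \<open>On the manifold both squares of the previous identity are divisible by the square of
  \<open>c = Re areas_ratio\<close>. In particular \<open>c\<close> never vanishes, which keeps the multiplier analysis
  free of exceptional points.\<close>

lemma O_star_identity:
  assumes "s \<in> O_star a b lam"
  defines "c \<equiv> Re (areas_ratio lam s)"
  shows "c\<^sup>2 * ((2 * (c - Re (Y2 s)) + w3_plus lam s * w3_minus lam s - c)\<^sup>2 / 4
      + tau s * (cmod (zeta s + of_real (w3_minus lam s)))\<^sup>2) = 4 * a\<^sup>2 * b\<^sup>2"
proof -
  define u x e t m n where d: "u = zeta s" "x = xi s" "e = Y2 s" "t = tau s" "m = w3_plus lam s" "n = w3_minus lam s"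
  note r = O_star_relations[OF assms(1), folded d, folded c_def]
  have "(((cmod x)\<^sup>2 + (cmod e)\<^sup>2) / 2 + t * (cmod u)\<^sup>2)\<^sup>2 - (cmod (of_real t * u\<^sup>2 + x * e))\<^sup>2 = 4 * a\<^sup>2 * b\<^sup>2"
    unfolding r(6,7) power2_abs by (simp add: power2_eq_square algebra_simps)
  moreover have "x * cnj u - cnj e * u = - of_real c * (u + of_real n)"
    using r(5) by (simp add: add_eq_0_iff)
  moreover have "(cmod x)\<^sup>2 - (cmod e)\<^sup>2 = c * (2 * (c - Re e) + m * n - c)"
  proof -
    have x: "x = of_real c - e - u * of_real m" using r(4) by (simp add: algebra_simps)
    have "Re (x * cnj u - cnj e * u + of_real c * (u + of_real n)) = 0" unfolding r(5) by simp
    then have "c * n = 2 * Re (e * cnj u) - 2 * c * Re u + m * (cmod u)\<^sup>2"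
      unfolding x cmod_power2 by (simp add: algebra_simps power2_eq_square)
    then have "m * (c * n) = m * (2 * Re (e * cnj u) - 2 * c * Re u + m * (cmod u)\<^sup>2)"
      by (simp only:)
    then show ?thesis
      unfolding x cmod_power2 by (simp add: algebra_simps power2_eq_square)
  qed
  ultimately have "4 * a\<^sup>2 * b\<^sup>2 = (c * (2 * (c - Re e) + m * n - c))\<^sup>2 / 4
      + t * (cmod (- of_real c * (u + of_real n)))\<^sup>2"
    using casimir_identity[of x e t u] by simp
  then show ?thesis
    unfolding d[symmetric] norm_mult power_mult_distrib
    by (simp add: distrib_left mult.left_commute[of t])
qed

lemma Re_areas_ratio_nonzero:
  assumes "s \<in> O_star a b lam" "a > b" "b > 0"
  shows "Re (areas_ratio lam s) \<noteq> 0"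
  using O_star_identity[OF assms(1)] assms(2,3) by auto

text \<open>The heart of the smoothness claim: the differentials of the five defining functions are
  linearly independent at every point of \<open>O_star\<close>. The second part locates the points at which
  the differential of \<open>Re areas_ratio\<close> may depend on them.\<close>

lemma lagrange_multipliers:
  fixes al be c3 eps :: real and q :: complex
  assumes s: "s \<in> O_star a b lam" and ab: "a > b" "b > 0"
    and H: "\<And>v. Re (q * d_casimir1 s v) + be * d_casimir2 s v + c3 * Im (d_areas_ratio lam s v) + al * Re (d_areas_speed lam s v)
      = eps * Re (d_areas_ratio lam s v)"
  shows "eps = 0 \<Longrightarrow> q = 0 \<and> be = 0 \<and> c3 = 0 \<and> al = 0"
    and "eps \<noteq> 0 \<Longrightarrow> w3_plus lam s = lam \<or> Re (zeta s) = 0"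
proof -
  define u x e t m n c where d: "u = zeta s" "x = xi s" "e = Y2 s" "t = tau s" "m = w3_plus lam s"
    "n = w3_minus lam s" "c = Re (areas_ratio lam s)"
  note r = O_star_relations[OF s, folded d]
  have "c \<noteq> 0" using Re_areas_ratio_nonzero[OF s ab] by (simp add: d)
  define k where "k = q * (W1 s / cnj (W1 s)) / 2"
  define mu where "mu = (of_real al * (u + of_real n) - of_real eps - \<i> * of_real c3) / 2"
  note red = functional_reduced[OF r(1,3), where q = q and be = be and ?c3.0 = c3 and al = al and eps = eps, folded d, folded k_def mu_def]
  have lin: "Re (d_xi s v * (of_real al * cnj u + 2 * of_real be * cnj x + 2 * k * e + 2 * mu))
    + Re (Y2 v * (2 * of_real be * cnj e + 2 * k * x + 2 * mu - of_real al * cnj u))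
    + Re (d_zeta s v * (of_real al * (cnj x - cnj e + of_real c) + 4 * of_real t * (of_real be * cnj u + k * u)
        + 2 * mu * of_real m))
    + d_w3 v * (al * c + 2 * Re (mu * u))
    + Re (dlog_w1 s v) * (4 * t * (be * (cmod u)\<^sup>2 + Re (k * u\<^sup>2)))
    - Im (dlog_w1 s v) * (4 * Im (k * (of_real t * u\<^sup>2 + x * e))) = 0" for v
    unfolding red[symmetric] using H[of v] by simp
  have all: "Re (q' * (of_real al * cnj u + 2 * of_real be * cnj x + 2 * k * e + 2 * mu))
    + Re (r' * (2 * of_real be * cnj e + 2 * k * x + 2 * mu - of_real al * cnj u))
    + Re (p' * (of_real al * (cnj x - cnj e + of_real c) + 4 * of_real t * (of_real be * cnj u + k * u)
        + 2 * mu * of_real m))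
    + m' * (al * c + 2 * Re (mu * u))
    + Re \<nu> * (4 * t * (be * (cmod u)\<^sup>2 + Re (k * u\<^sup>2)))
    - Im \<nu> * (4 * Im (k * (of_real t * u\<^sup>2 + x * e))) = 0" for q' r' p' m' \<nu>
    using tangent_vector_exists[OF r(1), of \<nu> p' q' r' m'] lin by metis
  have zero: "z = 0" if "\<And>y. Re (y * z) = 0" for z
    using that[of "cnj z"] by (simp add: complex_eq_iff)
  have A: "of_real al * cnj u + 2 * of_real be * cnj x + 2 * k * e + 2 * mu = 0"
    using all[where r' = 0 and p' = 0 and m' = 0 and \<nu> = 0] by (intro zero) simp
  have B: "2 * of_real be * cnj e + 2 * k * x + 2 * mu - of_real al * cnj u = 0"
    using all[where q' = 0 and p' = 0 and m' = 0 and \<nu> = 0] by (intro zero) simp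
  have C: "of_real al * (cnj x - cnj e + of_real c) + 4 * of_real t * (of_real be * cnj u + k * u)
        + 2 * mu * of_real m = 0"
    using all[where q' = 0 and r' = 0 and m' = 0 and \<nu> = 0] by (intro zero) simp
  have E: "al * c + 2 * Re (mu * u) = 0"
    using all[where q' = 0 and r' = 0 and p' = 0 and m' = 1 and \<nu> = 0] by simp
  have D: "be * (cmod u)\<^sup>2 + Re (k * u\<^sup>2) = 0"
    using all[where q' = 0 and r' = 0 and p' = 0 and m' = 0 and \<nu> = 1] r(2) by simp
  have G: "Im (k * (of_real t * u\<^sup>2 + x * e)) = 0"
    using all[where q' = 0 and r' = 0 and p' = 0 and m' = 0 and \<nu> = \<i>] by simp

  \<comment> \<open>pass to complex equations and adjoin all conjugates\<close>
  define A' B' c' t' m' n' where r': "A' = complex_of_real al" "B' = complex_of_real be"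
    "c' = complex_of_real c" "t' = complex_of_real t" "m' = complex_of_real m" "n' = complex_of_real n"
  have cnj': "cnj A' = A'" "cnj B' = B'" "cnj c' = c'" "cnj t' = t'" "cnj m' = m'" "cnj n' = n'"
    by (simp_all add: r')
  define U X E' k' M' where c: "U = cnj u" "X = cnj x" "E' = cnj e" "k' = cnj k" "M' = cnj mu"
  have a1: "A' * U + 2 * B' * X + 2 * k * e + 2 * mu = 0" using A by (simp add: r' c)
  have a2: "A' * u + 2 * B' * x + 2 * k' * E' + 2 * M' = 0"
    using arg_cong[OF a1, of cnj] by (simp add: cnj' c)
  have b1: "2 * B' * E' + 2 * k * x + 2 * mu - A' * U = 0" using B by (simp add: r' c)
  have b2: "2 * B' * e + 2 * k' * X + 2 * M' - A' * u = 0"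
    using arg_cong[OF b1, of cnj] by (simp add: cnj' c)
  have c1: "A' * (X - E' + c') + 4 * t' * (B' * U + k * u) + 2 * mu * m' = 0" using C by (simp add: r' c)
  have c2: "A' * (x - e + c') + 4 * t' * (B' * u + k' * U) + 2 * M' * m' = 0"
    using arg_cong[OF c1, of cnj] by (simp add: cnj' c)
  have d1: "2 * B' * u * U + k * u\<^sup>2 + k' * U\<^sup>2 = 0"
  proof -
    have "k * u\<^sup>2 + k' * U\<^sup>2 = of_real (2 * Re (k * u\<^sup>2))"
      unfolding c by (metis complex_add_cnj complex_cnj_mult complex_cnj_power)
    moreover have "2 * B' * u * U = of_real (2 * (be * (cmod u)\<^sup>2))"
      by (simp add: r' c complex_norm_square[symmetric] mult.assoc)
    ultimately show ?thesis using D by (metis add.assoc distrib_left mult_zero_right of_real_0 of_real_add)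
  qed
  have e1: "A' * c' + mu * u + M' * U = 0"
  proof -
    have "mu * u + M' * U = of_real (2 * Re (mu * u))"
      unfolding c by (metis complex_add_cnj complex_cnj_mult)
    then show ?thesis using E by (metis add.assoc of_real_0 of_real_add of_real_mult r'(1,3))
  qed
  have O1: "x + e + u * m' - c' = 0" using r(4) by (simp add: r')
  have O1': "X + E' + U * m' - c' = 0" using arg_cong[OF O1, of cnj] by (simp add: cnj' c)
  have O2: "x * U - E' * u + c' * (u + n') = 0" using r(5) by (simp add: r' c)
  have O2': "X * u - e * U + c' * (U + n') = 0" using arg_cong[OF O2, of cnj] by (simp add: cnj' c)
  have g1: "k * (t' * u\<^sup>2 + x * e) - k' * (t' * U\<^sup>2 + X * E') = 0"
  proof -
    have "k' * (t' * U\<^sup>2 + X * E') = cnj (k * (t' * u\<^sup>2 + x * e))" by (simp add: c cnj')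
    also have "\<dots> = k * (t' * u\<^sup>2 + x * e)"
    proof -
      have "Im (k * (t' * u\<^sup>2 + x * e)) = 0" using G by (simp only: r')
      then show ?thesis using complex_is_Real_iff Reals_cnj_iff by blast
    qed
    finally show ?thesis by simp
  qed
  have nm: "n' - m' + 2 * of_real lam = 0" by (simp add: r' d w3_plus_def w3_minus_def)
  have "c' \<noteq> 0" "t' \<noteq> 0" using \<open>c \<noteq> 0\<close> r(2) by (simp_all add: r')
  have "A' * c' * (m' - of_real lam) = 0"
    by (rule lagrange_w3[OF c1 c2 d1 e1 O2 O2' nm])
  then have w3: "al = 0 \<or> m = lam" using \<open>c' \<noteq> 0\<close> by (auto simp: r')
  have "c' * (2 * (mu - M') + A' * (u - U)) = 0"
    by (rule lagrange_rotation[OF a1 a2 b1 b2 c1 c2 g1 O1 O1'])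
  then have rot: "2 * (mu - M') + A' * (u - U) = 0" using \<open>c' \<noteq> 0\<close> by simp
  have M2: "2 * (mu + M') - (A' * (u + U + 2 * n') - 2 * of_real eps) = 0"
    by (simp add: complex_eq_iff mu_def c r' diff_divide_distrib)
  show "w3_plus lam s = lam \<or> Re (zeta s) = 0" if "eps \<noteq> 0"
  proof (cases "al = 0")
    case True
    then have "mu = - of_real eps / 2"
      using rot M2 by (simp add: r' complex_eq_iff c)
    then have "Re u = 0" using E True that by simp
    then show ?thesis by (simp add: d)
  next
    case False
    then show ?thesis using w3 by (simp add: d)
  qed
  show "q = 0 \<and> be = 0 \<and> c3 = 0 \<and> al = 0" if "eps = 0"
  proof -
    have al: "al = 0"
    proof (rule ccontr)
      assume "al \<noteq> 0"
      then have "m = lam" and A'0: "A' \<noteq> 0" using w3 by (auto simp: r')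
      then have ml: "m' = of_real lam" and nl: "n' = - of_real lam"
        by (simp_all add: r' d w3_plus_def w3_minus_def)
      have div: "2 * (mu / A') = U - of_real lam" "2 * (M' / A') = u - of_real lam"
      proof -
        have "4 * mu - A' * (2 * (U + n')) = (2 * (mu - M') + A' * (u - U))
            + (2 * (mu + M') - (A' * (u + U + 2 * n') - 2 * of_real eps))"
          and "4 * M' - A' * (2 * (u + n')) = (2 * (mu + M') - (A' * (u + U + 2 * n') - 2 * of_real eps))
            - (2 * (mu - M') + A' * (u - U))"
          using that by (simp_all add: algebra_simps)
        then have "4 * mu - A' * (2 * (U + n')) = 0" "4 * M' - A' * (2 * (u + n')) = 0"
          unfolding rot M2 by simp_all
        then have "2 * (2 * mu - A' * (U + n')) = 0" "2 * (2 * M' - A' * (u + n')) = 0"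
          by (simp_all add: algebra_simps)
        then have "2 * mu = A' * (U + n')" "2 * M' = A' * (u + n')" by simp_all
        then show "2 * (mu / A') = U - of_real lam" "2 * (M' / A') = u - of_real lam"
          using A'0 nl by simp_all
      qed
      show False
      proof (rule lagrange_contradiction)
        show "U + 2 * (B' / A') * X + 2 * (k / A') * e + 2 * (mu / A') = 0"
          using a1 A'0 by (simp add: field_simps)
        show "u + 2 * (B' / A') * x + 2 * (k' / A') * E' + 2 * (M' / A') = 0"
          using a2 A'0 by (simp add: field_simps)
        show "2 * (B' / A') * E' + 2 * (k / A') * x + 2 * (mu / A') - U = 0"
          using b1 A'0 by (simp add: field_simps)
        show "2 * (B' / A') * e + 2 * (k' / A') * X + 2 * (M' / A') - u = 0"
          using b2 A'0 by (simp add: field_simps)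
        show "X - E' + c' + 4 * t' * (B' / A' * U + k / A' * u) + 2 * (mu / A') * of_real lam = 0"
          using c1 A'0 by (simp add: field_simps ml)
        show "x - e + c' + 4 * t' * (B' / A' * u + k' / A' * U) + 2 * (M' / A') * of_real lam = 0"
          using c2 A'0 by (simp add: field_simps ml)
        show "2 * (B' / A') * u * U + k / A' * u\<^sup>2 + k' / A' * U\<^sup>2 = 0"
          using d1 A'0 by (simp add: field_simps)
        show "c' + mu / A' * u + M' / A' * U = 0"
          using e1 A'0 by (simp add: field_simps)
        show "x + e + u * of_real lam - c' = 0" "X + E' + U * of_real lam - c' = 0"
          using O1 O1' by (simp_all add: ml)
        show "2 * (mu / A') - (U - of_real lam) = 0" "2 * (M' / A') - (u - of_real lam) = 0"
          using div by simp_all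
        show "c' \<noteq> 0" "t' \<noteq> 0" by fact+
        show "U = cnj u" by (simp add: c)
        show "cnj (B' / A') = B' / A'" "k' / A' = cnj (k / A')" by (simp_all add: cnj' c)
      qed
    qed
    then have "mu = 0"
      using rot M2 that by (simp add: r' complex_eq_iff c)
    have "be = 0 \<and> k = 0"
    proof (rule lagrange_degenerate)
      have half: "z = 0" if "2 * z = 0" for z :: complex using that by simp
      show "of_real be * cnj x + k * e = 0"
        by (rule half) (use A in \<open>simp add: \<open>mu = 0\<close> al algebra_simps\<close>)
      show "of_real be * cnj e + k * x = 0"
        by (rule half) (use B in \<open>simp add: \<open>mu = 0\<close> al algebra_simps\<close>)
      show "of_real be * cnj u + k * u = 0" using C \<open>mu = 0\<close> al r(2) by simp
      show "cmod (of_real t * u\<^sup>2 + x * e) < ((cmod x)\<^sup>2 + (cmod e)\<^sup>2) / 2 + t * (cmod u)\<^sup>2"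
        unfolding r(6,7) using ab by (simp add: abs_if)
      show "t > 0" by (rule r(2))
    qed
    moreover have "W1 s \<noteq> 0" using r(1) by (simp add: U_domain_iff)
    ultimately show ?thesis
      using al \<open>mu = 0\<close> that by (simp add: k_def mu_def)
  qed
qed

section \<open>The submanifold\<close>

text \<open>The Casimir equations followed by \<open>U1 = 0\<close> and \<open>U2 = 0\<close> in reduced form, as a family indexed
  by \<open>i < 5\<close>.\<close>

definition O_star_eqn :: "real \<Rightarrow> real \<Rightarrow> real \<Rightarrow> nat \<Rightarrow> state \<Rightarrow> real" where
  "O_star_eqn a b lam i s = [Re (casimir1 s) - (a\<^sup>2 - b\<^sup>2), Im (casimir1 s), casimir2 s - 2 * (a\<^sup>2 + b\<^sup>2),
     Im (areas_ratio lam s), Re (areas_speed lam s)] ! i"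
definition d_O_star_eqn :: "real \<Rightarrow> nat \<Rightarrow> state \<Rightarrow> state \<Rightarrow> real" where
  "d_O_star_eqn lam i s v = [Re (d_casimir1 s v), Im (d_casimir1 s v), d_casimir2 s v, Im (d_areas_ratio lam s v), Re (d_areas_speed lam s v)] ! i"

lemma less_5: "i < 5 \<longleftrightarrow> i = 0 \<or> i = 1 \<or> i = 2 \<or> i = 3 \<or> i = (4::nat)"
  by auto

lemma all_less_5: "(\<forall>i<5. P i) \<longleftrightarrow> P 0 \<and> P 1 \<and> P 2 \<and> P 3 \<and> P (4::nat)"
  unfolding less_5 by blast

lemma sum_5: "(\<Sum>i<5. f i) = f 0 + f 1 + f 2 + f 3 + f (4::nat)" for f :: "nat \<Rightarrow> real"
  by (simp add: eval_nat_numeral)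

lemma O_star_iff_equations: "s \<in> O_star a b lam \<longleftrightarrow> s \<in> U_domain \<and> (\<forall>i<5. O_star_eqn a b lam i s = 0)"
proof -
  have casimir1: "casimir1 s = of_real (a\<^sup>2 - b\<^sup>2) \<longleftrightarrow> Re (casimir1 s) = a\<^sup>2 - b\<^sup>2 \<and> Im (casimir1 s) = 0"
    by (simp only: complex_eq_iff complex_of_real_def complex.sel)
  have T: "areas_speed lam s = 0 \<longleftrightarrow> Re (areas_speed lam s) = 0" if "Im (areas_ratio lam s) = 0"
    using Im_areas_speed_eq_0[OF that] by (simp add: complex_eq_iff)
  show ?thesis
  proof (cases "Im (areas_ratio lam s) = 0")
    case True
    then show ?thesis
      unfolding O_star_iff all_less_5 casimir1 T[OF True] by (simp add: O_star_eqn_def)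
  next
    case False
    then show ?thesis
      unfolding O_star_iff all_less_5 by (simp add: O_star_eqn_def)
  qed
qed

lemma O_star_eqn_has_derivative:
  assumes "s \<in> U_domain" "i < 5" shows "(O_star_eqn a b lam i has_derivative d_O_star_eqn lam i s) (at s)"
proof -
  have minus: "((\<lambda>x. f x - k) has_derivative f') (at s)" if "(f has_derivative f') (at s)"
    for f :: "state \<Rightarrow> real" and f' k
    by (rule has_derivative_eq_rhs[OF has_derivative_diff[OF that has_derivative_const]]) simp
  show ?thesis
    using assms(2) unfolding less_5 O_star_eqn_def[abs_def] d_O_star_eqn_def[abs_def]
    by (elim disjE) (simp_all add: minus has_derivative_Re has_derivative_Im
      casimir1_has_derivative[OF assms(1)] casimir2_has_derivative[OF assms(1)]
      areas_ratio_has_derivative[OF assms(1)] areas_speed_has_derivative[OF assms(1)])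
qed

lemma d_O_star_eqn_combination:
  "(\<Sum>i<5. c i * d_O_star_eqn lam i s v) = Re (Complex (c 0) (- c 1) * d_casimir1 s v) + c 2 * d_casimir2 s v
     + c 3 * Im (d_areas_ratio lam s v) + c 4 * Re (d_areas_speed lam s v)"
  by (simp add: sum_5 d_O_star_eqn_def)

lemma d_O_star_eqn_independent:
  assumes "s \<in> O_star a b lam" "a > b" "b > 0"
    and "\<And>v. (\<Sum>i<5. c i * d_O_star_eqn lam i s v) = 0"
  shows "\<forall>i<5. c i = 0"
proof -
  have "Complex (c 0) (- c 1) = 0 \<and> c 2 = 0 \<and> c 3 = 0 \<and> c 4 = 0"
    using lagrange_multipliers(1)[OF assms(1-3), of "Complex (c 0) (- c 1)" "c 2" "c 3" "c 4" 0] assms(4)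
    by (simp add: d_O_star_eqn_combination)
  then show ?thesis by (auto simp: less_5 complex_eq_iff)
qed

lemma smooth_on_zeta: "smooth_on U_domain zeta"
  unfolding zeta_def[abs_def]
  by (intro smooth_intros open_U_domain smooth_on_linear linear_complex_coords) (simp add: U_domain_iff)

lemma smooth_on_xi: "smooth_on U_domain xi"
  unfolding xi_def[abs_def]
  by (intro smooth_intros open_U_domain smooth_on_linear linear_complex_coords) (simp add: U_domain_iff)

lemma smooth_on_O_star_eqn:
  assumes "i < 5" shows "smooth_on U_domain (O_star_eqn a b lam i)"
proof -
  note [smooth_intros] = smooth_on_linear linear_complex_coords open_U_domain smooth_on_zeta smooth_on_xi
  have real: "complex_of_real (w3_plus lam s) = W3 s + of_real lam" "complex_of_real (w3_minus lam s) = W3 s - of_real lam" for s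
    using cnj_coords(5)[of s] by (simp_all add: w3_plus_def w3_minus_def)
  have casimir1: "smooth_on U_domain casimir1"
    unfolding casimir1_def[abs_def] power2_eq_square by (intro smooth_intros)
  have casimir2_eq: "casimir2 = (\<lambda>s. Re (X1 s * cnj (X1 s) + Y2 s * cnj (Y2 s) + 2 * (Z1 s * cnj (Z1 s))))"
    unfolding casimir2_def by (simp add: fun_eq_iff complex_mult_cnj cmod_power2)
  have casimir2: "smooth_on U_domain casimir2"
    unfolding casimir2_eq by (intro smooth_intros)
  have C: "smooth_on U_domain (areas_ratio lam)"
    unfolding areas_ratio_def[abs_def] real by (intro smooth_intros)
  have T: "smooth_on U_domain (areas_speed lam)"
    unfolding areas_speed_def[abs_def] real by (intro smooth_intros C)
  show ?thesis
    using assms unfolding less_5 O_star_eqn_def[abs_def]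
    by (elim disjE) (simp_all, (intro smooth_intros casimir1 casimir2 C T)+)
qed

lemma O_star_submanifold:
  assumes "a > b" "b > 0"
  shows "submanifold 4 (O_star a b lam)"
  unfolding submanifold_def
proof (intro conjI ballI)
  have dim: "DIM(state) = 9" by simp
  then show "4 \<le> DIM(state)" by simp
  have D: "DIM(state) - 4 = 5" by simp
  fix p assume p: "p \<in> O_star a b lam"
  have fd: "frechet_derivative (O_star_eqn a b lam i) (at x) = d_O_star_eqn lam i x" if "x \<in> U_domain" "i < 5" for x i
    using frechet_derivative_at[OF O_star_eqn_has_derivative[OF that]] by simp
  show "\<exists>U (g :: nat \<Rightarrow> state \<Rightarrow> real). open U \<and> p \<in> U \<and> (\<forall>i<DIM(state) - 4. smooth_on U (g i)) \<and>
          O_star a b lam \<inter> U = {x \<in> U. \<forall>i<DIM(state) - 4. g i x = 0} \<and>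
          (\<forall>x\<in>O_star a b lam \<inter> U. \<forall>c :: nat \<Rightarrow> real. (\<forall>v. (\<Sum>i<DIM(state) - 4. c i * frechet_derivative (g i) (at x) v) = 0)
             \<longrightarrow> (\<forall>i<DIM(state) - 4. c i = 0))"
    unfolding D
  proof (intro exI[of _ U_domain] exI[of _ "O_star_eqn a b lam"] conjI ballI allI impI)
    show "p \<in> U_domain" using p by (simp add: O_star_iff)
    show "O_star a b lam \<inter> U_domain = {x \<in> U_domain. \<forall>i<5. O_star_eqn a b lam i x = 0}"
      by (auto simp: O_star_iff_equations)
    fix x c i
    assume x: "x \<in> O_star a b lam \<inter> U_domain"
      and comb: "\<forall>v. (\<Sum>i<5. c i * frechet_derivative (O_star_eqn a b lam i) (at x) v) = 0" and i: "i < (5::nat)"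
    have "(\<Sum>i<5. c i * d_O_star_eqn lam i x v) = 0" for v
      using comb[rule_format, of v] fd x by simp
    then show "c i = 0" using d_O_star_eqn_independent[of x a b lam c] x i assms by auto
  qed (simp_all add: open_U_domain smooth_on_O_star_eqn)
qed

section \<open>The Hamiltonian vector field of the first equation\<close>

text \<open>The energy is \<open>H = \<tau> + w\<^sub>3\<^sup>2/2 - Re y\<^sub>2\<close>. On the manifold \<open>c = Re areas_ratio\<close> is a constant of
  motion, and so is \<open>shifted_energy = H + c - \<lambda>\<^sup>2/2\<close>; \<open>energy_rest\<close> is twice what remains of it
  after subtracting \<open>\<tau>\<close>.\<close>

definition energy_rest :: "real \<Rightarrow> state \<Rightarrow> real" where
  "energy_rest lam s = 2 * (Re (areas_ratio lam s) - Re (Y2 s)) + w3_plus lam s * w3_minus lam s"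

text \<open>The bracket of \<open>U1\<close> and \<open>U2\<close> is \<open>degeneracy\<close> up to the factor \<open>- 2 \<i> c\<close>
  (lemma \<open>poisson_U1_U2\<close>).\<close>

definition degeneracy :: "real \<Rightarrow> state \<Rightarrow> real" where
  "degeneracy lam s = (energy_rest lam s)\<^sup>2 / 4 + tau s * ((cmod (zeta s + of_real (w3_minus lam s)))\<^sup>2 + Re (areas_ratio lam s))"
definition shifted_energy :: "real \<Rightarrow> state \<Rightarrow> real" where "shifted_energy lam s = tau s + energy_rest lam s / 2"
text \<open>Up to the factor \<open>- 1/(2 \<tau>)\<close>, the derivative of \<open>c\<close> and of \<open>shifted_energy\<close> along the field
  defined next.\<close>

definition kernel_drift :: "real \<Rightarrow> state \<Rightarrow> real" where
  "kernel_drift lam s = w3_plus lam s * energy_rest lam s + 4 * tau s * (w3_minus lam s + Re (zeta s))"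

text \<open>These components describe the Hamiltonian vector field of \<open>U1\<close> on the manifold, divided by
  \<open>\<i> c\<close> and multiplied by \<open>\<kappa>\<close> (lemma \<open>ham_direction_U1\<close>).\<close>

definition ham_direction :: "real \<Rightarrow> state \<Rightarrow> real \<Rightarrow> state \<Rightarrow> bool" where
  "ham_direction lam s \<kappa> v \<longleftrightarrow>
     dlog_w1 s v = of_real (\<kappa> * w3_plus lam s / (2 * tau s)) \<and> d_w3 v = - 2 * \<kappa> \<and>
     d_zeta s v = of_real (- \<kappa> * energy_rest lam s / (2 * tau s)) \<and> d_xi s v = of_real (- \<kappa> * w3_minus lam s) \<and>
     Y2 v = of_real \<kappa> * (zeta s - cnj (zeta s) - of_real (w3_minus lam s))"

text \<open>The field respects the Casimir functions and \<open>U1\<close>, as a Hamiltonian field of \<open>U1\<close> must; its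
  effect on the remaining equation is proportional to the degeneracy of the bracket.\<close>

lemma ham_direction_derivatives:
  assumes s: "s \<in> O_star a b lam" and v: "ham_direction lam s \<kappa> v"
  shows "d_areas_ratio lam s v = of_real (- \<kappa> * kernel_drift lam s / (2 * tau s))" "d_casimir1 s v = 0" "d_casimir2 s v = 0"
    "Re (d_areas_speed lam s v) = - 2 * \<kappa> * degeneracy lam s / tau s"
proof -
  define u x e t m n c Q where d: "u = zeta s" "x = xi s" "e = Y2 s" "t = tau s" "m = w3_plus lam s" "n = w3_minus lam s"
    "c = Re (areas_ratio lam s)" "Q = energy_rest lam s"
  note r = O_star_relations[OF s, folded d]
  have Q: "Q = 2 * (c - Re e) + m * n" by (simp add: d energy_rest_def)
  have v': "dlog_w1 s v = of_real (\<kappa> * m / (2 * t))" "d_w3 v = - 2 * \<kappa>"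
     "d_zeta s v = of_real (- \<kappa> * Q / (2 * t))" "d_xi s v = of_real (- \<kappa> * n)"
     "Y2 v = of_real \<kappa> * (u - cnj u - of_real n)"
    using v by (simp_all add: ham_direction_def d)
  have x: "x = of_real c - e - u * of_real m" using r(4) by (simp add: algebra_simps)
  have t: "t \<noteq> 0" using r(2) by simp
  have E: "kernel_drift lam s = m * Q + 4 * t * (n + Re u)" by (simp add: d kernel_drift_def)
  have f: "degeneracy lam s = Q\<^sup>2 / 4 + t * ((cmod (u + of_real n))\<^sup>2 + c)" by (simp add: d degeneracy_def)
  show d_areas_ratio: "d_areas_ratio lam s v = of_real (- \<kappa> * kernel_drift lam s / (2 * tau s))"
    unfolding d_areas_ratio_def v' E d(4)[symmetric] using t
    by (simp add: d(1)[symmetric] d(5)[symmetric] complex_eq_iff field_simps)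
  have T: "x * cnj u - cnj e * u + of_real c * (u + of_real n) = 0" by (rule r(5))
  show "d_casimir1 s v = 0"
  proof -
    have "of_real (2 * t * Re (dlog_w1 s v)) * u\<^sup>2 + of_real (2 * t) * u * d_zeta s v
      + d_xi s v * e + x * Y2 v + (dlog_w1 s v - cnj (dlog_w1 s v)) * (of_real t * u\<^sup>2 + x * e)
      = of_real \<kappa> * (of_real m * u\<^sup>2 - u * of_real Q - of_real n * e + x * (u - cnj u - of_real n))"
      unfolding v' using t by (simp add: algebra_simps)
    also have "of_real m * u\<^sup>2 - u * of_real Q - of_real n * e + x * (u - cnj u - of_real n)
      = - (x * cnj u - cnj e * u + of_real c * (u + of_real n))"
    proof -
      have "2 * complex_of_real (Re e) = e + cnj e" by (simp add: complex_eq_iff)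
      then have Qc: "complex_of_real Q = 2 * of_real c - e - cnj e + of_real (m * n)"
        unfolding Q by simp
      show ?thesis unfolding x Qc by (simp add: algebra_simps power2_eq_square)
    qed
    finally show ?thesis unfolding d_casimir1_def d[symmetric] T by simp
  qed
  have T': "2 * c * Re u - 2 * (Re e * Re u + Im e * Im u) - m * (cmod u)\<^sup>2 + c * n = 0"
  proof -
    have "Re (x * cnj u - cnj e * u + of_real c * (u + of_real n)) = 0" unfolding T by simp
    then show ?thesis
      unfolding x cmod_power2 by (simp add: algebra_simps power2_eq_square)
  qed
  show "d_casimir2 s v = 0"
  proof -
    have "d_casimir2 s v = \<kappa> * (- 2 * n * Re x - 2 * n * Re e + 4 * Im u * Im e - 2 * Re u * Q + 2 * m * (cmod u)\<^sup>2)"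
      unfolding d_casimir2_def d[symmetric] v' using t by (simp add: field_simps)
    also have "\<dots> = \<kappa> * (- 2 * (2 * c * Re u - 2 * (Re e * Re u + Im e * Im u) - m * (cmod u)\<^sup>2 + c * n))"
      unfolding x Q by (simp add: algebra_simps)
    also have "\<dots> = 0" unfolding T' by simp
    finally show ?thesis .
  qed
  show "Re (d_areas_speed lam s v) = - 2 * \<kappa> * degeneracy lam s / tau s"
    unfolding d_areas_speed_def d_areas_ratio r(3) d(1-6)[symmetric] v' E f cmod_power2 x using t
    by (simp add: Q field_simps power2_eq_square)
qed

text \<open>Where the bracket vanishes the Hamiltonian field of \<open>U1\<close> is tangent to the manifold.
  It provides the tangent vectors that the null set argument differentiates along.\<close>

lemma ham_direction_tangent:
  assumes "s \<in> O_star a b lam" "degeneracy lam s = 0" "ham_direction lam s \<kappa> v" "i < 5"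
  shows "d_O_star_eqn lam i s v = 0"
  using assms(4) ham_direction_derivatives[OF assms(1,3)] assms(2)
  by (auto simp: less_5 d_O_star_eqn_def)

lemma ham_direction_exists: "s \<in> U_domain \<Longrightarrow> \<exists>v. ham_direction lam s \<kappa> v"
  unfolding ham_direction_def using tangent_vector_exists by blast

section \<open>The Poisson bracket\<close>

lemma linear_state_expansion:
  fixes g :: "state \<Rightarrow> complex"
  assumes "linear g"
  shows "g (\<omega>, \<alpha>, \<beta>) = (\<Sum>j\<in>UNIV. of_real (\<omega> $ j) * g (axis j 1, 0, 0))
     + (\<Sum>j\<in>UNIV. of_real (\<alpha> $ j) * g (0, axis j 1, 0)) + (\<Sum>j\<in>UNIV. of_real (\<beta> $ j) * g (0, 0, axis j 1))"
proof -
  have "(\<omega>, \<alpha>, \<beta>) = (\<Sum>j\<in>UNIV. (\<omega> $ j) *\<^sub>R (axis j 1, 0, 0)) + (\<Sum>j\<in>UNIV. (\<alpha> $ j) *\<^sub>R (0, axis j 1, 0))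
     + (\<Sum>j\<in>UNIV. (\<beta> $ j) *\<^sub>R (0, 0, axis j 1))" (is "_ = ?r")
    by (simp add: sum_3 vec_eq_iff axis_def forall_3)
  then have "g (\<omega>, \<alpha>, \<beta>) = g ?r" by simp
  also have "\<dots> = (\<Sum>j\<in>UNIV. (\<omega> $ j) *\<^sub>R g (axis j 1, 0, 0))
     + (\<Sum>j\<in>UNIV. (\<alpha> $ j) *\<^sub>R g (0, axis j 1, 0)) + (\<Sum>j\<in>UNIV. (\<beta> $ j) *\<^sub>R g (0, 0, axis j 1))"
    by (simp only: linear_add[OF assms] linear_sum[OF assms] linear_scale[OF assms])
  finally show ?thesis by (simp add: scaleR_conv_of_real)
qed

text \<open>The Hamiltonian vector field of a function with gradients \<open>p, q, r\<close> with respect to \<open>M, \<alpha>, \<beta>\<close>.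
  Halving two components passes from \<open>M\<close> to \<open>\<omega>\<close>.\<close>

definition ham_vector :: "real \<Rightarrow> state \<Rightarrow> real^3 \<Rightarrow> real^3 \<Rightarrow> real^3 \<Rightarrow> state" where
  "ham_vector lam s p q r = (let \<alpha> = fst (snd s); \<beta> = snd (snd s);
     d = cross3 (momentum lam s) p + cross3 \<alpha> q + cross3 \<beta> r
     in (vector [d $ 1 / 2, d $ 2 / 2, d $ 3], cross3 \<alpha> p, cross3 \<beta> p))"

text \<open>\<open>U1\<close> is purely imaginary, so its gradient is a constant \<open>k\<close> times a real one, and the bracket
  is an honest derivative along a real vector.\<close>

lemma poisson_ham_vector:
  assumes "linear (frechet_derivative g (at s))"
    and "\<And>i. dM f s i = k * of_real (p $ i)" "\<And>i. dalpha f s i = k * of_real (q $ i)"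
    and "\<And>i. dbeta f s i = k * of_real (r $ i)"
  shows "poisson lam f g s = k * frechet_derivative g (at s) (ham_vector lam s p q r)"
proof -
  let ?g = "frechet_derivative g (at s)"
  have half: "?g (axis i (1 / 2), 0, 0) = ?g (axis i 1, 0, 0) / 2" for i
  proof -
    have "((axis i (1 / 2), 0, 0) :: state) = (1 / 2) *\<^sub>R (axis i 1, 0, 0)"
      by (simp add: vec_eq_iff axis_def)
    then have "?g (axis i (1 / 2), 0, 0) = (1 / 2) *\<^sub>R ?g (axis i 1, 0, 0)"
      by (simp only: linear_scale[OF assms(1)])
    then show ?thesis by (simp add: scaleR_conv_of_real)
  qed
  note expansion = linear_state_expansion[OF assms(1), of "fst (ham_vector lam s p q r)"
    "fst (snd (ham_vector lam s p q r))" "snd (snd (ham_vector lam s p q r))", unfolded prod.collapse]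
  show ?thesis
    unfolding poisson_def assms(2-4) dM_def[of g] dalpha_def[of g] dbeta_def[of g]
    unfolding expansion
    by (simp add: ham_vector_def Let_def sum_3 levi_civita_def cross3_def axis_def half[unfolded axis_def])
       (simp add: field_simps)
qed

text \<open>The quotient rule in the original coordinates, convenient for evaluating on basis vectors.\<close>

lemma d_areas_ratio_numerator:
  assumes "s \<in> U_domain"
  shows "d_areas_ratio lam s v = (Y2 s * W1 v + Y2 v * W1 s + X1 v * cnj (W1 s) + X1 s * cnj (W1 v)
     + Z1 v * of_real (w3_plus lam s) + Z1 s * of_real (d_w3 v) - areas_ratio lam s * W1 v) / W1 s"
proof -
  have "W1 s \<noteq> 0" using assms by (simp add: U_domain_iff)
  then show ?thesis
    unfolding d_areas_ratio_def areas_ratio_def d_zeta_def d_xi_def dlog_w1_def zeta_def xi_def cnj_coords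
    by (simp add: field_simps)
qed

text \<open>The complex coordinates of cross products, with the planar components of the gradients
  joined into complex numbers.\<close>

lemma ham_vector_coords:
  fixes p q r :: "real^3"
  defines "pp \<equiv> Complex (p $ 1) (p $ 2)" and "qq \<equiv> Complex (q $ 1) (q $ 2)" and "rr \<equiv> Complex (r $ 1) (r $ 2)"
  shows "X1 (ham_vector lam s p q r) = \<i> * (Z1 s * pp - of_real (p $ 3) * X1 s)"
    "Y2 (ham_vector lam s p q r) = \<i> * (of_real (p $ 3) * Y2 s - Z1 s * cnj pp)"
    "2 * Z1 (ham_vector lam s p q r) = \<i> * (X1 s * cnj pp - Y2 s * pp)"
    "4 * W1 (ham_vector lam s p q r) = \<i> * (2 * of_real (w3_plus lam s) * pp - 4 * of_real (p $ 3) * W1 s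
       + Z1 s * (qq - \<i> * rr) + cnj (Z1 s) * (qq + \<i> * rr)
       - X1 s * (of_real (q $ 3) - \<i> * of_real (r $ 3)) - cnj (Y2 s) * (of_real (q $ 3) + \<i> * of_real (r $ 3)))"
    "2 * d_w3 (ham_vector lam s p q r) = Im (4 * cnj (W1 s) * pp + cnj (X1 s) * (qq + \<i> * rr) + Y2 s * (qq - \<i> * rr))"
proof -
  obtain \<omega> \<alpha> \<beta> where s: "s = (\<omega>, \<alpha>, \<beta>)" by (cases s)
  note defs = s pp_def qq_def rr_def ham_vector_def Let_def cross3_def momentum_def d_w3_def w3_plus_def complex_coords
  show "X1 (ham_vector lam s p q r) = \<i> * (Z1 s * pp - of_real (p $ 3) * X1 s)"
    unfolding defs complex_eq_iff by (simp add: algebra_simps)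
  show "Y2 (ham_vector lam s p q r) = \<i> * (of_real (p $ 3) * Y2 s - Z1 s * cnj pp)"
    unfolding defs complex_eq_iff by (simp add: algebra_simps)
  show "2 * Z1 (ham_vector lam s p q r) = \<i> * (X1 s * cnj pp - Y2 s * pp)"
    unfolding defs complex_eq_iff by (simp add: algebra_simps)
  show "4 * W1 (ham_vector lam s p q r) = \<i> * (2 * of_real (w3_plus lam s) * pp - 4 * of_real (p $ 3) * W1 s
       + Z1 s * (qq - \<i> * rr) + cnj (Z1 s) * (qq + \<i> * rr)
       - X1 s * (of_real (q $ 3) - \<i> * of_real (r $ 3)) - cnj (Y2 s) * (of_real (q $ 3) + \<i> * of_real (r $ 3)))"
    unfolding defs complex_eq_iff by (simp add: field_simps)
  show "2 * d_w3 (ham_vector lam s p q r) = Im (4 * cnj (W1 s) * pp + cnj (X1 s) * (qq + \<i> * rr) + Y2 s * (qq - \<i> * rr))"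
    unfolding defs complex_eq_iff by (simp add: algebra_simps)
qed

definition grad_M :: "real \<Rightarrow> state \<Rightarrow> real^3" where
  "grad_M lam s = (\<chi> i. Im (d_areas_ratio lam s (axis i (if i = 3 then 1 else 1/2), 0, 0)))"
definition grad_alpha :: "real \<Rightarrow> state \<Rightarrow> real^3" where
  "grad_alpha lam s = (\<chi> i. Im (d_areas_ratio lam s (0, axis i 1, 0)))"
definition grad_beta :: "real \<Rightarrow> state \<Rightarrow> real^3" where
  "grad_beta lam s = (\<chi> i. Im (d_areas_ratio lam s (0, 0, axis i 1)))"

lemma basis_coords:
  "X1 (v, 0, 0) = 0" "Y2 (v, 0, 0) = 0" "Z1 (v, 0, 0) = 0" "W1 (v, 0, 0) = Complex (v $ 1) (v $ 2)" "d_w3 (v, 0, 0) = v $ 3"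
  "X1 (0, v, 0) = Complex (v $ 1) (v $ 2)" "Y2 (0, v, 0) = Complex (v $ 1) (- v $ 2)" "Z1 (0, v, 0) = of_real (v $ 3)"
  "W1 (0, v, 0) = 0" "d_w3 (0, v, 0) = 0"
  "X1 (0, 0, v) = Complex (- v $ 2) (v $ 1)" "Y2 (0, 0, v) = Complex (v $ 2) (v $ 1)" "Z1 (0, 0, v) = \<i> * of_real (v $ 3)"
  "W1 (0, 0, v) = 0" "d_w3 (0, 0, v) = 0"
  by (simp_all add: complex_coords d_w3_def complex_eq_iff)

text \<open>Only these combinations of the gradients of \<open>Im areas_ratio\<close> enter the coordinates of the
  Hamiltonian vector.\<close>

lemma gradients:
  assumes s: "s \<in> U_domain" and c: "areas_ratio lam s = of_real c"
  defines "w \<equiv> W1 s"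
  shows "2 * Complex (grad_M lam s $ 1) (grad_M lam s $ 2)
      = - \<i> * (X1 s / w - (cnj (Y2 s) - of_real c) / cnj w)"
    "2 * complex_of_real (grad_M lam s $ 3) = - \<i> * (Z1 s / w - cnj (Z1 s) / cnj w)"
    "Complex (grad_alpha lam s $ 1) (grad_alpha lam s $ 2) + \<i> * Complex (grad_beta lam s $ 1) (grad_beta lam s $ 2)
      = 2 * \<i> * w / cnj w"
    "Complex (grad_alpha lam s $ 1) (grad_alpha lam s $ 2) - \<i> * Complex (grad_beta lam s $ 1) (grad_beta lam s $ 2)
      = - 2 * \<i>"
    "complex_of_real (grad_alpha lam s $ 3) + \<i> * of_real (grad_beta lam s $ 3) = \<i> * of_real (w3_plus lam s) / cnj w"
    "complex_of_real (grad_alpha lam s $ 3) - \<i> * of_real (grad_beta lam s $ 3) = - \<i> * of_real (w3_plus lam s) / w"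
proof -
  have w: "w \<noteq> 0" "cnj w \<noteq> 0" using s by (simp_all add: U_domain_iff w_def)
  have Im: "complex_of_real (Im z) = - \<i> / 2 * (z - cnj z)" for z
    by (simp add: complex_eq_iff)
  have M: "complex_of_real (grad_M lam s $ 1) = - \<i> / 2 * ((Y2 s + X1 s - of_real c) / (2 * w) - cnj ((Y2 s + X1 s - of_real c) / (2 * w)))"
    "complex_of_real (grad_M lam s $ 2) = - \<i> / 2 * (\<i> * (Y2 s - X1 s - of_real c) / (2 * w) - cnj (\<i> * (Y2 s - X1 s - of_real c) / (2 * w)))"
    "complex_of_real (grad_M lam s $ 3) = - \<i> / 2 * (Z1 s / w - cnj (Z1 s / w))"
    unfolding grad_M_def Im[symmetric] of_real_eq_iff using w
    by (simp_all add: d_areas_ratio_numerator[OF s] basis_coords axis_def c w_def[symmetric] Complex_eq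
        add_divide_distrib diff_divide_distrib algebra_simps)
  have A: "complex_of_real (grad_alpha lam s $ 1) = - \<i> / 2 * ((w + cnj w) / w - cnj ((w + cnj w) / w))"
    "complex_of_real (grad_alpha lam s $ 2) = - \<i> / 2 * (\<i> * (cnj w - w) / w - cnj (\<i> * (cnj w - w) / w))"
    "complex_of_real (grad_alpha lam s $ 3) = - \<i> / 2 * (of_real (w3_plus lam s) / w - cnj (of_real (w3_plus lam s) / w))"
    unfolding grad_alpha_def Im[symmetric] of_real_eq_iff using w
    by (simp_all add: d_areas_ratio_numerator[OF s] basis_coords axis_def c w_def[symmetric] Complex_eq
        add_divide_distrib diff_divide_distrib algebra_simps)
  have B: "complex_of_real (grad_beta lam s $ 1) = - \<i> / 2 * (\<i> * (w + cnj w) / w - cnj (\<i> * (w + cnj w) / w))"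
    "complex_of_real (grad_beta lam s $ 2) = - \<i> / 2 * ((w - cnj w) / w - cnj ((w - cnj w) / w))"
    "complex_of_real (grad_beta lam s $ 3) = - \<i> / 2 * (\<i> * of_real (w3_plus lam s) / w - cnj (\<i> * of_real (w3_plus lam s) / w))"
    unfolding grad_beta_def Im[symmetric] of_real_eq_iff using w
    by (simp_all add: d_areas_ratio_numerator[OF s] basis_coords axis_def c w_def[symmetric] Complex_eq
        add_divide_distrib diff_divide_distrib algebra_simps)
  show "2 * Complex (grad_M lam s $ 1) (grad_M lam s $ 2)
      = - \<i> * (X1 s / w - (cnj (Y2 s) - of_real c) / cnj w)"
    unfolding Complex_eq M using w by (simp add: field_simps)
  show "2 * complex_of_real (grad_M lam s $ 3) = - \<i> * (Z1 s / w - cnj (Z1 s) / cnj w)"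
    unfolding M using w by (simp add: field_simps)
  show "Complex (grad_alpha lam s $ 1) (grad_alpha lam s $ 2) + \<i> * Complex (grad_beta lam s $ 1) (grad_beta lam s $ 2)
      = 2 * \<i> * w / cnj w"
    unfolding Complex_eq A B using w by (simp add: field_simps)
  show "Complex (grad_alpha lam s $ 1) (grad_alpha lam s $ 2) - \<i> * Complex (grad_beta lam s $ 1) (grad_beta lam s $ 2)
      = - 2 * \<i>"
    unfolding Complex_eq A B using w by (simp add: field_simps)
  show "complex_of_real (grad_alpha lam s $ 3) + \<i> * of_real (grad_beta lam s $ 3) = \<i> * of_real (w3_plus lam s) / cnj w"
    unfolding A B using w by (simp add: field_simps)
  show "complex_of_real (grad_alpha lam s $ 3) - \<i> * of_real (grad_beta lam s $ 3) = - \<i> * of_real (w3_plus lam s) / w"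
    unfolding A B using w by (simp add: field_simps)
qed

lemma ham_direction_U1:
  assumes s: "s \<in> O_star a b lam"
  shows "ham_direction lam s (Re (areas_ratio lam s) / 2) (ham_vector lam s (grad_M lam s) (grad_alpha lam s) (grad_beta lam s))"
proof -
  let ?v = "ham_vector lam s (grad_M lam s) (grad_alpha lam s) (grad_beta lam s)"
  define w z x y m c where d: "w = W1 s" "z = Z1 s" "x = X1 s" "y = Y2 s"
    "m = complex_of_real (w3_plus lam s)" "c = complex_of_real (Re (areas_ratio lam s))"
  note r = O_star_relations[OF s]
  have w: "w \<noteq> 0" "cnj w \<noteq> 0" using r(1) by (simp_all add: U_domain_iff d)
  note gr = gradients[OF r(1,3), folded d]
  define pp p3 where p: "pp = Complex (grad_M lam s $ 1) (grad_M lam s $ 2)" "p3 = complex_of_real (grad_M lam s $ 3)"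
  have pp: "pp = - \<i> / 2 * (x / w - (cnj y - c) / cnj w)" and p3: "p3 = - \<i> / 2 * (z / w - cnj z / cnj w)"
    using gr(1,2) by (simp_all add: p field_simps)
  have cnj': "cnj m = m" "cnj c = c" by (simp_all add: d)
  have cpp: "cnj pp = \<i> / 2 * (cnj x / cnj w - (y - c) / w)"
    unfolding pp by (simp add: cnj')
  note co = ham_vector_coords[of lam s "grad_M lam s" "grad_alpha lam s" "grad_beta lam s", folded p d]
  have lam: "W3 s + of_real lam = m" "W3 s - of_real lam = of_real (w3_minus lam s)"
    using cnj_coords(5)[of s] by (simp_all add: d w3_plus_def w3_minus_def)
  define n where "n = complex_of_real (w3_minus lam s)"
  have P: "residual1 lam c s = 0" "residual2 lam c s = 0"
    using O_star_iff_residuals[OF r(1), of c] s r(3) by (auto simp: d O_star_iff)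
  have C: "y * w + x * cnj w + z * m = c * w"
    using P(1) by (simp add: residual1_def lam d[symmetric])
  have T: "x * cnj z - z * cnj y + c * (w * n + z) = 0"
    using P(2) by (simp add: residual2_def lam d[symmetric] n_def)
  have "residual3 lam c s = 0" by (rule residual3_eq_0[OF r(1) cnj'(2) P])
  moreover have "(W3 s)\<^sup>2 - of_real (lam\<^sup>2) = (W3 s + of_real lam) * (W3 s - of_real lam)"
    by (simp add: power2_eq_square algebra_simps)
  ultimately have xy: "x * cnj x - y * cnj y + c\<^sup>2 = c * of_real (energy_rest lam s)"
  proof -
    assume a: "residual3 lam c s = 0" and b: "(W3 s)\<^sup>2 - of_real (lam\<^sup>2) = (W3 s + of_real lam) * (W3 s - of_real lam)"
    have "2 * complex_of_real (Re y) = y + cnj y" by (simp add: complex_eq_iff)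
    then have Q: "complex_of_real (energy_rest lam s) = 2 * c - y - cnj y + m * n"
      by (simp add: energy_rest_def d(4-6)[symmetric] n_def)
    have "(cnj y - c) * (y - c) - x * cnj x + c * (m * n) = 0"
      using a unfolding residual3_def b lam d[symmetric] n_def by simp
    then show ?thesis unfolding Q by (simp add: algebra_simps power2_eq_square)
  qed
  have t: "complex_of_real (tau s) = w * cnj w" by (simp add: tau_eq d)
  have div2: "p = q / 2" if "2 * p = q" for p q :: complex using that by auto
  have dlog_w1: "dlog_w1 s ?v = of_real (Re (areas_ratio lam s) / 2 * w3_plus lam s / (2 * tau s))"
  proof -
    have "4 * W1 ?v = m * c / cnj w"
      unfolding co(4) gr(3-6) pp p3 using w by (simp add: field_simps)
    then have "4 * dlog_w1 s ?v = m * c / (w * cnj w)"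
      unfolding dlog_w1_def d(1)[symmetric] using w by (simp add: field_simps)
    moreover have "z = q / 4" if "4 * z = q" for z q :: complex using that by auto
    ultimately have "dlog_w1 s ?v = m * c / (w * cnj w) / 4" by blast
    then show ?thesis by (simp add: t d(5,6) mult_ac)
  qed
  have d_xi: "d_xi s ?v = of_real (- (Re (areas_ratio lam s) / 2) * w3_minus lam s)"
  proof -
    have "2 * X1 ?v = (x * cnj z - z * cnj y + c * z) / cnj w"
      unfolding co(1) pp p3 using w by (simp add: field_simps)
    also have "x * cnj z - z * cnj y + c * z = - c * n * w"
      using T by (simp add: algebra_simps add_eq_0_iff2)
    finally have "X1 ?v = - c * n * w / cnj w / 2" by (rule div2)
    moreover have "cnj (dlog_w1 s ?v) = dlog_w1 s ?v" unfolding dlog_w1 by simp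
    ultimately have "d_xi s ?v = - c * n / 2"
      unfolding d_xi_def cnj_coords d(1)[symmetric] using w by simp
    then show ?thesis by (simp add: d(6) n_def)
  qed
  have Y2: "Y2 ?v = of_real (Re (areas_ratio lam s) / 2) * (zeta s - cnj (zeta s) - of_real (w3_minus lam s))"
  proof -
    have T': "z * cnj x - cnj z * y = - c * (cnj w * n + cnj z)"
      using arg_cong[OF T, of cnj] by (simp add: cnj' n_def algebra_simps add_eq_0_iff2)
    have "2 * Y2 ?v = (z * cnj x - cnj z * y) / cnj w + c * z / w"
      unfolding co(2) cpp p3 using w by (simp add: field_simps)
    also have "\<dots> = c * (z / w - cnj z / cnj w - n)"
      unfolding T' using w by (simp add: field_simps)
    finally have "Y2 ?v = c * (z / w - cnj z / cnj w - n) / 2" by (rule div2)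
    then show ?thesis by (simp add: zeta_def d(1,2,6) n_def)
  qed
  have d_zeta: "d_zeta s ?v = of_real (- (Re (areas_ratio lam s) / 2) * energy_rest lam s / (2 * tau s))"
  proof -
    have "4 * cnj w * Z1 ?v = - (x * cnj x - y * cnj y + y * c + x * c * cnj w / w)"
    proof -
      have "4 * cnj w * Z1 ?v = 2 * cnj w * (2 * Z1 ?v)" by simp
      also have "\<dots> = - (x * cnj x - y * cnj y + y * c + x * c * cnj w / w)"
        unfolding co(3) pp cpp using w by (simp add: cnj' field_simps)
      finally show ?thesis .
    qed
    moreover have "4 * (w * cnj w) * d_zeta s ?v = 4 * cnj w * Z1 ?v - z / w * (4 * (w * cnj w) * dlog_w1 s ?v)"
      unfolding d_zeta_def zeta_def d(1,2)[symmetric] using w by (simp add: field_simps)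
    moreover have "4 * (w * cnj w) * dlog_w1 s ?v = m * c"
      unfolding dlog_w1 of_real_divide of_real_mult t d(5,6)[symmetric] using w by simp
    ultimately have "4 * (w * cnj w) * d_zeta s ?v
        = - (x * cnj x - y * cnj y + y * c + x * c * cnj w / w) - z / w * (m * c)" by simp
    also have "\<dots> = - (x * cnj x - y * cnj y + y * c + c * (y * w + x * cnj w + z * m) / w - c * y)"
      using w by (simp add: field_simps)
    also have "\<dots> = - (c * of_real (energy_rest lam s))"
      unfolding C xy[symmetric] using w by (simp add: power2_eq_square)
    finally have "d_zeta s ?v = - c * of_real (energy_rest lam s) / (4 * (w * cnj w))"
      using w by (simp add: field_simps)
    then show ?thesis by (simp add: t d(6))
  qed
  have d_w3: "d_w3 ?v = - 2 * (Re (areas_ratio lam s) / 2)"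
  proof -
    define g where "g = x * cnj w / w"
    have "4 * cnj w * pp = - 2 * \<i> * (g - cnj y + c)"
      unfolding pp g_def using w by (simp add: cnj' field_simps)
    moreover have "cnj x * (2 * \<i> * w / cnj w) = 2 * \<i> * cnj g" by (simp add: g_def)
    ultimately have "2 * d_w3 ?v = Im (- 2 * \<i> * (g - cnj y + c) + 2 * \<i> * cnj g + y * (- 2 * \<i>))"
      unfolding co(5) gr(3,4) by (simp only:)
    also have "\<dots> = - 2 * Re (areas_ratio lam s)" by (simp add: d(6))
    finally show ?thesis by simp
  qed
  show ?thesis
    unfolding ham_direction_def using dlog_w1 d_w3 d_zeta d_xi Y2 by simp
qed

lemma poisson_U1_U2:
  assumes s: "s \<in> O_star a b lam"
  shows "poisson lam (U1 lam) (U2 lam) s = - 2 * \<i> * of_real (Re (areas_ratio lam s) * degeneracy lam s)"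
proof -
  let ?v = "ham_vector lam s (grad_M lam s) (grad_alpha lam s) (grad_beta lam s)"
  note dom = O_star_relations(1)[OF s]
  have T: "areas_speed lam s = 0" using s by (simp add: O_star_iff)
  have U1: "frechet_derivative (U1 lam) (at s) v = 2 * \<i> * of_real (Im (d_areas_ratio lam s v))" for v
    unfolding frechet_derivative_at[OF U1_has_derivative[OF dom], of lam, symmetric] by (simp add: complex_eq_iff)
  have U2: "frechet_derivative (U2 lam) (at s) = (\<lambda>v. of_real (tau s * Re (d_areas_speed lam s v)))"
    using frechet_derivative_at[OF U2_has_derivative[OF dom], of lam] by (simp add: T)
  have "linear (frechet_derivative (U2 lam) (at s))"
    unfolding frechet_derivative_at[OF U2_has_derivative[OF dom], symmetric]
    by (rule has_derivative_linear[OF U2_has_derivative[OF dom]])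
  then have "poisson lam (U1 lam) (U2 lam) s = 2 * \<i> * frechet_derivative (U2 lam) (at s) ?v"
    by (intro poisson_ham_vector) (simp_all add: dM_def dalpha_def dbeta_def U1 grad_M_def grad_alpha_def grad_beta_def)
  also have "frechet_derivative (U2 lam) (at s) ?v = of_real (- Re (areas_ratio lam s) * degeneracy lam s)"
    unfolding U2 ham_direction_derivatives(4)[OF s ham_direction_U1[OF s]]
    using tau_pos[OF dom] by simp
  finally show ?thesis by simp
qed

section \<open>The zero set of the bracket\<close>

text \<open>A function vanishing on \<open>M\<close> pulls back to the chart; a tangent vector that sees it is the
  image of a direction in the parameter domain, so \<open>negligible_level_set\<close> applies there.\<close>

lemma negligible_in_chart:
  fixes V :: "(real^4) set"
  assumes \<psi>: "local_parametrization (O_star a b lam) V \<psi>" and ab: "a > b" "b > 0"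
    and M: "M \<subseteq> O_star a b lam"
    and "\<And>s. s \<in> M \<Longrightarrow> h s = 0" and h: "\<And>s. s \<in> M \<Longrightarrow> (h has_derivative h' s) (at s)"
    and tangent: "\<And>s. s \<in> M \<Longrightarrow> \<exists>v. (\<forall>i<5. d_O_star_eqn lam i s v = 0) \<and> h' s v \<noteq> (0::real)"
  shows "negligible {x \<in> V. \<psi> x \<in> M}"
proof (rule negligible_level_set)
  fix x assume x: "x \<in> {x \<in> V. \<psi> x \<in> M}"
  then have "x \<in> V" and xM: "\<psi> x \<in> M" by auto
  define D where "D = frechet_derivative \<psi> (at x)"
  have openV: "open V" and sm: "smooth_on V \<psi>" and inj: "inj D"
    and "openin (top_of_set (O_star a b lam)) (\<psi> ` V)"
    using \<psi> \<open>x \<in> V\<close> by (simp_all add: local_parametrization_def D_def)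
  then have sub: "\<psi> ` V \<subseteq> O_star a b lam" by (intro openin_imp_subset)
  have D: "(\<psi> has_derivative D) (at x)"
    unfolding D_def by (rule smooth_on_has_derivative[OF sm \<open>x \<in> V\<close>])
  show "(h \<circ> \<psi>) x = 0" using assms(5)[OF xM] by simp
  show "(h \<circ> \<psi> has_derivative h' (\<psi> x) \<circ> D) (at x)"
    by (rule diff_chain_at[OF D h[OF xM]])
  have S: "\<psi> x \<in> O_star a b lam" using xM M by auto
  have dom: "\<psi> x \<in> U_domain" using S by (simp add: O_star_iff)
  have lin: "linear (d_O_star_eqn lam i (\<psi> x))" if "i < 5" for i
    using has_derivative_linear[OF O_star_eqn_has_derivative[OF dom that]] .
  have zero: "d_O_star_eqn lam i (\<psi> x) (D y) = 0" if "i < 5" for i y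
  proof -
    have "(O_star_eqn a b lam i \<circ> \<psi> has_derivative d_O_star_eqn lam i (\<psi> x) \<circ> D) (at x)"
      by (rule diff_chain_at[OF D O_star_eqn_has_derivative[OF dom that]])
    moreover have "(O_star_eqn a b lam i \<circ> \<psi> has_derivative (\<lambda>_. 0)) (at x)"
      using sub that
      by (intro has_derivative_transform_within_open[OF has_derivative_const[of 0] openV \<open>x \<in> V\<close>])
         (auto simp: O_star_iff_equations)
    ultimately have "d_O_star_eqn lam i (\<psi> x) \<circ> D = (\<lambda>_. 0)" by (rule has_derivative_unique)
    then show ?thesis by (simp add: fun_eq_iff)
  qed
  obtain v where v: "\<forall>i<5. d_O_star_eqn lam i (\<psi> x) v = 0" "h' (\<psi> x) v \<noteq> 0"
    using tangent[OF xM] by blast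
  have "v \<in> range D"
  proof (rule tangent_vectors_in_range[where N = 5 and L = "\<lambda>i. d_O_star_eqn lam i (\<psi> x)"])
    show "\<forall>i<5. c i = 0" if "\<And>v. (\<Sum>i<5. c i * d_O_star_eqn lam i (\<psi> x) v) = 0" for c
      by (rule d_O_star_eqn_independent[OF S ab that])
  qed (use lin has_derivative_linear[OF D] inj zero v(1) in auto)
  then show "\<exists>y. (h' (\<psi> x) \<circ> D) y \<noteq> 0" using v(2) by auto
qed

text \<open>\<open>O_star_identity\<close> turns the degeneracy into a function of the two constants of motion \<open>c\<close> and
  \<open>shifted_energy\<close>.\<close>

lemma degeneracy_identity:
  assumes "s \<in> O_star a b lam"
  defines "c \<equiv> Re (areas_ratio lam s)"
  shows "c\<^sup>2 * degeneracy lam s = c ^ 3 * shifted_energy lam s - c ^ 4 / 4 + 4 * a\<^sup>2 * b\<^sup>2"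
proof -
  have Q: "2 * (c - Re (Y2 s)) + w3_plus lam s * w3_minus lam s = energy_rest lam s" by (simp add: energy_rest_def c_def)
  have "4 * a\<^sup>2 * b\<^sup>2 = c\<^sup>2 * ((energy_rest lam s - c)\<^sup>2 / 4 + tau s * (cmod (zeta s + of_real (w3_minus lam s)))\<^sup>2)"
    using O_star_identity[OF assms(1)] unfolding c_def[symmetric] Q by simp
  then show ?thesis
    unfolding degeneracy_def shifted_energy_def c_def[symmetric]
    by (simp add: field_simps power2_eq_square power3_eq_cube power4_eq_xxxx)
qed

lemma energy_rest_shifted_energy_has_derivatives:
  assumes "s \<in> U_domain"
  shows "(energy_rest lam has_derivative (\<lambda>v. 2 * (Re (d_areas_ratio lam s v) - Re (Y2 v)) + (w3_plus lam s * d_w3 v + d_w3 v * w3_minus lam s))) (at s)"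
    and "(shifted_energy lam has_derivative (\<lambda>v. 2 * tau s * Re (dlog_w1 s v)
       + (2 * (Re (d_areas_ratio lam s v) - Re (Y2 v)) + (w3_plus lam s * d_w3 v + d_w3 v * w3_minus lam s)) / 2)) (at s)"
proof -
  show Q: "(energy_rest lam has_derivative (\<lambda>v. 2 * (Re (d_areas_ratio lam s v) - Re (Y2 v)) + (w3_plus lam s * d_w3 v + d_w3 v * w3_minus lam s))) (at s)"
    unfolding energy_rest_def[abs_def]
    by (rule has_derivative_eq_rhs, (rule has_derivative_add has_derivative_diff has_derivative_mult has_derivative_Re
      has_derivative_const areas_ratio_has_derivative[OF assms] w3_plus_has_derivative coord_has_derivative)+) simp
  show "(shifted_energy lam has_derivative (\<lambda>v. 2 * tau s * Re (dlog_w1 s v)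
       + (2 * (Re (d_areas_ratio lam s v) - Re (Y2 v)) + (w3_plus lam s * d_w3 v + d_w3 v * w3_minus lam s)) / 2)) (at s)"
    unfolding shifted_energy_def[abs_def]
    by (intro has_derivative_add tau_has_derivative assms bounded_linear.has_derivative[OF bounded_linear_divide Q])
qed

lemma kernel_drift_has_derivative:
  assumes "s \<in> U_domain"
  shows "(kernel_drift lam has_derivative (\<lambda>v. w3_plus lam s * (2 * (Re (d_areas_ratio lam s v) - Re (Y2 v)) + (w3_plus lam s * d_w3 v + d_w3 v * w3_minus lam s))
      + d_w3 v * energy_rest lam s + (4 * tau s * (d_w3 v + Re (d_zeta s v)) + 4 * (2 * tau s * Re (dlog_w1 s v)) * (w3_minus lam s + Re (zeta s))))) (at s)"
  unfolding kernel_drift_def[abs_def]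
  by (rule has_derivative_eq_rhs, (rule has_derivative_add has_derivative_mult has_derivative_Re has_derivative_const
      energy_rest_shifted_energy_has_derivatives(1)[OF assms] w3_plus_has_derivative tau_has_derivative[OF assms] zeta_has_derivative[OF assms])+) simp

text \<open>Otherwise the differential of \<open>Re areas_ratio\<close> would vanish on the tangent space and be a
  combination of the differentials of the equations.\<close>

lemma areas_ratio_has_tangential_derivative:
  assumes s: "s \<in> O_star a b lam" and ab: "a > b" "b > 0" and "w3_plus lam s \<noteq> lam" "Re (zeta s) \<noteq> 0"
  shows "\<exists>v. (\<forall>i<5. d_O_star_eqn lam i s v = 0) \<and> Re (d_areas_ratio lam s v) \<noteq> 0"
proof (rule ccontr)
  assume none: "\<nexists>v. (\<forall>i<5. d_O_star_eqn lam i s v = 0) \<and> Re (d_areas_ratio lam s v) \<noteq> 0"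
  have dom: "s \<in> U_domain" using s by (simp add: O_star_iff)
  have "\<exists>c. \<forall>v. Re (d_areas_ratio lam s v) = (\<Sum>i<5. c i * d_O_star_eqn lam i s v)"
  proof (rule common_kernel_spans)
    show "linear (d_O_star_eqn lam i s)" if "i < 5" for i
      using has_derivative_linear[OF O_star_eqn_has_derivative[OF dom that]] .
    show "linear (\<lambda>v. Re (d_areas_ratio lam s v))"
      using has_derivative_linear[OF has_derivative_Re[OF areas_ratio_has_derivative[OF dom]]] .
  qed (use none in blast)
  then obtain c where c: "\<And>v. Re (d_areas_ratio lam s v) = (\<Sum>i<5. c i * d_O_star_eqn lam i s v)" by blast
  have "w3_plus lam s = lam \<or> Re (zeta s) = 0"
    by (rule lagrange_multipliers(2)[OF s ab, where eps = 1 and q = "Complex (c 0) (- c 1)" and be = "c 2"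
          and ?c3.0 = "c 3" and al = "c 4"]) (simp_all add: c d_O_star_eqn_combination)
  with assms(4,5) show False by simp
qed

text \<open>By \<open>degeneracy_identity\<close> the zero set of the bracket is given by one relation
  \<open>c\<^sup>3 k - c\<^sup>4/4 + 4 a\<^sup>2 b\<^sup>2 = 0\<close> between the constants of motion \<open>c\<close> and \<open>k = shifted_energy\<close>. It is
  cut into five pieces; on each, some function vanishes that has a nonzero derivative in a tangent
  direction. Along the Hamiltonian field of \<open>U1\<close> the left-hand side of the relation has derivative
  proportional to \<open>k * kernel_drift\<close>. If \<open>k \<noteq> 0\<close> and \<open>kernel_drift = 0\<close>, then \<open>kernel_drift\<close> itself
  changes along the field. If \<open>k = 0\<close>, the relation says that \<open>c\<^sup>4 = 16 a\<^sup>2 b\<^sup>2\<close>, and \<open>c\<close> has a nonzero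
  tangential derivative unless \<open>w\<^sub>3 = 0\<close> or \<open>Re \<zeta> = 0\<close>; these two functions change along the field.\<close>

lemma poisson_zero_set_null:
  assumes ab: "a > b" "b > 0"
  shows "null_in4 (O_star a b lam) {s \<in> O_star a b lam. poisson lam (U1 lam) (U2 lam) s = 0}"
  unfolding null_in4_def
proof (intro conjI allI impI)
  fix V :: "(real^4) set" and \<psi>
  assume \<psi>: "local_parametrization (O_star a b lam) V \<psi>"
  let ?O = "O_star a b lam" and ?c = "\<lambda>s. Re (areas_ratio lam s)"
  define Z where "Z = {s \<in> ?O. degeneracy lam s = 0}"
  have dom: "s \<in> U_domain" "tau s > 0" if "s \<in> Z" for s
    using that tau_pos by (auto simp: Z_def O_star_iff)
  have c0: "?c s \<noteq> 0" if "s \<in> Z" for s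
    using Re_areas_ratio_nonzero[OF _ ab] that by (simp add: Z_def)
  have ham: "\<exists>v. (\<forall>i<5. d_O_star_eqn lam i s v = 0) \<and> ham_direction lam s 1 v" if s: "s \<in> Z" for s
  proof -
    obtain v where "ham_direction lam s 1 v" using ham_direction_exists[OF dom(1)[OF s]] by blast
    then show ?thesis using ham_direction_tangent[of s a b lam 1 v] s by (intro exI[of _ v]) (simp add: Z_def)
  qed
  define d_shifted_energy where "d_shifted_energy s v = 2 * tau s * Re (dlog_w1 s v)
       + (2 * (Re (d_areas_ratio lam s v) - Re (Y2 v)) + (w3_plus lam s * d_w3 v + d_w3 v * w3_minus lam s)) / 2" for s v
  have d_shifted_energy: "d_shifted_energy s v = - kernel_drift lam s / (2 * tau s)" if "s \<in> Z" "ham_direction lam s 1 v" for s v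
  proof -
    have "Re (d_areas_ratio lam s v) = - kernel_drift lam s / (2 * tau s)"
      using ham_direction_derivatives(1)[of s a b lam 1 v] that by (simp add: Z_def)
    moreover have "Re (dlog_w1 s v) = w3_plus lam s / (2 * tau s)" "Re (Y2 v) = - w3_minus lam s" "d_w3 v = - 2"
      using that(2) by (simp_all add: ham_direction_def)
    ultimately show ?thesis
      using dom(2)[OF that(1)] by (simp add: d_shifted_energy_def field_simps)
  qed
  note negl = negligible_in_chart[OF \<psi> ab]
  \<comment> \<open>\<open>N1\<close> to \<open>N5\<close> are the five pieces, in the order of the description above\<close>
  have N1: "negligible {x \<in> V. \<psi> x \<in> {s \<in> Z. shifted_energy lam s \<noteq> 0 \<and> kernel_drift lam s \<noteq> 0}}"
  proof (rule negl)
    fix s assume s: "s \<in> {s \<in> Z. shifted_energy lam s \<noteq> 0 \<and> kernel_drift lam s \<noteq> 0}"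
    then have sO: "s \<in> ?O" and sZ: "s \<in> Z" by (auto simp: Z_def)
    show "(\<lambda>s. 4 * (?c s ^ 3 * shifted_energy lam s) - ?c s ^ 4 + 16 * a\<^sup>2 * b\<^sup>2) s = 0"
      using degeneracy_identity[OF sO] sZ by (simp add: Z_def)
    show "((\<lambda>s. 4 * (?c s ^ 3 * shifted_energy lam s) - ?c s ^ 4 + 16 * a\<^sup>2 * b\<^sup>2) has_derivative
        (\<lambda>v. 4 * (3 * ?c s ^ 2 * Re (d_areas_ratio lam s v) * shifted_energy lam s + ?c s ^ 3 * d_shifted_energy s v) - 4 * ?c s ^ 3 * Re (d_areas_ratio lam s v))) (at s)"
      unfolding d_shifted_energy_def
      by (rule has_derivative_eq_rhs, (rule has_derivative_add has_derivative_diff has_derivative_mult has_derivative_power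
           has_derivative_Re has_derivative_const areas_ratio_has_derivative[OF dom(1)[OF sZ]] energy_rest_shifted_energy_has_derivatives(2)[OF dom(1)[OF sZ]])+)
         (simp add: fun_eq_iff algebra_simps)
    obtain v where v: "\<forall>i<5. d_O_star_eqn lam i s v = 0" "ham_direction lam s 1 v" using ham[OF sZ] by blast
    have d_areas_ratio: "Re (d_areas_ratio lam s v) = - kernel_drift lam s / (2 * tau s)"
      using ham_direction_derivatives(1)[OF sO v(2)] by simp
    have "4 * (3 * ?c s ^ 2 * Re (d_areas_ratio lam s v) * shifted_energy lam s + ?c s ^ 3 * d_shifted_energy s v) - 4 * ?c s ^ 3 * Re (d_areas_ratio lam s v)
        = - 6 * ?c s ^ 2 * kernel_drift lam s * shifted_energy lam s / tau s"
      unfolding d_shifted_energy[OF sZ v(2)] d_areas_ratio using dom(2)[OF sZ] by (simp add: field_simps)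
    also have "\<dots> \<noteq> 0" using s c0[OF sZ] dom(2)[OF sZ] by simp
    finally show "\<exists>v. (\<forall>i<5. d_O_star_eqn lam i s v = 0) \<and>
        4 * (3 * ?c s ^ 2 * Re (d_areas_ratio lam s v) * shifted_energy lam s + ?c s ^ 3 * d_shifted_energy s v) - 4 * ?c s ^ 3 * Re (d_areas_ratio lam s v) \<noteq> 0"
      using v(1) by blast
  qed (auto simp: Z_def)
  have N2: "negligible {x \<in> V. \<psi> x \<in> {s \<in> Z. shifted_energy lam s \<noteq> 0 \<and> kernel_drift lam s = 0}}"
  proof (rule negl)
    fix s assume s: "s \<in> {s \<in> Z. shifted_energy lam s \<noteq> 0 \<and> kernel_drift lam s = 0}"
    then have sO: "s \<in> ?O" and sZ: "s \<in> Z" and E: "kernel_drift lam s = 0" by (auto simp: Z_def)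
    show "kernel_drift lam s = 0" by fact
    show "(kernel_drift lam has_derivative (\<lambda>v. w3_plus lam s * (2 * (Re (d_areas_ratio lam s v) - Re (Y2 v)) + (w3_plus lam s * d_w3 v + d_w3 v * w3_minus lam s))
      + d_w3 v * energy_rest lam s + (4 * tau s * (d_w3 v + Re (d_zeta s v)) + 4 * (2 * tau s * Re (dlog_w1 s v)) * (w3_minus lam s + Re (zeta s))))) (at s)"
      by (rule kernel_drift_has_derivative[OF dom(1)[OF sZ]])
    obtain v where v: "\<forall>i<5. d_O_star_eqn lam i s v = 0" "ham_direction lam s 1 v" using ham[OF sZ] by blast
    have d_areas_ratio: "Re (d_areas_ratio lam s v) = 0"
      using ham_direction_derivatives(1)[OF sO v(2)] E by simp
    define m n t X Q where d: "m = w3_plus lam s" "n = w3_minus lam s" "t = tau s" "X = Re (zeta s)" "Q = energy_rest lam s"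
    have t: "t > 0" using dom(2)[OF sZ] by (simp add: d)
    have "w3_plus lam s * (2 * (Re (d_areas_ratio lam s v) - Re (Y2 v)) + (w3_plus lam s * d_w3 v + d_w3 v * w3_minus lam s))
      + d_w3 v * energy_rest lam s + (4 * tau s * (d_w3 v + Re (d_zeta s v)) + 4 * (2 * tau s * Re (dlog_w1 s v)) * (w3_minus lam s + Re (zeta s)))
      = 4 * m * (n + X) - 2 * m\<^sup>2 - 8 * t - 4 * Q"
    proof -
      have "Re (dlog_w1 s v) = m / (2 * t)" "Re (Y2 v) = - n" "d_w3 v = - 2" "Re (d_zeta s v) = - Q / (2 * t)"
        using v(2) by (simp_all add: ham_direction_def d)
      then show ?thesis
        using t unfolding d_areas_ratio d[symmetric] by (simp add: field_simps power2_eq_square)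
    qed
    moreover have "4 * m * (n + X) - 2 * m\<^sup>2 - 8 * t - 4 * Q \<noteq> 0"
    proof
      assume eq: "4 * m * (n + X) - 2 * m\<^sup>2 - 8 * t - 4 * Q = 0"
      have "m * Q + 4 * t * (n + X) = 0" using E by (simp add: kernel_drift_def d)
      \<comment> \<open>eliminating \<open>n + X\<close> from the two equations leaves a multiple of \<open>shifted_energy\<close>\<close>
      then have "(2 * t + Q) * (m\<^sup>2 + 4 * t) = 0" using eq by algebra
      moreover have "m\<^sup>2 + 4 * t \<noteq> 0" using t by (smt (verit) zero_le_power2)
      ultimately show False using s by (simp add: shifted_energy_def d)
    qed
    ultimately show "\<exists>v. (\<forall>i<5. d_O_star_eqn lam i s v = 0) \<and>
      w3_plus lam s * (2 * (Re (d_areas_ratio lam s v) - Re (Y2 v)) + (w3_plus lam s * d_w3 v + d_w3 v * w3_minus lam s))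
      + d_w3 v * energy_rest lam s + (4 * tau s * (d_w3 v + Re (d_zeta s v)) + 4 * (2 * tau s * Re (dlog_w1 s v)) * (w3_minus lam s + Re (zeta s))) \<noteq> 0"
      using v(1) by metis
  qed (auto simp: Z_def)
  have N3: "negligible {x \<in> V. \<psi> x \<in> {s \<in> Z. shifted_energy lam s = 0 \<and> w3_plus lam s \<noteq> lam \<and> Re (zeta s) \<noteq> 0}}"
  proof (rule negl)
    fix s assume s: "s \<in> {s \<in> Z. shifted_energy lam s = 0 \<and> w3_plus lam s \<noteq> lam \<and> Re (zeta s) \<noteq> 0}"
    then have sO: "s \<in> ?O" and sZ: "s \<in> Z" by (auto simp: Z_def)
    show "(\<lambda>s. ?c s ^ 4 - 16 * a\<^sup>2 * b\<^sup>2) s = 0"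
      using degeneracy_identity[OF sO] s by (simp add: Z_def)
    show "((\<lambda>s. ?c s ^ 4 - 16 * a\<^sup>2 * b\<^sup>2) has_derivative (\<lambda>v. 4 * ?c s ^ 3 * Re (d_areas_ratio lam s v))) (at s)"
      by (rule has_derivative_eq_rhs, (rule has_derivative_diff has_derivative_power
           has_derivative_Re has_derivative_const areas_ratio_has_derivative[OF dom(1)[OF sZ]])+)
         (simp add: fun_eq_iff algebra_simps)
    show "\<exists>v. (\<forall>i<5. d_O_star_eqn lam i s v = 0) \<and> 4 * ?c s ^ 3 * Re (d_areas_ratio lam s v) \<noteq> 0"
      using areas_ratio_has_tangential_derivative[OF sO ab] s c0[OF sZ] by simp
  qed (auto simp: Z_def)
  have N4: "negligible {x \<in> V. \<psi> x \<in> {s \<in> Z. w3_plus lam s = lam}}"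
  proof (rule negl)
    fix s assume s: "s \<in> {s \<in> Z. w3_plus lam s = lam}"
    show "(\<lambda>s. w3_plus lam s - lam) s = 0" using s by simp
    show "((\<lambda>s. w3_plus lam s - lam) has_derivative d_w3) (at s)"
      by (rule has_derivative_eq_rhs, (rule has_derivative_diff w3_plus_has_derivative has_derivative_const)+) simp
    obtain v where v: "\<forall>i<5. d_O_star_eqn lam i s v = 0" "ham_direction lam s 1 v" using ham[of s] s by blast
    then show "\<exists>v. (\<forall>i<5. d_O_star_eqn lam i s v = 0) \<and> d_w3 v \<noteq> 0"
      by (intro exI[of _ v]) (simp add: ham_direction_def)
  qed (auto simp: Z_def)
  have N5: "negligible {x \<in> V. \<psi> x \<in> {s \<in> Z. shifted_energy lam s = 0 \<and> Re (zeta s) = 0}}"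
  proof (rule negl)
    fix s assume s: "s \<in> {s \<in> Z. shifted_energy lam s = 0 \<and> Re (zeta s) = 0}"
    show "(\<lambda>s. Re (zeta s)) s = 0" using s by simp
    show "((\<lambda>s. Re (zeta s)) has_derivative (\<lambda>v. Re (d_zeta s v))) (at s)"
      using s dom(1) by (intro has_derivative_Re zeta_has_derivative) auto
    obtain v where v: "\<forall>i<5. d_O_star_eqn lam i s v = 0" "ham_direction lam s 1 v" using ham[of s] s by blast
    have "energy_rest lam s = - 2 * tau s" "tau s > 0" using s dom(2) by (auto simp: shifted_energy_def)
    then have "Re (d_zeta s v) = 1" using v(2) by (simp add: ham_direction_def)
    then show "\<exists>v. (\<forall>i<5. d_O_star_eqn lam i s v = 0) \<and> Re (d_zeta s v) \<noteq> 0" using v(1) by (intro exI[of _ v]) simp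
  qed (auto simp: Z_def)
  have Z: "{s \<in> ?O. poisson lam (U1 lam) (U2 lam) s = 0} = Z"
    using Re_areas_ratio_nonzero[OF _ ab] by (auto simp: Z_def poisson_U1_U2)
  show "negligible {x \<in> V. \<psi> x \<in> {s \<in> ?O. poisson lam (U1 lam) (U2 lam) s = 0}}"
    unfolding Z
    by (rule negligible_subset[OF negligible_Un[OF N1 negligible_Un[OF N2 negligible_Un[OF N3 negligible_Un[OF N4 N5]]]]]) auto
qed auto


theorem proposition3:
  fixes a b lam :: real
  assumes "a > b" and "b > 0" and "lam \<noteq> 0"
  shows "O_star a b lam \<noteq> {}
    \<and> submanifold 4 (O_star a b lam)
    \<and> gyrostat_invariant lam (O_star a b lam)
    \<and> null_in4 (O_star a b lam)
        {s \<in> O_star a b lam. poisson lam (U1 lam) (U2 lam) s = 0}"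
  using O_star_nonempty O_star_submanifold[OF assms(1,2)] O_star_invariant poisson_zero_set_null[OF assms(1,2)]
  by blast

end
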